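(* Let $t\in\mathbb R\setminus\{0\}$. Let $\phi$ be an $\mathbb H_t^{n\times n}$-valued rational function analytic at the origin and satisfying $\phi(x)=-(\phi(-x))^{\circledast}$ at the real points where $\phi$ is defined, and let $\phi(x)=D+xC(I_{\mathbb H_t^N}-xA)^{-1}B$ be a minimal realization of $\phi$, with associated $\circledast$-symmetric matrix $H$. Then, up to an additive decomposition of $D-D^{\circledast}$ into two $\circledast$-anti-symmetric matrices, $$D-D^{\circledast}=M_1+M_2,\qquad M_j+M_j^{\circledast}=0,\quad j=1,2,$$ there is a one-to-one correspondence between minimal additive decompositions $\phi=\phi_1+\phi_2$ of $\phi$ in which both $\phi_1$ and $\phi_2$ satisfy $\phi_j(x)=-(\phi_j(-x))^{\circledast}$, and $A$-invariant subspaces of $\mathbb H_t^N$ which are non-degenerate with respect to $H$.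
   Context: For real $t\neq 0$, $\mathbb H_t$ is the real associative algebra of elements $q=a+bj_t$ with $a,b\in\mathbb C$, where $\mathbb C\subset\mathbb H_t$, $j_t^2=t$ and $j_t a=\overline a\, j_t$ for $a\in\mathbb C$. Let $I(a+bj_t)=\begin{pmatrix}a&tb\\ \overline b&\overline a\end{pmatrix}$ and $q^{\circledast}=\overline a-bj_t$ for $q=a+bj_t$; for a matrix $M=(m_{jk})$ over $\mathbb H_t$, $M^{\circledast}$ is the matrix with $(j,k)$ entry $m_{kj}^{\circledast}$. $M$ is $\circledast$-symmetric if $M=M^{\circledast}$ and $\circledast$-anti-symmetric if $M=-M^{\circledast}$. $I_{\mathbb H_t^N}$ is the identity matrix. The variable $x$ is real. An $\mathbb H_t^{n\times n}$-valued function $\phi$ of $x$, defined at $0$, is rational if $\phi(x)=D+xC(I_{\mathbb H_t^N}-xA)^{-1}B$ with $D=\phi(0)$ and $(C,A,B)\in\mathbb H_t^{n\times N}\times\mathbb H_t^{N\times N}\times\mathbb H_t^{N\times n}$ (a realization). $(C,A)$ is observable if for $h\in\mathbb H_t^N$: $C(I_{\mathbb H_t^N}-xA)^{-1}h=0$ on some interval $(-\varepsilon,\varepsilon)$ iff $h=0$. $(A,B)$ is controllable if for $h\in\mathbb H_t^{1\times N}$: $hA^kB=0$ for all $k\ge 0$ iff $h=0$. The realization is minimal if $(C,A)$ is observable and $(A,B)$ is controllable; then the degree of $\phi$ is $N$. An additive decomposition $\phi=\phi_1+\phi_2$ into $\mathbb H_t^{n\times n}$-valued rational functions is minimal if the degrees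 of $\phi_1$ and $\phi_2$ add up to the degree of $\phi$. The associated $\circledast$-symmetric matrix $H\in\mathbb H_t^{N\times N}$ is the unique invertible $\circledast$-symmetric matrix with $A^{\circledast}H+HA=0$ and $B=H^{-1}C^{\circledast}$. For $f,g\in\mathbb H_t^N$, $[f,g]_{\circledast}=\sum_{k=1}^N\operatorname{Tr}\big(I(f_k^{\circledast})I(g_k)\big)$ and $[f,g]_H=[f,Hg]_{\circledast}$. Subspaces of $\mathbb H_t^N$ are right $\mathbb H_t$-submodules. A subspace $\mathcal M$ is non-degenerate with respect to $H$ if $\mathcal M\cap\mathcal M^{\perp_H}=\{0\}$, where $\mathcal M^{\perp_H}=\{f\in\mathbb H_t^N:[f,m]_H=0\ \forall m\in\mathcal M\}$. *)

theory Defs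
  imports "Jordan_Normal_Form.Matrix" "HOL-Analysis.Product_Vector"
begin

text \<open>
  The pair \<open>(a, b)\<close> stands for \<open>a + b j\<^sub>t\<close>. The real vector space structure is that of the
  product type; only the multiplication depends on the parameter \<open>t\<close>, by
  \<open>(a + b j\<^sub>t) (c + d j\<^sub>t) = (a c + t b (cnj d)) + (a d + b (cnj c)) j\<^sub>t\<close>.
\<close>

type_synonym hq = "complex \<times> complex"

definition hq_mult :: "real \<Rightarrow> hq \<Rightarrow> hq \<Rightarrow> hq" where
  "hq_mult t p q =
     (fst p * fst q + of_real t * snd p * cnj (snd q), fst p * snd q + snd p * cnj (fst q))"

definition hq_one :: hq where
  "hq_one = (1, 0)"

definition hq_conj :: "hq \<Rightarrow> hq" where
  "hq_conj q = (cnj (fst q), - snd q)"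

definition hq_I :: "real \<Rightarrow> hq \<Rightarrow> complex mat" where
  "hq_I t q = mat_of_rows_list 2 [[fst q, of_real t * snd q], [cnj (snd q), cnj (fst q)]]"

lemma hq_mult_j_j: "hq_mult t (0, 1) (0, 1) = t *\<^sub>R hq_one"
  by (simp add: hq_mult_def hq_one_def of_real_def)

lemma hq_mult_j_complex: "hq_mult t (0, 1) (a, 0) = hq_mult t (cnj a, 0) (0, 1)"
  by (simp add: hq_mult_def)

lemma hq_mult_complex_j: "(a, b) = (a, 0) + hq_mult t (b, 0) (0, 1)"
  by (simp add: hq_mult_def)

lemma hq_mult_complex: "hq_mult t (a, 0) (c, 0) = (a * c, 0)"
  by (simp add: hq_mult_def)

lemma hq_mult_assoc: "hq_mult t (hq_mult t p q) r = hq_mult t p (hq_mult t q r)"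
  by (simp add: hq_mult_def algebra_simps)

lemma hq_one_mult [simp]: "hq_mult t hq_one q = q" "hq_mult t q hq_one = q"
  by (simp_all add: hq_mult_def hq_one_def)

text \<open>
  The matrix product of the library is not available since it takes the multiplication of the
  entries from a type class, whereas here it depends on \<open>t\<close>. Columns in the
  \<open>N\<close>-dimensional space are matrices in \<open>carrier_mat N 1\<close>.
\<close>

definition hmat_mult :: "real \<Rightarrow> hq mat \<Rightarrow> hq mat \<Rightarrow> hq mat" where
  "hmat_mult t A B = mat (dim_row A) (dim_col B)
     (\<lambda>(i, j). \<Sum>k<dim_col A. hq_mult t (A $$ (i, k)) (B $$ (k, j)))"

abbreviation hmat_mult_syntax :: "hq mat \<Rightarrow> real \<Rightarrow> hq mat \<Rightarrow> hq mat"
    ("_ \<odot>\<^bsub>_\<^esub> _" [70, 0, 71] 70) where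
  "A \<odot>\<^bsub>t\<^esub> B \<equiv> hmat_mult t A B"

definition hmat_one :: "nat \<Rightarrow> hq mat" where
  "hmat_one N = mat N N (\<lambda>(i, j). if i = j then hq_one else 0)"

definition hmat_scaleR :: "real \<Rightarrow> hq mat \<Rightarrow> hq mat" where
  "hmat_scaleR x A = map_mat (\<lambda>q. x *\<^sub>R q) A"

definition hmat_adj :: "hq mat \<Rightarrow> hq mat" where
  "hmat_adj M = map_mat hq_conj (transpose_mat M)"

primrec hmat_pow :: "real \<Rightarrow> hq mat \<Rightarrow> nat \<Rightarrow> hq mat" where
  "hmat_pow t A 0 = hmat_one (dim_row A)"
| "hmat_pow t A (Suc k) = hmat_pow t A k \<odot>\<^bsub>t\<^esub> A"

definition hmat_is_inverse :: "real \<Rightarrow> hq mat \<Rightarrow> hq mat \<Rightarrow> bool" where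
  "hmat_is_inverse t A X \<longleftrightarrow>
     (\<exists>N. A \<in> carrier_mat N N \<and> X \<in> carrier_mat N N \<and>
          A \<odot>\<^bsub>t\<^esub> X = hmat_one N \<and> X \<odot>\<^bsub>t\<^esub> A = hmat_one N)"

definition hmat_invertible :: "real \<Rightarrow> hq mat \<Rightarrow> bool" where
  "hmat_invertible t A \<longleftrightarrow> (\<exists>X. hmat_is_inverse t A X)"

definition hmat_inv :: "real \<Rightarrow> hq mat \<Rightarrow> hq mat" where
  "hmat_inv t A = (THE X. hmat_is_inverse t A X)"

definition hmat_symmetric :: "hq mat \<Rightarrow> bool" where
  "hmat_symmetric M \<longleftrightarrow> M = hmat_adj M"

definition hmat_antisymmetric :: "hq mat \<Rightarrow> bool" where
  "hmat_antisymmetric M \<longleftrightarrow> M = - hmat_adj M"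

text \<open>
  Functions of the real variable are partial functions, so that the points at which a function is
  defined are part of it. The function given by \<open>D + x C (I - x A)\<^sup>-\<^sup>1 B\<close> is defined
  exactly where \<open>I - x A\<close> is invertible. Two minimal realizations of the same function
  near the origin are similar and hence define the same partial function; for the functions that
  have a degree in the sense below, equality of partial functions is therefore equality of rational
  functions.
\<close>

type_synonym hfun = "real \<Rightarrow> hq mat option"

definition pencil :: "hq mat \<Rightarrow> real \<Rightarrow> hq mat" where
  "pencil A x = hmat_one (dim_row A) - hmat_scaleR x A"

definition transfer_fun :: "real \<Rightarrow> hq mat \<Rightarrow> hq mat \<Rightarrow> hq mat \<Rightarrow> hq mat \<Rightarrow> hfun" where
  "transfer_fun t D C A B x =
     (if hmat_invertible t (pencil A x)
      then Some (D + hmat_scaleR x (C \<odot>\<^bsub>t\<^esub> hmat_inv t (pencil A x) \<odot>\<^bsub>t\<^esub> B))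
      else None)"

definition realization ::
    "real \<Rightarrow> nat \<Rightarrow> nat \<Rightarrow> hfun \<Rightarrow> hq mat \<Rightarrow> hq mat \<Rightarrow> hq mat \<Rightarrow> hq mat \<Rightarrow> bool" where
  "realization t n N \<phi> D C A B \<longleftrightarrow>
     D \<in> carrier_mat n n \<and> C \<in> carrier_mat n N \<and> A \<in> carrier_mat N N \<and> B \<in> carrier_mat N n \<and>
     \<phi> = transfer_fun t D C A B"

definition rational_hfun :: "real \<Rightarrow> nat \<Rightarrow> hfun \<Rightarrow> bool" where
  "rational_hfun t n \<phi> \<longleftrightarrow> (\<exists>N D C A B. realization t n N \<phi> D C A B)"

definition observable :: "real \<Rightarrow> nat \<Rightarrow> nat \<Rightarrow> hq mat \<Rightarrow> hq mat \<Rightarrow> bool" where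
  "observable t n N C A \<longleftrightarrow>
     (\<forall>h \<in> carrier_mat N 1.
        (\<exists>\<epsilon>>0. \<forall>x\<in>{-\<epsilon><..<\<epsilon>}. C \<odot>\<^bsub>t\<^esub> hmat_inv t (pencil A x) \<odot>\<^bsub>t\<^esub> h = 0\<^sub>m n 1)
        \<longleftrightarrow> h = 0\<^sub>m N 1)"

definition controllable :: "real \<Rightarrow> nat \<Rightarrow> nat \<Rightarrow> hq mat \<Rightarrow> hq mat \<Rightarrow> bool" where
  "controllable t n N A B \<longleftrightarrow>
     (\<forall>h \<in> carrier_mat 1 N.
        (\<forall>k. h \<odot>\<^bsub>t\<^esub> hmat_pow t A k \<odot>\<^bsub>t\<^esub> B = 0\<^sub>m 1 n) \<longleftrightarrow> h = 0\<^sub>m 1 N)"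

definition minimal_realization ::
    "real \<Rightarrow> nat \<Rightarrow> nat \<Rightarrow> hfun \<Rightarrow> hq mat \<Rightarrow> hq mat \<Rightarrow> hq mat \<Rightarrow> hq mat \<Rightarrow> bool" where
  "minimal_realization t n N \<phi> D C A B \<longleftrightarrow>
     realization t n N \<phi> D C A B \<and> observable t n N C A \<and> controllable t n N A B"

definition has_degree :: "real \<Rightarrow> nat \<Rightarrow> hfun \<Rightarrow> nat \<Rightarrow> bool" where
  "has_degree t n \<phi> N \<longleftrightarrow> (\<exists>D C A B. minimal_realization t n N \<phi> D C A B)"

text \<open>
  A sum of rational functions may extend to points at which the summands have poles, so the
  identity \<open>\<phi> = \<phi>\<^sub>1 + \<phi>\<^sub>2\<close> is required wherever all three functions are defined.
\<close>

definition additive_decomposition :: "real \<Rightarrow> nat \<Rightarrow> hfun \<Rightarrow> hfun \<Rightarrow> hfun \<Rightarrow> bool" where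
  "additive_decomposition t n \<phi> \<phi>1 \<phi>2 \<longleftrightarrow>
     rational_hfun t n \<phi>1 \<and> rational_hfun t n \<phi>2 \<and>
     (\<forall>x Y Y1 Y2. \<phi> x = Some Y \<longrightarrow> \<phi>1 x = Some Y1 \<longrightarrow> \<phi>2 x = Some Y2 \<longrightarrow> Y = Y1 + Y2)"

definition minimal_decomposition :: "real \<Rightarrow> nat \<Rightarrow> hfun \<Rightarrow> hfun \<Rightarrow> hfun \<Rightarrow> bool" where
  "minimal_decomposition t n \<phi> \<phi>1 \<phi>2 \<longleftrightarrow>
     additive_decomposition t n \<phi> \<phi>1 \<phi>2 \<and>
     (\<exists>N1 N2. has_degree t n \<phi>1 N1 \<and> has_degree t n \<phi>2 N2 \<and> has_degree t n \<phi> (N1 + N2))"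

definition odd_antisymmetric :: "hfun \<Rightarrow> bool" where
  "odd_antisymmetric \<phi> \<longleftrightarrow>
     (\<forall>x Y Z. \<phi> x = Some Y \<longrightarrow> \<phi> (- x) = Some Z \<longrightarrow> Y = - hmat_adj Z)"

definition associated_matrix ::
    "real \<Rightarrow> nat \<Rightarrow> hq mat \<Rightarrow> hq mat \<Rightarrow> hq mat \<Rightarrow> hq mat \<Rightarrow> bool" where
  "associated_matrix t N C A B H \<longleftrightarrow>
     H \<in> carrier_mat N N \<and> hmat_invertible t H \<and> hmat_symmetric H \<and>
     hmat_adj A \<odot>\<^bsub>t\<^esub> H + H \<odot>\<^bsub>t\<^esub> A = 0\<^sub>m N N \<and>
     B = hmat_inv t H \<odot>\<^bsub>t\<^esub> hmat_adj C"

definition hform :: "real \<Rightarrow> nat \<Rightarrow> hq mat \<Rightarrow> hq mat \<Rightarrow> complex" where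
  "hform t N f g =
     (\<Sum>k<N. \<Sum>i<2. (hq_I t (hq_conj (f $$ (k, 0))) * hq_I t (g $$ (k, 0))) $$ (i, i))"

definition hform_H :: "real \<Rightarrow> nat \<Rightarrow> hq mat \<Rightarrow> hq mat \<Rightarrow> hq mat \<Rightarrow> complex" where
  "hform_H t N H f g = hform t N f (H \<odot>\<^bsub>t\<^esub> g)"

definition right_subspace :: "real \<Rightarrow> nat \<Rightarrow> hq mat set \<Rightarrow> bool" where
  "right_subspace t N W \<longleftrightarrow>
     W \<subseteq> carrier_mat N 1 \<and> 0\<^sub>m N 1 \<in> W \<and>
     (\<forall>f\<in>W. \<forall>g\<in>W. f + g \<in> W) \<and> (\<forall>f\<in>W. \<forall>q. map_mat (\<lambda>p. hq_mult t p q) f \<in> W)"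

definition invariant_under :: "real \<Rightarrow> hq mat \<Rightarrow> hq mat set \<Rightarrow> bool" where
  "invariant_under t A W \<longleftrightarrow> (\<forall>f\<in>W. A \<odot>\<^bsub>t\<^esub> f \<in> W)"

definition perp_H :: "real \<Rightarrow> nat \<Rightarrow> hq mat \<Rightarrow> hq mat set \<Rightarrow> hq mat set" where
  "perp_H t N H W = {f \<in> carrier_mat N 1. \<forall>m\<in>W. hform_H t N H f m = 0}"

definition nondegenerate_H :: "real \<Rightarrow> nat \<Rightarrow> hq mat \<Rightarrow> hq mat set \<Rightarrow> bool" where
  "nondegenerate_H t N H W \<longleftrightarrow> W \<inter> perp_H t N H W = {0\<^sub>m N 1}"

text \<open>
  \<open>H_projection t N H W\<close> is the matrix \<open>P\<close> of the projection onto \<open>W\<close> along its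
  \<open>H\<close>-orthogonal complement; it exists and is unique for non-degenerate \<open>W\<close>.
\<close>

definition H_projection :: "real \<Rightarrow> nat \<Rightarrow> hq mat \<Rightarrow> hq mat set \<Rightarrow> hq mat" where
  "H_projection t N H W =
     (THE P. P \<in> carrier_mat N N \<and> (\<forall>f\<in>W. P \<odot>\<^bsub>t\<^esub> f = f) \<and>
             (\<forall>f\<in>perp_H t N H W. P \<odot>\<^bsub>t\<^esub> f = 0\<^sub>m N 1))"

text \<open>
  If \<open>P\<close> projects onto \<open>W\<close>, then \<open>(C P, P A P, P B)\<close> is the compression to \<open>W\<close>. With
  respect to the splitting by \<open>P\<close>, the matrix \<open>I - x P A P\<close> is the direct sum of
  \<open>I - x A\<close> compressed to \<open>W\<close> and an identity, so the function below, domain included, is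
  the transfer function of the restriction of the system to \<open>W\<close>, written without choosing a basis
  of \<open>W\<close>.
\<close>

definition compressed_fun :: "real \<Rightarrow> hq mat \<Rightarrow> hq mat \<Rightarrow> hq mat \<Rightarrow> hq mat \<Rightarrow> hq mat \<Rightarrow> hfun" where
  "compressed_fun t P D C A B =
     transfer_fun t D (C \<odot>\<^bsub>t\<^esub> P) (P \<odot>\<^bsub>t\<^esub> A \<odot>\<^bsub>t\<^esub> P) (P \<odot>\<^bsub>t\<^esub> B)"

text \<open>
  The summands satisfy \<open>\<phi>\<^sub>j(0) = - \<phi>\<^sub>j(0)\<^sup>\<circledast>\<close>, so \<open>\<phi>\<^sub>j(0) - \<phi>\<^sub>j(0)\<^sup>\<circledast> = M\<^sub>j\<close> amounts to
  \<open>\<phi>\<^sub>j(0) = M\<^sub>j / 2\<close>.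
\<close>

definition subspace_decomposition ::
    "real \<Rightarrow> nat \<Rightarrow> hq mat \<Rightarrow> hq mat \<Rightarrow> hq mat \<Rightarrow> hq mat \<Rightarrow> hq mat \<Rightarrow> hq mat \<Rightarrow> hq mat set \<Rightarrow>
     hfun \<times> hfun" where
  "subspace_decomposition t N C A B H M1 M2 W =
     (let P = H_projection t N H W in
      (compressed_fun t P (hmat_scaleR (1/2) M1) C A B,
       compressed_fun t (hmat_one N - P) (hmat_scaleR (1/2) M2) C A B))"

end

theory Submission
  imports Defs
begin

text \<open>
  Write \<open>\<HH>\<close> for the algebra with parameter \<open>t\<close>. Let \<open>W\<close> be a subspace that is invariant under
  \<open>A\<close> and non-degenerate, and let \<open>P\<close> be the \<open>H\<close>-orthogonal projection onto \<open>W\<close>. The relation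
  \<open>A\<^sup>\<circledast> H + H A = 0\<close> makes the orthogonal complement of \<open>W\<close> invariant as well
  (\<open>invariant_imp_commute\<close>), so \<open>P\<close> commutes with \<open>A\<close>. The term \<open>C (I - x A)\<^sup>-\<^sup>1 B\<close> then splits
  into \<open>C (I - x A)\<^sup>-\<^sup>1 P B\<close> and \<open>C (I - x A)\<^sup>-\<^sup>1 (I - P) B\<close>. Each part comes from a compression of the
  system, and the compression inherits both the relation with \<open>H\<close>, hence the oddness, and
  minimality. The ranks of \<open>P\<close> and \<open>I - P\<close> add up to \<open>N\<close>, so the decomposition is minimal.

  Conversely, the direct sum of minimal realizations of two summands realizes \<open>\<phi>\<close> with the minimal
  dimension \<open>N\<close>. It is therefore similar to the given realization (\<open>state_space_embedding\<close>), and the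
  similarity carries the projection onto the first summand to a projection \<open>P\<close> that commutes with
  \<open>A\<close> (\<open>additive_state_space\<close>). Observability and controllability imply that a matrix \<open>Z\<close> is
  determined by all products \<open>C A\<^sup>k Z A\<^sup>l B\<close> (\<open>sandwich_unique\<close>). If the first summand is odd,
  \<open>P\<close> and its \<open>H\<close>-adjoint \<open>H\<^sup>-\<^sup>1 P\<^sup>\<circledast> H\<close> have the same products, so \<open>P\<close> is an
  \<open>H\<close>-orthogonal projection and its range is the required \<open>W\<close> (\<open>odd_summand_projection\<close>). The same
  uniqueness shows that different subspaces give different summands.

  For \<open>t > 0\<close> the algebra has zero divisors and submodules of \<open>\<HH>\<^sup>N\<close> need not be free. Three devices
  treat both signs of \<open>t\<close> alike. Square matrices are inverted, and ranks compared, by counting real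
  dimensions. Observability yields an invertible Gram matrix by means of a second, positive involution
  of the algebra. Finally, a non-degenerate subspace is always free, because Gram-Schmidt
  orthogonalization never gets stuck: \<open>f\<^sup>\<circledast> H f\<close> is a real number for a column \<open>f\<close>, and if it
  vanishes on all of a subspace, then by polarization the subspace is isotropic
  (\<open>nondegenerate_frame\<close>).
\<close>

(* Columns are matrices with 1 column; with Suc 0 their carriers would no longer match. *)
declare One_nat_def [simp del]

section \<open>Real linear dependence\<close>

text \<open>
  Gaussian elimination: a vector with a non-zero \<open>i\<close>-th entry is used to clear the \<open>i\<close>-th entries of
  the others, which costs one equation and one vector.
\<close>

lemma real_dependency:
  fixes f :: "'k \<Rightarrow> 'i \<Rightarrow> real"
  assumes "finite I" "finite K" "card I < card K"
  shows "\<exists>c. (\<exists>k\<in>K. c k \<noteq> 0) \<and> (\<forall>i\<in>I. (\<Sum>k\<in>K. c k * f k i) = 0)"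
  using assms
proof (induction I arbitrary: K f rule: finite_induct)
  case empty
  then have "K \<noteq> {}" by auto
  then show ?case by (intro exI[of _ "\<lambda>_. 1"]) auto
next
  case (insert i I)
  show ?case
  proof (cases "\<forall>k\<in>K. f k i = 0")
    case True
    have "card I < card K" using insert by simp
    from insert.IH[OF insert.prems(1) this, of f] obtain c where
      "\<exists>k\<in>K. c k \<noteq> 0" "\<forall>i\<in>I. (\<Sum>k\<in>K. c k * f k i) = 0" by blast
    then show ?thesis using True by (intro exI[of _ c]) auto
  next
    case False
    then obtain p where p: "p \<in> K" "f p i \<noteq> 0" by blast
    define f' where "f' k j = f k j - (f k i / f p i) * f p j" for k j
    have "card I < card (K - {p})" using insert p by simp
    from insert.IH[OF _ this, of f'] insert.prems(1) obtain c where
      c: "\<exists>k\<in>K - {p}. c k \<noteq> 0" "\<forall>i\<in>I. (\<Sum>k\<in>K - {p}. c k * f' k i) = 0" by auto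
    define d where "d k = (if k = p then - (\<Sum>k\<in>K - {p}. c k * f k i / f p i) else c k)" for k
    have d: "(\<Sum>k\<in>K. d k * f k j) = (\<Sum>k\<in>K - {p}. c k * f' k j)" for j
    proof -
      have "(\<Sum>k\<in>K. d k * f k j) = d p * f p j + (\<Sum>k\<in>K - {p}. c k * f k j)"
        using insert.prems(1) p(1) by (simp add: sum.remove[of K p] d_def)
      also have "\<dots> = (\<Sum>k\<in>K - {p}. c k * f' k j)"
        by (simp add: d_def f'_def sum_distrib_right sum_subtractf sum_distrib_left algebra_simps sum_negf)
      finally show ?thesis .
    qed
    have "f' k i = 0" for k using p by (simp add: f'_def)
    then have "\<forall>j\<in>insert i I. (\<Sum>k\<in>K. d k * f k j) = 0" using c(2) by (simp add: d)
    moreover have "\<exists>k\<in>K. d k \<noteq> 0" using c(1) by (auto simp: d_def)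
    ultimately show ?thesis by blast
  qed
qed

text \<open>
  An equation between elements of the algebra consists of four real ones.
\<close>

lemma hq_dependency:
  fixes f :: "'k \<Rightarrow> 'i \<Rightarrow> hq"
  assumes "finite I" "finite K" "4 * card I < card K"
  shows "\<exists>c. (\<exists>k\<in>K. c k \<noteq> 0) \<and> (\<forall>i\<in>I. (\<Sum>k\<in>K. c k *\<^sub>R f k i) = 0)"
proof -
  define coord :: "hq \<Rightarrow> nat \<Rightarrow> real" where
    "coord q s = [Re (fst q), Im (fst q), Re (snd q), Im (snd q)] ! s" for q s
  have "card (I \<times> {..<4::nat}) < card K"
    using assms by (simp add: card_cartesian_product mult.commute)
  from real_dependency[OF _ assms(2) this, of "\<lambda>k (i, s). coord (f k i) s"] assms(1)
  obtain c where c: "\<exists>k\<in>K. c k \<noteq> 0"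
    "\<And>i s. i \<in> I \<Longrightarrow> s < 4 \<Longrightarrow> (\<Sum>k\<in>K. c k * coord (f k i) s) = 0" by auto
  have "(\<Sum>k\<in>K. c k *\<^sub>R f k i) = 0" if "i \<in> I" for i
    using c(2)[OF that, of 0] c(2)[OF that, of 1] c(2)[OF that, of 2] c(2)[OF that, of 3]
    by (auto simp: coord_def prod_eq_iff complex_eq_iff fst_sum snd_sum)
  then show ?thesis using c(1) by blast
qed

section \<open>Matrix algebra\<close>

notation hmat_adj ("_\<^sup>\<circledast>" [1000] 1000)
notation hmat_scaleR (infixr "*\<^sub>H" 75)

locale generalized_quaternions =
  fixes t :: real
  assumes t_nonzero: "t \<noteq> 0"
begin

abbreviation hmat_prod :: "hq mat \<Rightarrow> hq mat \<Rightarrow> hq mat" (infixl "**" 70) where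
  "A ** B \<equiv> A \<odot>\<^bsub>t\<^esub> B"

abbreviation qmult :: "hq \<Rightarrow> hq \<Rightarrow> hq" (infixl "\<diamondop>" 70) where
  "p \<diamondop> q \<equiv> hq_mult t p q"

lemma norm_hq_mult_le: "norm (p \<diamondop> q) \<le> norm p * norm q * (3 + \<bar>t\<bar>)"
proof -
  have fst_le: "cmod (fst r) \<le> norm r" and snd_le: "cmod (snd r) \<le> norm r" for r :: hq
    using norm_fst_le[of "fst r" "snd r"] norm_snd_le[of "snd r" "fst r"] by simp_all
  have "norm (p \<diamondop> q) \<le> cmod (fst (p \<diamondop> q)) + cmod (snd (p \<diamondop> q))"
    by (metis norm_Pair_le prod.collapse)
  also have "\<dots> \<le> (cmod (fst p) * cmod (fst q) + \<bar>t\<bar> * (cmod (snd p) * cmod (snd q)))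
      + (cmod (fst p) * cmod (snd q) + cmod (snd p) * cmod (fst q))"
    unfolding hq_mult_def fst_conv snd_conv
    by (intro add_mono norm_triangle_le) (simp_all add: norm_mult mult.assoc)
  also have "\<dots> \<le> (norm p * norm q + \<bar>t\<bar> * (norm p * norm q))
      + (norm p * norm q + norm p * norm q)"
    by (intro add_mono mult_mono mult_left_mono fst_le snd_le) auto
  finally show ?thesis
    by (simp add: algebra_simps)
qed

sublocale qmult: bounded_bilinear "hq_mult t"
proof
  show "\<exists>K. \<forall>a b. norm (a \<diamondop> b) \<le> norm a * norm b * K"
    using norm_hq_mult_le by blast
qed (auto simp: hq_mult_def algebra_simps scaleR_conv_of_real)

lemma hq_conj_mult: "hq_conj (p \<diamondop> q) = hq_conj q \<diamondop> hq_conj p"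
  by (simp add: hq_conj_def hq_mult_def algebra_simps)

lemma hq_conj_additive: "additive hq_conj"
  by (standard) (simp add: hq_conj_def)

lemma hq_conj_simps [simp]:
  "hq_conj 0 = 0" "hq_conj (p + q) = hq_conj p + hq_conj q" "hq_conj (p - q) = hq_conj p - hq_conj q"
  "hq_conj (- p) = - hq_conj p" "hq_conj (hq_conj p) = p" "hq_conj hq_one = hq_one"
  "hq_conj (x *\<^sub>R p) = x *\<^sub>R hq_conj p"
  by (auto simp: hq_conj_def hq_one_def complex_eq_iff prod_eq_iff)

lemma hq_conj_sum: "hq_conj (\<Sum>i\<in>S. f i) = (\<Sum>i\<in>S. hq_conj (f i))"
  using additive.sum[OF hq_conj_additive] by blast

lemma dim_hmat [simp]:
  "dim_row (A ** B) = dim_row A" "dim_col (A ** B) = dim_col B"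
  "dim_row (hmat_one N) = N" "dim_col (hmat_one N) = N"
  "dim_row (x *\<^sub>H A) = dim_row A" "dim_col (x *\<^sub>H A) = dim_col A"
  "dim_row (A\<^sup>\<circledast>) = dim_col A" "dim_col (A\<^sup>\<circledast>) = dim_row A"
  by (simp_all add: hmat_mult_def hmat_one_def hmat_scaleR_def hmat_adj_def)

lemma carrier_hmat [simp, intro]:
  "A \<in> carrier_mat a b \<Longrightarrow> B \<in> carrier_mat b c \<Longrightarrow> A ** B \<in> carrier_mat a c"
  "hmat_one N \<in> carrier_mat N N"
  "A \<in> carrier_mat a b \<Longrightarrow> x *\<^sub>H A \<in> carrier_mat a b"
  "A \<in> carrier_mat a b \<Longrightarrow> A\<^sup>\<circledast> \<in> carrier_mat b a"
  by (auto intro!: carrier_matI)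

lemma index_hmat [simp]:
  "i < dim_row A \<Longrightarrow> j < dim_col B \<Longrightarrow> (A ** B) $$ (i, j) = (\<Sum>k<dim_col A. A $$ (i, k) \<diamondop> B $$ (k, j))"
  "i < N \<Longrightarrow> j < N \<Longrightarrow> hmat_one N $$ (i, j) = (if i = j then hq_one else 0)"
  "i < dim_row A \<Longrightarrow> j < dim_col A \<Longrightarrow> (x *\<^sub>H A) $$ (i, j) = x *\<^sub>R A $$ (i, j)"
  "i < dim_col A \<Longrightarrow> j < dim_row A \<Longrightarrow> A\<^sup>\<circledast> $$ (i, j) = hq_conj (A $$ (j, i))"
  by (simp_all add: hmat_mult_def hmat_one_def hmat_scaleR_def hmat_adj_def)

lemma hmat_assoc:
  assumes "dim_col A = dim_row B"
  shows "(A ** B) ** C = A ** (B ** C)"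
proof (rule eq_matI)
  fix i j assume ij: "i < dim_row (A ** (B ** C))" "j < dim_col (A ** (B ** C))"
  have "((A ** B) ** C) $$ (i, j)
      = (\<Sum>k<dim_col B. \<Sum>l<dim_col A. A $$ (i, l) \<diamondop> (B $$ (l, k) \<diamondop> C $$ (k, j)))"
    using ij by (simp add: qmult.sum_left hq_mult_assoc)
  also have "\<dots> = (\<Sum>l<dim_col A. \<Sum>k<dim_col B. A $$ (i, l) \<diamondop> (B $$ (l, k) \<diamondop> C $$ (k, j)))"
    by (rule sum.swap)
  also have "\<dots> = (A ** (B ** C)) $$ (i, j)"
    using ij assms by (simp add: qmult.sum_right)
  finally show "((A ** B) ** C) $$ (i, j) = (A ** (B ** C)) $$ (i, j)" .
qed auto

lemma hmat_one_left [simp]: "dim_row A = N \<Longrightarrow> hmat_one N ** A = A"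
  by (rule eq_matI)
     (auto simp: if_distrib[where f="\<lambda>p. p \<diamondop> _"] qmult.zero_left sum.delta cong: if_cong)

lemma hmat_one_right [simp]: "dim_col A = N \<Longrightarrow> A ** hmat_one N = A"
  by (rule eq_matI)
     (auto simp: if_distrib[where f="\<lambda>p. _ \<diamondop> p"] qmult.zero_right sum.delta' cong: if_cong)

lemma hmat_add_left: "dim_row A = dim_row B \<Longrightarrow> dim_col A = dim_col B \<Longrightarrow> (A + B) ** C = A ** C + B ** C"
  by (rule eq_matI) (auto simp: qmult.add_left sum.distrib)

lemma hmat_add_right:
  "dim_col A = dim_row B \<Longrightarrow> dim_row B = dim_row C \<Longrightarrow> dim_col B = dim_col C \<Longrightarrow> A ** (B + C) = A ** B + A ** C"
  by (rule eq_matI) (auto simp: qmult.add_right sum.distrib)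

lemma hmat_diff_left: "dim_row A = dim_row B \<Longrightarrow> dim_col A = dim_col B \<Longrightarrow> (A - B) ** C = A ** C - B ** C"
  by (rule eq_matI) (auto simp: qmult.diff_left sum_subtractf)

lemma hmat_diff_right:
  "dim_col A = dim_row B \<Longrightarrow> dim_row B = dim_row C \<Longrightarrow> dim_col B = dim_col C \<Longrightarrow> A ** (B - C) = A ** B - A ** C"
  by (rule eq_matI) (auto simp: qmult.diff_right sum_subtractf)

lemma hmat_uminus_left [simp]: "(- A) ** B = - (A ** B)"
  by (rule eq_matI) (auto simp: qmult.minus_left sum_negf)

lemma hmat_uminus_right [simp]: "dim_col A = dim_row B \<Longrightarrow> A ** (- B) = - (A ** B)"
  by (rule eq_matI) (auto simp: qmult.minus_right sum_negf)

lemma hmat_scaleR_left [simp]: "(x *\<^sub>H A) ** B = x *\<^sub>H (A ** B)"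
  by (rule eq_matI) (auto simp: qmult.scaleR_left scaleR_sum_right)

lemma hmat_scaleR_right [simp]: "dim_col A = dim_row B \<Longrightarrow> A ** (x *\<^sub>H B) = x *\<^sub>H (A ** B)"
  by (rule eq_matI) (auto simp: qmult.scaleR_right scaleR_sum_right)

lemma hmat_zero_left [simp]: "0\<^sub>m a b ** A = 0\<^sub>m a (dim_col A)"
  by (rule eq_matI) (auto simp: qmult.zero_left)

lemma hmat_zero_right [simp]: "dim_col A = a \<Longrightarrow> A ** 0\<^sub>m a b = 0\<^sub>m (dim_row A) b"
  by (rule eq_matI) (auto simp: qmult.zero_right)

lemma hmat_add_zero:
  "dim_row X = a \<Longrightarrow> dim_col X = b \<Longrightarrow> X + 0\<^sub>m a b = X"
  "dim_row X = a \<Longrightarrow> dim_col X = b \<Longrightarrow> 0\<^sub>m a b + X = X" for X :: "hq mat"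
  by (auto intro!: eq_matI)

lemma diff_self_hmat [simp]: "f \<in> carrier_mat a b \<Longrightarrow> f - f = 0\<^sub>m a b" for f :: "hq mat"
  by (rule eq_matI) auto

lemma hmat_adj_mult: "dim_col A = dim_row B \<Longrightarrow> (A ** B)\<^sup>\<circledast> = B\<^sup>\<circledast> ** A\<^sup>\<circledast>"
  by (rule eq_matI) (auto simp: hq_conj_mult hq_conj_sum)

lemma hmat_adj_adj [simp]: "(A\<^sup>\<circledast>)\<^sup>\<circledast> = A"
  by (rule eq_matI) auto

lemma hmat_adj_simps [simp]:
  "(hmat_one N)\<^sup>\<circledast> = hmat_one N" "(0\<^sub>m a b)\<^sup>\<circledast> = 0\<^sub>m b a" "(- A)\<^sup>\<circledast> = - (A\<^sup>\<circledast>)"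
  "(x *\<^sub>H A)\<^sup>\<circledast> = x *\<^sub>H (A\<^sup>\<circledast>)"
  by (rule eq_matI; auto)+

lemma hmat_adj_add: "dim_row A = dim_row B \<Longrightarrow> dim_col A = dim_col B \<Longrightarrow> (A + B)\<^sup>\<circledast> = A\<^sup>\<circledast> + B\<^sup>\<circledast>"
  by (rule eq_matI) auto

lemma hmat_adj_diff: "dim_row A = dim_row B \<Longrightarrow> dim_col A = dim_col B \<Longrightarrow> (A - B)\<^sup>\<circledast> = A\<^sup>\<circledast> - B\<^sup>\<circledast>"
  by (rule eq_matI) auto

lemma hmat_adj_inject [simp]: "A\<^sup>\<circledast> = B\<^sup>\<circledast> \<longleftrightarrow> A = B"
  by (metis hmat_adj_adj)

lemma dim_hmat_pow [simp]:
  "dim_row (hmat_pow t A k) = dim_row A" "dim_row A = dim_col A \<Longrightarrow> dim_col (hmat_pow t A k) = dim_row A"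
  by (induction k) auto

lemma carrier_hmat_pow [simp, intro]: "A \<in> carrier_mat N N \<Longrightarrow> hmat_pow t A k \<in> carrier_mat N N"
  by (auto intro!: carrier_matI)

lemma hmat_pow_Suc_left: "A \<in> carrier_mat N N \<Longrightarrow> hmat_pow t A (Suc k) = A ** hmat_pow t A k"
  by (induction k) (auto simp: hmat_assoc)

lemma hmat_pow_add:
  assumes "A \<in> carrier_mat N N"
  shows "hmat_pow t A (k + l) = hmat_pow t A k ** hmat_pow t A l"
  using assms by (induction l) (auto simp: hmat_assoc)

text \<open>
  The form in which invariance is used: an intertwining relation for \<open>A\<close> and \<open>B\<close> passes to powers.
\<close>

lemma hmat_pow_intertwine:
  assumes "A \<in> carrier_mat N N" "B \<in> carrier_mat M M" "X \<in> carrier_mat N M" "A ** X = X ** B"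
  shows "hmat_pow t A k ** X = X ** hmat_pow t B k"
proof (induction k)
  case (Suc k)
  have "hmat_pow t A (Suc k) ** X = hmat_pow t A k ** (A ** X)"
    using assms by (simp add: hmat_assoc)
  also have "\<dots> = (hmat_pow t A k ** X) ** B"
    using assms by (simp add: hmat_assoc)
  also have "\<dots> = X ** hmat_pow t B (Suc k)"
    using assms by (simp add: Suc.IH hmat_assoc)
  finally show ?case .
qed (use assms in auto)

lemma hmat_pow_adj: "A \<in> carrier_mat N N \<Longrightarrow> (hmat_pow t A k)\<^sup>\<circledast> = hmat_pow t (A\<^sup>\<circledast>) k"
proof (induction k)
  case (Suc k)
  then show ?case
    by (subst hmat_pow_Suc_left[of _ N]) (auto simp: hmat_adj_mult)
qed auto

lemma hmat_scaleR_one [simp]: "1 *\<^sub>H A = A"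
  by (rule eq_matI) auto

lemma hmat_scaleR_zero [simp]: "0 *\<^sub>H A = 0\<^sub>m (dim_row A) (dim_col A)"
  by (rule eq_matI) auto

lemma hmat_scaleR_scaleR [simp]: "x *\<^sub>H (y *\<^sub>H A) = (x * y) *\<^sub>H A"
  by (rule eq_matI) auto

lemma hmat_scaleR_cancel [simp]:
  assumes "x \<noteq> 0"
  shows "x *\<^sub>H A = x *\<^sub>H B \<longleftrightarrow> A = B"
proof
  assume "x *\<^sub>H A = x *\<^sub>H B"
  then have "(1 / x) *\<^sub>H (x *\<^sub>H A) = (1 / x) *\<^sub>H (x *\<^sub>H B)" by simp
  then show "A = B" using assms by simp
qed simp

section \<open>Invertibility by counting real dimensions\<close>

lemma hmat_diff_eq_0: "A - B = 0\<^sub>m a b \<Longrightarrow> A \<in> carrier_mat a b \<Longrightarrow> B \<in> carrier_mat a b \<Longrightarrow> A = B"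
  for A B :: "hq mat"
proof (rule eq_matI)
  fix i j assume *: "A - B = 0\<^sub>m a b" "A \<in> carrier_mat a b" "B \<in> carrier_mat a b" "i < dim_row B" "j < dim_col B"
  have "A $$ (i, j) - B $$ (i, j) = (A - B) $$ (i, j)" using *(2-) by simp
  also have "\<dots> = 0" using * by simp
  finally show "A $$ (i, j) = B $$ (i, j)" by simp
qed auto

definition unit_column :: "nat \<Rightarrow> nat \<Rightarrow> hq mat" where
  "unit_column N j = mat N 1 (\<lambda>(i, _). if i = j then hq_one else 0)"

lemma unit_column_carrier [simp]: "unit_column N j \<in> carrier_mat N 1"
  by (simp add: unit_column_def)

lemma dim_unit_column [simp]: "dim_row (unit_column N j) = N" "dim_col (unit_column N j) = 1"
  by (simp_all add: unit_column_def)

lemma mult_unit_column: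
  assumes "dim_col A = N" "j < N" "i < dim_row A"
  shows "(A ** unit_column N j) $$ (i, 0) = A $$ (i, j)"
proof -
  have "(A ** unit_column N j) $$ (i, 0) = (\<Sum>k<N. A $$ (i, k) \<diamondop> (if k = j then hq_one else 0))"
    using assms by (simp add: unit_column_def)
  also have "\<dots> = A $$ (i, j)"
    using assms(2) by (simp add: if_distrib[where f="\<lambda>p. _ \<diamondop> p"] qmult.zero_right cong: if_cong)
  finally show ?thesis .
qed

lemma hmat_eqI_columns:
  assumes "A \<in> carrier_mat n N" "B \<in> carrier_mat n N"
    and "\<And>h. h \<in> carrier_mat N 1 \<Longrightarrow> A ** h = B ** h"
  shows "A = B"
proof (rule eq_matI)
  fix i j assume "i < dim_row B" "j < dim_col B"
  moreover have "A ** unit_column N j = B ** unit_column N j"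
    by (rule assms(3)) (rule unit_column_carrier)
  ultimately show "A $$ (i, j) = B $$ (i, j)"
    using assms(1,2) mult_unit_column[of A N j i] mult_unit_column[of B N j i] by simp
qed (use assms in auto)

definition hmat_injective :: "hq mat \<Rightarrow> bool" where
  "hmat_injective A \<longleftrightarrow>
     (\<forall>h \<in> carrier_mat (dim_col A) 1. A ** h = 0\<^sub>m (dim_row A) 1 \<longrightarrow> h = 0\<^sub>m (dim_col A) 1)"

lemma hmat_injectiveD:
  "hmat_injective A \<Longrightarrow> A \<in> carrier_mat M N \<Longrightarrow> h \<in> carrier_mat N 1 \<Longrightarrow> A ** h = 0\<^sub>m M 1 \<Longrightarrow> h = 0\<^sub>m N 1"
  by (auto simp: hmat_injective_def)

text \<open>
  Columns and elements in the real basis \<open>1, \<i>, j\<^sub>t, \<i> j\<^sub>t\<close>.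
\<close>

definition coord_column :: "nat \<Rightarrow> (nat \<times> nat \<Rightarrow> real) \<Rightarrow> hq mat" where
  "coord_column N c =
     mat N 1 (\<lambda>(i, _). (Complex (c (i, 0)) (c (i, 1)), Complex (c (i, 2)) (c (i, 3))))"

definition coord_unit :: "nat \<Rightarrow> hq" where
  "coord_unit s = [(1, 0), (\<i>, 0), (0, 1), (0, \<i>)] ! s"

lemma coord_column_carrier [simp]: "coord_column N c \<in> carrier_mat N 1"
  by (simp add: coord_column_def)

lemma dim_coord_column [simp]: "dim_row (coord_column N c) = N" "dim_col (coord_column N c) = 1"
  by (simp_all add: coord_column_def)

lemma coord_column_eq_0: "coord_column N c = 0\<^sub>m N 1 \<Longrightarrow> i < N \<Longrightarrow> s < 4 \<Longrightarrow> c (i, s) = 0"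
proof -
  assume "coord_column N c = 0\<^sub>m N 1" "i < N" "s < 4"
  then have "coord_column N c $$ (i, 0) = 0" by simp
  moreover have "s = 0 \<or> s = 1 \<or> s = 2 \<or> s = 3" using \<open>s < 4\<close> by auto
  ultimately show "c (i, s) = 0"
    using \<open>i < N\<close> by (auto simp: coord_column_def prod_eq_iff complex_eq_iff)
qed

lemma mult_coord_column:
  assumes "A \<in> carrier_mat M N" "i < M"
  shows "(A ** coord_column N c) $$ (i, 0) =
    (\<Sum>(k, s)\<in>{..<N} \<times> {..<4}. c (k, s) *\<^sub>R (A $$ (i, k) \<diamondop> coord_unit s))"
proof -
  have "(Complex (c (k, 0)) (c (k, 1)), Complex (c (k, 2)) (c (k, 3))) = (\<Sum>s<4. c (k, s) *\<^sub>R coord_unit s)"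
    for k
    by (simp add: numeral_eq_Suc One_nat_def coord_unit_def prod_eq_iff complex_eq_iff)
  then have "(A ** coord_column N c) $$ (i, 0)
      = (\<Sum>k<N. A $$ (i, k) \<diamondop> (\<Sum>s<4. c (k, s) *\<^sub>R coord_unit s))"
    using assms by (simp add: coord_column_def)
  then show ?thesis
    by (simp add: qmult.sum_right qmult.scaleR_right sum.cartesian_product)
qed

text \<open>
  The \<open>4 N\<close> real basis columns have images in a space of real dimension \<open>4 M\<close>; a real dependency
  between the images is a non-zero column in the kernel.
\<close>

lemma hmat_injective_imp_le:
  assumes A: "A \<in> carrier_mat M N" and inj: "hmat_injective A"
  shows "N \<le> M"
proof (rule ccontr)
  assume "\<not> N \<le> M"
  then have "4 * card {..<M} < card ({..<N} \<times> {..<4::nat})"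
    by (simp add: card_cartesian_product)
  from hq_dependency[OF _ _ this, of "\<lambda>(k, s) i. A $$ (i, k) \<diamondop> coord_unit s"]
  obtain c where c: "\<exists>k<N. \<exists>s<4. c (k, s) \<noteq> 0"
    "\<And>i. i < M \<Longrightarrow> (\<Sum>(k, s)\<in>{..<N} \<times> {..<4}. c (k, s) *\<^sub>R (A $$ (i, k) \<diamondop> coord_unit s)) = 0"
    by (auto simp: case_prod_beta)
  have "A ** coord_column N c = 0\<^sub>m M 1"
    using c(2) A by (intro eq_matI) (auto simp: mult_coord_column[OF A] simp del: index_hmat)
  then have "coord_column N c = 0\<^sub>m N 1"
    using inj A by (auto simp: hmat_injective_def)
  then show False using c(1) coord_column_eq_0 by blast
qed

text \<open>
  The images of the \<open>4 N\<close> real basis columns together with \<open>y\<close> are dependent in a space of real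
  dimension \<open>4 N\<close>. Only the coefficient of \<open>y\<close> needs to be inverted, and it is real.
\<close>

lemma hmat_injective_imp_surjective:
  assumes A: "A \<in> carrier_mat N N" and inj: "hmat_injective A" and y: "y \<in> carrier_mat N 1"
  shows "\<exists>h \<in> carrier_mat N 1. A ** h = y"
proof -
  define K where "K = insert None (Some ` ({..<N} \<times> {..<4::nat}))"
  have fin: "finite K" and card: "4 * card {..<N} < card K"
    by (auto simp: K_def card_image card_cartesian_product)
  define f where "f k i = (case k of None \<Rightarrow> y $$ (i, 0) | Some (k, s) \<Rightarrow> A $$ (i, k) \<diamondop> coord_unit s)" for k i
  from hq_dependency[OF _ fin card, of f]
  obtain d where d: "\<exists>k\<in>K. d k \<noteq> 0" "\<And>i. i < N \<Longrightarrow> (\<Sum>k\<in>K. d k *\<^sub>R f k i) = 0" by auto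
  define c where "c = d \<circ> Some"
  have eq: "d None *\<^sub>R y $$ (i, 0) + (A ** coord_column N c) $$ (i, 0) = 0" if "i < N" for i
  proof -
    have "(\<Sum>k\<in>K. d k *\<^sub>R f k i) = d None *\<^sub>R f None i + (\<Sum>k\<in>{..<N} \<times> {..<4}. d (Some k) *\<^sub>R f (Some k) i)"
      unfolding K_def by (subst sum.insert) (auto simp: sum.reindex)
    then show ?thesis using d(2)[OF that]
      by (simp add: mult_coord_column[OF A that] f_def c_def case_prod_beta del: index_hmat)
  qed
  \<comment> \<open>Otherwise the dependency would be one between the images of the basis columns alone.\<close>
  have "d None \<noteq> 0"
  proof
    assume 0: "d None = 0"
    then have "A ** coord_column N c = 0\<^sub>m N 1"
      using eq A by (intro eq_matI) (auto simp del: index_hmat)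
    then have "coord_column N c = 0\<^sub>m N 1"
      using inj A by (auto simp: hmat_injective_def)
    then have "\<And>i s. i < N \<Longrightarrow> s < 4 \<Longrightarrow> c (i, s) = 0" using coord_column_eq_0 by blast
    then show False using d(1) 0 by (auto simp: K_def c_def)
  qed
  have "A ** ((- 1 / d None) *\<^sub>H coord_column N c) = y"
  proof (rule eq_matI)
    fix i j assume ij: "i < dim_row y" "j < dim_col y"
    then have "A ** ((- 1 / d None) *\<^sub>H coord_column N c) = (- 1 / d None) *\<^sub>H (A ** coord_column N c)"
      using A by (intro hmat_scaleR_right) (auto simp: coord_column_def)
    moreover have "(A ** coord_column N c) $$ (i, 0) = - (d None *\<^sub>R y $$ (i, 0))"
      using eq[of i] ij y by (simp add: eq_neg_iff_add_eq_0 add.commute del: index_hmat)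
    moreover have "dim_col (coord_column N c) = 1" by (simp add: coord_column_def)
    ultimately show "(A ** ((- 1 / d None) *\<^sub>H coord_column N c)) $$ (i, j) = y $$ (i, j)"
      using ij y A \<open>d None \<noteq> 0\<close> by (simp del: index_hmat(1))
  qed (use A y in \<open>auto simp: coord_column_def\<close>)
  then show ?thesis by (intro bexI) auto
qed

lemma hmat_inverse_unique:
  assumes "hmat_is_inverse t A X" "hmat_is_inverse t A Y"
  shows "X = Y"
proof -
  obtain N where N: "A \<in> carrier_mat N N" "X \<in> carrier_mat N N" "Y \<in> carrier_mat N N"
    "A ** Y = hmat_one N" "X ** A = hmat_one N"
    using assms unfolding hmat_is_inverse_def by (metis carrier_matD(1))
  have "X = X ** (A ** Y)" using N by simp
  also have "\<dots> = (X ** A) ** Y" using N by (intro hmat_assoc[symmetric]) auto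
  also have "\<dots> = Y" using N by simp
  finally show ?thesis .
qed

lemma hmat_inv_eqI: "hmat_is_inverse t A X \<Longrightarrow> hmat_inv t A = X"
  unfolding hmat_inv_def using hmat_inverse_unique by blast

lemma hmat_inverse_inv: "hmat_invertible t A \<Longrightarrow> hmat_is_inverse t A (hmat_inv t A)"
  using hmat_inv_eqI by (auto simp: hmat_invertible_def)

lemma hmat_invD:
  assumes "hmat_invertible t A" "A \<in> carrier_mat N N"
  shows "hmat_inv t A \<in> carrier_mat N N" "A ** hmat_inv t A = hmat_one N" "hmat_inv t A ** A = hmat_one N"
  using hmat_inverse_inv[OF assms(1)] assms(2) by (auto simp: hmat_is_inverse_def)

lemma hmat_injective_imp_invertible:
  assumes A: "A \<in> carrier_mat N N" and inj: "hmat_injective A"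
  shows "hmat_invertible t A"
proof -
  have "\<forall>j. \<exists>h. h \<in> carrier_mat N 1 \<and> A ** h = unit_column N j"
    using hmat_injective_imp_surjective[OF assms] unit_column_carrier by blast
  then obtain x where x: "\<And>j. x j \<in> carrier_mat N 1" "\<And>j. A ** x j = unit_column N j" by metis
  define X where "X = mat N N (\<lambda>(i, j). x j $$ (i, 0))"
  have X: "X \<in> carrier_mat N N" by (simp add: X_def)
  have AX: "A ** X = hmat_one N"
  proof (rule eq_matI)
    fix i j assume ij: "i < dim_row (hmat_one N)" "j < dim_col (hmat_one N)"
    have "(A ** X) $$ (i, j) = (A ** x j) $$ (i, 0)"
      using ij A x(1)[of j] by (simp add: X_def)
    then show "(A ** X) $$ (i, j) = hmat_one N $$ (i, j)"
      using ij by (simp add: x(2) unit_column_def)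
  qed (use A X in auto)
  have "X ** A = hmat_one N"
  proof (rule hmat_eqI_columns[of _ N N])
    fix h :: "hq mat" assume h: "h \<in> carrier_mat N 1"
    have "A ** ((X ** A) ** h - h) = (A ** X) ** (A ** h) - A ** h"
      using A X h by (simp add: hmat_diff_right hmat_assoc)
    also have "\<dots> = 0\<^sub>m N 1" using A h by (auto simp: AX)
    finally have "A ** ((X ** A) ** h - h) = 0\<^sub>m N 1" .
    moreover have "(X ** A) ** h - h \<in> carrier_mat N 1" using h by (rule minus_carrier_mat)
    ultimately have "(X ** A) ** h - h = 0\<^sub>m N 1"
      by (rule hmat_injectiveD[OF inj A, rotated])
    then have "(X ** A) ** h = h"
      by (rule hmat_diff_eq_0) (use A X h in auto)
    then show "(X ** A) ** h = hmat_one N ** h" using h by simp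
  qed (use A X in auto)
  then show ?thesis
    using A X AX by (auto simp: hmat_invertible_def hmat_is_inverse_def)
qed

lemma left_inverse_imp_injective:
  assumes "X \<in> carrier_mat N M" "Y \<in> carrier_mat M N" "X ** Y = hmat_one N"
  shows "hmat_injective Y"
  unfolding hmat_injective_def
proof (intro ballI impI)
  fix h assume h: "h \<in> carrier_mat (dim_col Y) 1" "Y ** h = 0\<^sub>m (dim_row Y) 1"
  have "h = (X ** Y) ** h" using assms h by simp
  also have "\<dots> = X ** (Y ** h)" using assms by (intro hmat_assoc) auto
  finally show "h = 0\<^sub>m (dim_col Y) 1" using assms h by simp
qed

lemma left_inverse_imp_le:
  assumes "X \<in> carrier_mat N M" "Y \<in> carrier_mat M N" "X ** Y = hmat_one N"
  shows "N \<le> M"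
  using left_inverse_imp_injective[OF assms] hmat_injective_imp_le assms(2) by blast

text \<open>
  A right inverse \<open>Y\<close> is injective, hence invertible, and its inverse can only be \<open>X\<close>.
\<close>

lemma right_inverse_imp_inverse:
  assumes "X \<in> carrier_mat N N" "Y \<in> carrier_mat N N" "X ** Y = hmat_one N"
  shows "hmat_is_inverse t X Y"
proof -
  obtain Z where Z: "Z \<in> carrier_mat N N" "Y ** Z = hmat_one N" "Z ** Y = hmat_one N"
    using hmat_injective_imp_invertible[OF assms(2) left_inverse_imp_injective[OF assms]] assms(2)
    by (auto simp: hmat_invertible_def hmat_is_inverse_def)
  have "X = X ** (Y ** Z)" using assms Z by simp
  also have "\<dots> = (X ** Y) ** Z" using assms Z by (intro hmat_assoc[symmetric]) auto
  also have "\<dots> = Z" using assms Z by simp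
  finally show ?thesis using assms Z by (auto simp: hmat_is_inverse_def)
qed

section \<open>The resolvent near the origin\<close>

definition hmat_norm :: "hq mat \<Rightarrow> real" where
  "hmat_norm M = (\<Sum>i<dim_row M. \<Sum>j<dim_col M. norm (M $$ (i, j)))"

definition qmult_bound :: real where
  "qmult_bound = 3 + \<bar>t\<bar>"

lemma qmult_bound_pos: "0 < qmult_bound"
  by (simp add: qmult_bound_def add_pos_nonneg)

lemma hmat_norm_nonneg [simp]: "0 \<le> hmat_norm M"
  by (simp add: hmat_norm_def sum_nonneg)

lemma norm_index_le:
  assumes "i < dim_row M" "j < dim_col M"
  shows "norm (M $$ (i, j)) \<le> hmat_norm M"
proof -
  have "norm (M $$ (i, j)) \<le> (\<Sum>j<dim_col M. norm (M $$ (i, j)))"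
    using assms by (intro member_le_sum) auto
  also have "\<dots> \<le> hmat_norm M"
    unfolding hmat_norm_def using assms
    by (intro member_le_sum[of i _ "\<lambda>i. \<Sum>j<dim_col M. norm (M $$ (i, j))"]) (auto intro: sum_nonneg)
  finally show ?thesis .
qed

lemma hmat_norm_eq_0D:
  assumes "hmat_norm M \<le> 0"
  shows "M = 0\<^sub>m (dim_row M) (dim_col M)"
proof (rule eq_matI)
  fix i j assume "i < dim_row (0\<^sub>m (dim_row M) (dim_col M))" "j < dim_col (0\<^sub>m (dim_row M) (dim_col M))"
  then have ij: "i < dim_row M" "j < dim_col M" by auto
  from norm_index_le[OF this] have "norm (M $$ (i, j)) \<le> 0" using assms by linarith
  then show "M $$ (i, j) = 0\<^sub>m (dim_row M) (dim_col M) $$ (i, j)"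
    using ij by simp
qed auto

lemma hmat_norm_add_le:
  assumes "dim_row A = dim_row B" "dim_col A = dim_col B"
  shows "hmat_norm (A + B) \<le> hmat_norm A + hmat_norm B"
  using assms by (auto simp: hmat_norm_def sum.distrib[symmetric] intro!: sum_mono norm_triangle_ineq)

lemma hmat_norm_scaleR [simp]: "hmat_norm (x *\<^sub>H A) = \<bar>x\<bar> * hmat_norm A"
  by (simp add: hmat_norm_def sum_distrib_left)

lemma hmat_norm_mult_le:
  assumes "dim_col A = dim_row B"
  shows "hmat_norm (A ** B) \<le> qmult_bound * hmat_norm A * hmat_norm B"
proof -
  define a where "a i = (\<Sum>k<dim_col A. norm (A $$ (i, k)))" for i
  define b where "b j = (\<Sum>k<dim_row B. norm (B $$ (k, j)))" for j
  have entry: "norm ((A ** B) $$ (i, j)) \<le> qmult_bound * (a i * b j)"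
    if "i < dim_row A" "j < dim_col B" for i j
  proof -
    have "norm ((A ** B) $$ (i, j)) \<le> (\<Sum>k<dim_col A. norm (A $$ (i, k) \<diamondop> B $$ (k, j)))"
      using that by (simp add: norm_sum)
    also have "\<dots> \<le> (\<Sum>k<dim_col A. norm (A $$ (i, k)) * b j * qmult_bound)"
    proof (rule sum_mono)
      fix k assume k: "k \<in> {..<dim_col A}"
      have "norm (B $$ (k, j)) \<le> b j"
        unfolding b_def using k assms by (intro member_le_sum[of k _ "\<lambda>k. norm (B $$ (k, j))"]) auto
      then show "norm (A $$ (i, k) \<diamondop> B $$ (k, j)) \<le> norm (A $$ (i, k)) * b j * qmult_bound"
        using qmult_bound_pos
        by (intro order.trans[OF norm_hq_mult_le])
           (auto simp: qmult_bound_def[symmetric] intro!: mult_right_mono mult_left_mono)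
    qed
    also have "\<dots> = qmult_bound * (a i * b j)"
      by (simp add: a_def sum_distrib_right sum_distrib_left algebra_simps)
    finally show ?thesis .
  qed
  have "hmat_norm (A ** B) \<le> (\<Sum>i<dim_row A. \<Sum>j<dim_col B. qmult_bound * (a i * b j))"
    unfolding hmat_norm_def dim_hmat by (intro sum_mono entry) auto
  also have "\<dots> = qmult_bound * (\<Sum>i<dim_row A. a i) * (\<Sum>j<dim_col B. b j)"
    by (simp add: sum_distrib_left[symmetric] sum_distrib_right[symmetric] mult.assoc)
  also have "(\<Sum>i<dim_row A. a i) = hmat_norm A" by (simp add: a_def hmat_norm_def)
  also have "(\<Sum>j<dim_col B. b j) = hmat_norm B" unfolding b_def hmat_norm_def by (rule sum.swap)
  finally show ?thesis .
qed

abbreviation resolvent :: "hq mat \<Rightarrow> real \<Rightarrow> hq mat" where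
  "resolvent A x \<equiv> hmat_inv t (pencil A x)"

abbreviation pencil_invertible :: "hq mat \<Rightarrow> real \<Rightarrow> bool" where
  "pencil_invertible A x \<equiv> hmat_invertible t (pencil A x)"

lemma dim_pencil [simp]:
  "dim_row (pencil A x) = dim_row A" "dim_col (pencil A x) = dim_col A"
  by (simp_all add: pencil_def)

lemma pencil_carrier [simp]: "A \<in> carrier_mat N N \<Longrightarrow> pencil A x \<in> carrier_mat N N"
  by (auto intro: carrier_matI)

lemma pencil_mult:
  "A \<in> carrier_mat N N \<Longrightarrow> X \<in> carrier_mat N p \<Longrightarrow> pencil A x ** X = X - x *\<^sub>H (A ** X)"
  by (simp add: pencil_def hmat_diff_left)

lemma mult_pencil:
  "A \<in> carrier_mat N N \<Longrightarrow> X \<in> carrier_mat p N \<Longrightarrow> X ** pencil A x = X - x *\<^sub>H (X ** A)"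
  by (simp add: pencil_def hmat_diff_right)

lemma hmat_diff_eq_iff:
  fixes X Y Z :: "hq mat"
  assumes "X \<in> carrier_mat a b" "Y \<in> carrier_mat a b" "Z \<in> carrier_mat a b"
  shows "X - Y = Z \<longleftrightarrow> X = Z + Y"
proof
  assume eq: "X - Y = Z"
  show "X = Z + Y"
    by (rule eq_matI) (use assms in \<open>auto simp flip: eq\<close>)
next
  assume eq: "X = Z + Y"
  show "X - Y = Z"
    by (rule eq_matI) (use assms in \<open>auto simp: eq\<close>)
qed

lemma resolvent_carrier [simp]:
  "A \<in> carrier_mat N N \<Longrightarrow> pencil_invertible A x \<Longrightarrow> resolvent A x \<in> carrier_mat N N"
  by (rule hmat_invD) auto

lemma dim_resolvent [simp]:
  assumes "pencil_invertible A x"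
  shows "dim_row (resolvent A x) = dim_row A" "dim_col (resolvent A x) = dim_row A"
proof -
  obtain N where "pencil A x \<in> carrier_mat N N" "resolvent A x \<in> carrier_mat N N"
    using hmat_inverse_inv[OF assms] unfolding hmat_is_inverse_def by blast
  then show "dim_row (resolvent A x) = dim_row A" "dim_col (resolvent A x) = dim_row A"
    using carrier_matD dim_pencil(1) by metis+
qed

lemma resolvent_eq:
  assumes A: "A \<in> carrier_mat N N" and inv: "pencil_invertible A x"
  shows "resolvent A x = hmat_one N + x *\<^sub>H (A ** resolvent A x)"
    and "resolvent A x = hmat_one N + x *\<^sub>H (resolvent A x ** A)"
proof -
  note R = hmat_invD[OF inv pencil_carrier[OF A]]
  have "resolvent A x - x *\<^sub>H (A ** resolvent A x) = hmat_one N"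
    using R pencil_mult[OF A R(1), of x] by simp
  then show "resolvent A x = hmat_one N + x *\<^sub>H (A ** resolvent A x)"
    by (subst (asm) hmat_diff_eq_iff[of _ N N]) (use A R in auto)
  have "resolvent A x - x *\<^sub>H (resolvent A x ** A) = hmat_one N"
    using R mult_pencil[OF A R(1), of x] by simp
  then show "resolvent A x = hmat_one N + x *\<^sub>H (resolvent A x ** A)"
    by (subst (asm) hmat_diff_eq_iff[of _ N N]) (use A R in auto)
qed

text \<open>
  For small \<open>x\<close> the map \<open>h \<mapsto> x A h\<close> is a contraction by the factor \<open>1/2\<close>. Hence \<open>I - x A\<close> is
  injective, and \<open>R = I + x A R\<close> bounds the resolvent \<open>R\<close>.
\<close>

lemma pencil_invertible_small:
  assumes A: "A \<in> carrier_mat N N" and small: "\<bar>x\<bar> * (qmult_bound * hmat_norm A) \<le> 1/2"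
  shows "pencil_invertible A x" "hmat_norm (resolvent A x) \<le> 2 * hmat_norm (hmat_one N)"
proof -
  have half: "hmat_norm (x *\<^sub>H (A ** X)) \<le> hmat_norm X / 2" if "X \<in> carrier_mat N p" for X p
  proof -
    have "hmat_norm (x *\<^sub>H (A ** X)) \<le> \<bar>x\<bar> * (qmult_bound * hmat_norm A * hmat_norm X)"
      using A that by (auto intro!: mult_left_mono hmat_norm_mult_le)
    also have "\<dots> = \<bar>x\<bar> * (qmult_bound * hmat_norm A) * hmat_norm X" by simp
    also have "\<dots> \<le> 1/2 * hmat_norm X" by (intro mult_right_mono small) simp
    finally show ?thesis by simp
  qed
  have "hmat_injective (pencil A x)"
    unfolding hmat_injective_def
  proof (intro ballI impI)
    fix h assume h: "h \<in> carrier_mat (dim_col (pencil A x)) 1"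
      "pencil A x ** h = 0\<^sub>m (dim_row (pencil A x)) 1"
    then have hc: "h \<in> carrier_mat N 1" using A by simp
    then have "h - x *\<^sub>H (A ** h) = 0\<^sub>m N 1"
      using h A pencil_mult[OF A hc, of x] by simp
    then have "h = x *\<^sub>H (A ** h)"
      by (rule hmat_diff_eq_0) (use A hc in auto)
    then have "hmat_norm h = hmat_norm (x *\<^sub>H (A ** h))" by (rule arg_cong)
    then have "hmat_norm h \<le> 0" using half[OF hc] by linarith
    then show "h = 0\<^sub>m (dim_col (pencil A x)) 1" using hmat_norm_eq_0D[of h] h by auto
  qed
  then show inv: "pencil_invertible A x"
    by (rule hmat_injective_imp_invertible[OF pencil_carrier[OF A]])
  have "hmat_norm (resolvent A x) \<le> hmat_norm (hmat_one N) + hmat_norm (x *\<^sub>H (A ** resolvent A x))"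
    using A inv resolvent_carrier[OF A inv]
    by (subst resolvent_eq(1)[OF A inv]) (intro hmat_norm_add_le; auto)
  then show "hmat_norm (resolvent A x) \<le> 2 * hmat_norm (hmat_one N)"
    using half[OF resolvent_carrier[OF A inv]] by simp
qed

lemma eventually_small: "\<forall>\<^sub>F x in nhds 0. \<bar>x\<bar> * c \<le> (1/2::real)"
proof -
  have "((\<lambda>x::real. \<bar>x\<bar> * c) \<longlongrightarrow> \<bar>0\<bar> * c) (nhds 0)"
    by (intro tendsto_intros filterlim_ident)
  then have "\<forall>\<^sub>F x in nhds 0. \<bar>x\<bar> * c < 1/2"
    by (rule order_tendstoD(2)) simp
  then show ?thesis by (rule eventually_mono) simp
qed

lemma eventually_pencil_invertible:
  "A \<in> carrier_mat N N \<Longrightarrow> \<forall>\<^sub>F x in nhds 0. pencil_invertible A x"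
  using eventually_small[of "qmult_bound * hmat_norm A"]
  by (rule eventually_mono) (rule pencil_invertible_small)

lemma eventually_at_0I: "\<forall>\<^sub>F x in nhds 0. P x \<Longrightarrow> \<forall>\<^sub>F x in at 0. P x" for P :: "real \<Rightarrow> bool"
  by (simp add: eventually_at_filter eventually_mono)

lemma resolvent_expand:
  assumes A: "A \<in> carrier_mat N N" and C: "C \<in> carrier_mat n N" and B: "B \<in> carrier_mat N p"
    and inv: "pencil_invertible A x"
  shows "C ** resolvent A x ** B = C ** B + x *\<^sub>H (C ** resolvent A x ** (A ** B))"
proof -
  note R = resolvent_carrier[OF A inv]
  have "C ** resolvent A x ** B = C ** (hmat_one N + x *\<^sub>H (resolvent A x ** A)) ** B"
    using resolvent_eq(2)[OF A inv] by simp
  also have "\<dots> = C ** B + x *\<^sub>H (C ** resolvent A x ** (A ** B))"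
    using A C B R by (simp add: hmat_add_left hmat_add_right hmat_assoc)
  finally show ?thesis .
qed

lemma resolvent_tendsto:
  assumes A: "A \<in> carrier_mat N N" and C: "C \<in> carrier_mat n N" and B: "B \<in> carrier_mat N p"
    and ij: "i < n" "j < p"
  shows "((\<lambda>x. (C ** resolvent A x ** B) $$ (i, j)) \<longlongrightarrow> (C ** B) $$ (i, j)) (at 0)"
proof (rule LIM_zero_cancel, rule tendsto_0_le)
  define b where "b = qmult_bound * (qmult_bound * hmat_norm C * (2 * hmat_norm (hmat_one N))) * hmat_norm (A ** B)"
  show "((\<lambda>x::real. x) \<longlongrightarrow> 0) (at 0)"
    by (rule tendsto_ident_at)
  show "\<forall>\<^sub>F x in at 0. norm ((C ** resolvent A x ** B) $$ (i, j) - (C ** B) $$ (i, j)) \<le> norm x * b"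
    using eventually_at_0I[OF eventually_small[of "qmult_bound * hmat_norm A"]]
  proof eventually_elim
    case (elim x)
    note inv = pencil_invertible_small[OF A elim]
    define E where "E = C ** resolvent A x ** (A ** B)"
    have E: "E \<in> carrier_mat n p" unfolding E_def using A B C inv by auto
    have "(C ** resolvent A x ** B) $$ (i, j) - (C ** B) $$ (i, j) = (x *\<^sub>H E) $$ (i, j)"
      unfolding resolvent_expand[OF A C B inv(1)] E_def[symmetric]
      using E B C ij by (simp del: index_hmat(1))
    also have "norm \<dots> \<le> hmat_norm (x *\<^sub>H E)"
      using E ij by (intro norm_index_le) auto
    also have "\<dots> = \<bar>x\<bar> * hmat_norm E" by simp
    finally have le: "norm ((C ** resolvent A x ** B) $$ (i, j) - (C ** B) $$ (i, j)) \<le> \<bar>x\<bar> * hmat_norm E" .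
    have "hmat_norm E \<le> qmult_bound * hmat_norm (C ** resolvent A x) * hmat_norm (A ** B)"
      unfolding E_def using A C inv(1) by (intro hmat_norm_mult_le) simp
    also have "\<dots> \<le> qmult_bound * (qmult_bound * hmat_norm C * hmat_norm (resolvent A x)) * hmat_norm (A ** B)"
      using qmult_bound_pos A C inv(1)
      by (intro mult_right_mono mult_left_mono hmat_norm_mult_le) auto
    also have "\<dots> \<le> b"
      unfolding b_def using qmult_bound_pos inv(2)
      by (intro mult_right_mono mult_left_mono) auto
    finally show ?case using le by (simp add: order.trans[OF le] mult_left_mono)
  qed
qed

lemma product_eq_of_transfer_eq:
  assumes A: "A \<in> carrier_mat N N" and C: "C \<in> carrier_mat n N" and B: "B \<in> carrier_mat N p"
    and A': "A' \<in> carrier_mat N' N'" and C': "C' \<in> carrier_mat n N'" and B': "B' \<in> carrier_mat N' p"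
    and eq: "\<forall>\<^sub>F x in at 0. C ** resolvent A x ** B = C' ** resolvent A' x ** B'"
  shows "C ** B = C' ** B'"
proof (rule eq_matI)
  fix i j assume "i < dim_row (C' ** B')" "j < dim_col (C' ** B')"
  then have ij: "i < n" "j < p" using C' B' by auto
  have "((\<lambda>x. (C ** resolvent A x ** B) $$ (i, j)) \<longlongrightarrow> (C' ** B') $$ (i, j)) (at 0)"
    by (rule Lim_transform_eventually[OF resolvent_tendsto[OF A' C' B' ij]])
       (use eq in \<open>auto elim: eventually_mono\<close>)
  with resolvent_tendsto[OF A C B ij] show "(C ** B) $$ (i, j) = (C' ** B') $$ (i, j)"
    by (rule tendsto_unique[OF at_neq_bot])
qed (use C C' B B' in auto)

text \<open>
  Letting \<open>x\<close> tend to \<open>0\<close> compares the leading coefficients, and dividing the rest of the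
  expansion by \<open>x\<close> replaces \<open>B\<close> by \<open>A B\<close>. The hypothesis excludes \<open>x = 0\<close>, because the factor
  \<open>x\<close> in \<open>D + x C (I - x A)\<^sup>-\<^sup>1 B\<close> hides the value there.
\<close>

lemma markov_eqI:
  assumes A: "A \<in> carrier_mat N N" and C: "C \<in> carrier_mat n N"
    and A': "A' \<in> carrier_mat N' N'" and C': "C' \<in> carrier_mat n N'"
    and "B \<in> carrier_mat N p" "B' \<in> carrier_mat N' p"
    and "\<forall>\<^sub>F x in at 0. C ** resolvent A x ** B = C' ** resolvent A' x ** B'"
  shows "C ** hmat_pow t A k ** B = C' ** hmat_pow t A' k ** B'"
  using assms(5-)
proof (induction k arbitrary: B B')
  case (0 B B')
  then show ?case using product_eq_of_transfer_eq[OF A C 0(1) A' C' 0(2,3)] A C A' C' by simp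
next
  case (Suc k B B')
  note CB = product_eq_of_transfer_eq[OF A C Suc.prems(1) A' C' Suc.prems(2,3)]
  have "\<forall>\<^sub>F x in at 0. C ** resolvent A x ** (A ** B) = C' ** resolvent A' x ** (A' ** B')"
    using Suc.prems(3) eventually_at_0I[OF eventually_pencil_invertible[OF A]]
      eventually_at_0I[OF eventually_pencil_invertible[OF A']] eventually_neq_at_within[of 0 0]
  proof eventually_elim
    case (elim x)
    define E E' where "E = C ** resolvent A x ** (A ** B)" and "E' = C' ** resolvent A' x ** (A' ** B')"
    have dims: "E \<in> carrier_mat n p" "E' \<in> carrier_mat n p"
      unfolding E_def E'_def using A C A' C' Suc.prems elim by auto
    have "C' ** B' + x *\<^sub>H E = C' ** B' + x *\<^sub>H E'"
      using elim(1) resolvent_expand[OF A C Suc.prems(1) elim(2)]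
        resolvent_expand[OF A' C' Suc.prems(2) elim(3)] CB by (simp add: E_def E'_def)
    moreover have "x *\<^sub>H E = (C' ** B' + x *\<^sub>H E) - C' ** B'" "x *\<^sub>H E' = (C' ** B' + x *\<^sub>H E') - C' ** B'"
      using dims C' Suc.prems by (auto intro!: eq_matI simp del: index_hmat(1))
    ultimately have "x *\<^sub>H E = x *\<^sub>H E'" by simp
    then have "E = E'" using elim(4) by simp
    then show ?case by (simp add: E_def E'_def)
  qed
  from Suc.IH[OF _ _ this] show ?case
    using A C A' C' Suc.prems by (simp add: hmat_assoc)
qed

lemma hmat_norm_pow_le:
  assumes "A \<in> carrier_mat N N" "h \<in> carrier_mat N p"
  shows "hmat_norm (hmat_pow t A k ** h) \<le> (qmult_bound * hmat_norm A) ^ k * hmat_norm h"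
proof (induction k)
  case (Suc k)
  have "hmat_pow t A (Suc k) ** h = A ** (hmat_pow t A k ** h)"
    using assms by (subst hmat_pow_Suc_left[of _ N]) (auto simp: hmat_assoc)
  then have "hmat_norm (hmat_pow t A (Suc k) ** h) \<le> qmult_bound * hmat_norm A * hmat_norm (hmat_pow t A k ** h)"
    using assms by (simp add: hmat_norm_mult_le)
  also have "\<dots> \<le> qmult_bound * hmat_norm A * ((qmult_bound * hmat_norm A) ^ k * hmat_norm h)"
    using Suc qmult_bound_pos by (intro mult_left_mono) auto
  finally show ?case by (simp add: mult_ac)
qed (use assms in simp)

text \<open>
  If all \<open>C A\<^sup>k h\<close> vanish, iterating the expansion gives \<open>C R h = x\<^sup>k C R A\<^sup>k h\<close> for every \<open>k\<close>, where
  \<open>R\<close> is the resolvent. The right-hand side is of order \<open>2\<^sup>-\<^sup>k\<close>.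
\<close>

lemma resolvent_zero_of_markov_zero:
  assumes A: "A \<in> carrier_mat N N" and C: "C \<in> carrier_mat n N" and h: "h \<in> carrier_mat N p"
    and zero: "\<And>k. C ** hmat_pow t A k ** h = 0\<^sub>m n p"
  shows "\<forall>\<^sub>F x in nhds 0. C ** resolvent A x ** h = 0\<^sub>m n p"
  using eventually_small[of "qmult_bound * hmat_norm A"]
proof eventually_elim
  case (elim x)
  note inv = pencil_invertible_small[OF A elim]
  note R = resolvent_carrier[OF A inv(1)]
  define E where "E k = C ** resolvent A x ** (hmat_pow t A k ** h)" for k
  have E: "E k \<in> carrier_mat n p" for k unfolding E_def using A C R h by auto
  have step: "E k = x *\<^sub>H E (Suc k)" for k
  proof -
    have "A ** (hmat_pow t A k ** h) = hmat_pow t A (Suc k) ** h"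
      using A h by (subst hmat_pow_Suc_left[of _ N]) (auto simp: hmat_assoc)
    moreover have "C ** (hmat_pow t A k ** h) = 0\<^sub>m n p"
      using zero[of k] A C h by (simp add: hmat_assoc)
    moreover have "hmat_pow t A k ** h \<in> carrier_mat N p" using A h by auto
    ultimately have "E k = 0\<^sub>m n p + x *\<^sub>H E (Suc k)"
      unfolding E_def using resolvent_expand[OF A C _ inv(1), of "hmat_pow t A k ** h" p] by metis
    then show ?thesis using E[of "Suc k"] by simp
  qed
  have E0: "hmat_norm (E 0) = \<bar>x\<bar> ^ k * hmat_norm (E k)" for k
    by (induction k) (simp, subst (asm) step, simp add: mult_ac)
  define b where "b = qmult_bound * hmat_norm (C ** resolvent A x) * hmat_norm h"
  have "hmat_norm (E 0) \<le> (1/2) ^ k * b" for k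
  proof -
    have "hmat_norm (E k) \<le> qmult_bound * hmat_norm (C ** resolvent A x) * hmat_norm (hmat_pow t A k ** h)"
      unfolding E_def using A C R by (intro hmat_norm_mult_le) auto
    also have "\<dots> \<le> qmult_bound * hmat_norm (C ** resolvent A x) * ((qmult_bound * hmat_norm A) ^ k * hmat_norm h)"
      using qmult_bound_pos by (intro mult_left_mono hmat_norm_pow_le[OF A h]) auto
    also have "\<dots> = (qmult_bound * hmat_norm A) ^ k * b" by (simp add: b_def)
    finally have "hmat_norm (E 0) \<le> \<bar>x\<bar> ^ k * ((qmult_bound * hmat_norm A) ^ k * b)"
      unfolding E0[of k] by (intro mult_left_mono) auto
    also have "\<dots> = (\<bar>x\<bar> * (qmult_bound * hmat_norm A)) ^ k * b" by (simp add: power_mult_distrib)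
    also have "\<dots> \<le> (1/2) ^ k * b"
      using elim qmult_bound_pos by (intro mult_right_mono power_mono) (auto simp: b_def)
    finally show ?thesis .
  qed
  moreover have "(\<lambda>k. (1/2::real) ^ k * b) \<longlonglongrightarrow> 0"
    by (rule tendsto_mult_left_zero) (simp add: LIMSEQ_power_zero)
  ultimately have "hmat_norm (E 0) \<le> 0" by (intro LIMSEQ_le_const) auto
  then have "E 0 = 0\<^sub>m n p" using hmat_norm_eq_0D[of "E 0"] E[of 0] by auto
  then show ?case unfolding E_def using A h by simp
qed

text \<open>
  Observability is stated with the resolvent, controllability with powers of \<open>A\<close>. From here on both
  are used in the form with powers, in which they are dual to each other.
\<close>

lemma observable_iff_markov:
  assumes A: "A \<in> carrier_mat N N" and C: "C \<in> carrier_mat n N"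
  shows "observable t n N C A \<longleftrightarrow>
    (\<forall>h \<in> carrier_mat N 1. (\<forall>k. C ** hmat_pow t A k ** h = 0\<^sub>m n 1) \<longrightarrow> h = 0\<^sub>m N 1)"
proof -
  have near: "(\<exists>\<epsilon>>0. \<forall>x\<in>{-\<epsilon><..<\<epsilon>}. P x) \<longleftrightarrow> (\<forall>\<^sub>F x in nhds 0. P x)" for P :: "real \<Rightarrow> bool"
    by (auto simp: eventually_nhds_metric dist_real_def abs_less_iff Ball_def)
  have "(\<forall>\<^sub>F x in nhds 0. C ** resolvent A x ** h = 0\<^sub>m n 1) \<longleftrightarrow> (\<forall>k. C ** hmat_pow t A k ** h = 0\<^sub>m n 1)"
    if h: "h \<in> carrier_mat N 1" for h
  proof
    assume "\<forall>\<^sub>F x in nhds 0. C ** resolvent A x ** h = 0\<^sub>m n 1"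
    with eventually_pencil_invertible[OF A]
    have "\<forall>\<^sub>F x in nhds 0. C ** resolvent A x ** h = C ** resolvent A x ** 0\<^sub>m N 1"
    proof eventually_elim
      case (elim x)
      then show ?case using A C resolvent_carrier[OF A elim(1)] by simp
    qed
    from markov_eqI[OF A C A C h _ eventually_at_0I[OF this]]
    show "\<forall>k. C ** hmat_pow t A k ** h = 0\<^sub>m n 1" using A C by simp
  qed (rule resolvent_zero_of_markov_zero[OF A C h], blast)
  moreover have "C ** hmat_pow t A k ** 0\<^sub>m N 1 = 0\<^sub>m n 1" for k using A C by simp
  ultimately show ?thesis unfolding observable_def near by blast
qed

lemma controllable_iff:
  assumes A: "A \<in> carrier_mat N N" and B: "B \<in> carrier_mat N n"
  shows "controllable t n N A B \<longleftrightarrow>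
    (\<forall>h \<in> carrier_mat 1 N. (\<forall>k. h ** hmat_pow t A k ** B = 0\<^sub>m 1 n) \<longrightarrow> h = 0\<^sub>m 1 N)"
proof -
  have "0\<^sub>m 1 N ** hmat_pow t A k ** B = 0\<^sub>m 1 n" for k using A B by simp
  then show ?thesis unfolding controllable_def by blast
qed

section \<open>State space isomorphism\<close>

text \<open>
  Real linear combinations of \<open>N \<times> N\<close> matrices. The order \<open>N\<close> is a parameter because the empty
  combination has to be a zero matrix of the right size.
\<close>

definition hmat_comb :: "nat \<Rightarrow> (nat \<Rightarrow> real) \<Rightarrow> (nat \<Rightarrow> hq mat) \<Rightarrow> nat \<Rightarrow> hq mat" where
  "hmat_comb N c F m = mat N N (\<lambda>(i, j). \<Sum>k<m. c k *\<^sub>R F k $$ (i, j))"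

lemma hmat_comb_carrier [simp]: "hmat_comb N c F m \<in> carrier_mat N N"
  by (simp add: hmat_comb_def)

lemma mult_hmat_comb_eq_0:
  assumes "\<And>k. k < m \<Longrightarrow> X ** F k ** Y = 0\<^sub>m n p" "\<And>k. F k \<in> carrier_mat N N"
    and X: "X \<in> carrier_mat n N" and Y: "Y \<in> carrier_mat N p"
  shows "X ** hmat_comb N c F m ** Y = 0\<^sub>m n p"
  using assms(1,2)
proof (induction m)
  case 0
  have "hmat_comb N c F 0 = 0\<^sub>m N N" by (rule eq_matI) (auto simp: hmat_comb_def)
  then show ?case using X Y by simp
next
  case (Suc m)
  have F: "F m \<in> carrier_mat N N" by (rule Suc.prems)
  have "hmat_comb N c F (Suc m) = hmat_comb N c F m + c m *\<^sub>H F m"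
    using F by (intro eq_matI) (auto simp: hmat_comb_def)
  then have "X ** hmat_comb N c F (Suc m) ** Y
      = X ** hmat_comb N c F m ** Y + c m *\<^sub>H (X ** F m ** Y)"
    using F X Y by (simp add: hmat_add_left hmat_add_right hmat_comb_def)
  also have "X ** hmat_comb N c F m ** Y = 0\<^sub>m n p"
    by (rule Suc.IH) (use Suc.prems in auto)
  also have "X ** F m ** Y = 0\<^sub>m n p" by (rule Suc.prems) simp
  also have "0\<^sub>m n p + c m *\<^sub>H 0\<^sub>m n p = 0\<^sub>m n p" by (rule eq_matI) auto
  finally show ?case .
qed

text \<open>
  The powers of \<open>A\<close> lie in a space of real dimension \<open>4 N\<^sup>2\<close>. Solving a dependency for the highest
  power that occurs expresses it by lower ones with real coefficients.
\<close>

lemma hmat_pow_dependent: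
  assumes A: "A \<in> carrier_mat N N"
  shows "\<exists>m c. hmat_pow t A m = hmat_comb N c (hmat_pow t A) m"
proof -
  define K where "K = {..4 * (N * N)}"
  have "finite ({..<N} \<times> {..<N})" "finite K" "4 * card ({..<N} \<times> {..<N}) < card K"
    by (auto simp: K_def card_cartesian_product)
  from hq_dependency[OF this, of "\<lambda>k (i, j). hmat_pow t A k $$ (i, j)"]
  obtain d where d: "\<exists>k\<in>K. d k \<noteq> 0"
    "\<And>i j. i < N \<Longrightarrow> j < N \<Longrightarrow> (\<Sum>k\<in>K. d k *\<^sub>R hmat_pow t A k $$ (i, j)) = 0" by auto
  define m where "m = Max {k\<in>K. d k \<noteq> 0}"
  have "m \<in> {k\<in>K. d k \<noteq> 0}" unfolding m_def using d(1) by (intro Max_in) (auto simp: K_def)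
  then have m: "m \<in> K" "d m \<noteq> 0" by auto
  have above: "d k = 0" if "k \<in> K" "k > m" for k
    using Max_ge[of "{k\<in>K. d k \<noteq> 0}" k] that by (fastforce simp: m_def K_def)
  have "hmat_pow t A m = hmat_comb N (\<lambda>k. - d k / d m) (hmat_pow t A) m"
  proof (rule eq_matI)
    fix i j assume "i < dim_row (hmat_comb N (\<lambda>k. - d k / d m) (hmat_pow t A) m)"
      "j < dim_col (hmat_comb N (\<lambda>k. - d k / d m) (hmat_pow t A) m)"
    then have ij: "i < N" "j < N" by (auto simp: hmat_comb_def)
    have "0 = (\<Sum>k\<in>K. d k *\<^sub>R hmat_pow t A k $$ (i, j))" using d(2)[OF ij] by simp
    also have "\<dots> = (\<Sum>k\<in>{..m}. d k *\<^sub>R hmat_pow t A k $$ (i, j))"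
      by (rule sum.mono_neutral_right) (use m above in \<open>auto simp: K_def\<close>)
    also have "\<dots> = (\<Sum>k<m. d k *\<^sub>R hmat_pow t A k $$ (i, j)) + d m *\<^sub>R hmat_pow t A m $$ (i, j)"
      by (simp add: lessThan_Suc_atMost[symmetric])
    finally have "d m *\<^sub>R hmat_pow t A m $$ (i, j) = - (\<Sum>k<m. d k *\<^sub>R hmat_pow t A k $$ (i, j))"
      by (metis add.inverse_unique minus_minus)
    then have "(1 / d m) *\<^sub>R (d m *\<^sub>R hmat_pow t A m $$ (i, j))
        = (1 / d m) *\<^sub>R - (\<Sum>k<m. d k *\<^sub>R hmat_pow t A k $$ (i, j))" by simp
    then show "hmat_pow t A m $$ (i, j) = hmat_comb N (\<lambda>k. - d k / d m) (hmat_pow t A) m $$ (i, j)"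
      using ij m(2) by (simp add: hmat_comb_def scaleR_sum_right sum_negf)
  qed (use A in \<open>auto simp: hmat_comb_def\<close>)
  then show ?thesis by blast
qed

lemma finitely_many_markov:
  assumes A: "A \<in> carrier_mat N N" and C: "C \<in> carrier_mat n N"
  shows "\<exists>m. \<forall>h \<in> carrier_mat N 1. (\<forall>k<m. C ** hmat_pow t A k ** h = 0\<^sub>m n 1) \<longrightarrow>
    (\<forall>k. C ** hmat_pow t A k ** h = 0\<^sub>m n 1)"
proof -
  obtain m c where m: "hmat_pow t A m = hmat_comb N c (hmat_pow t A) m"
    using hmat_pow_dependent[OF A] by blast
  have "C ** hmat_pow t A k ** h = 0\<^sub>m n 1"
    if h: "h \<in> carrier_mat N 1" and z: "\<And>k. k < m \<Longrightarrow> C ** hmat_pow t A k ** h = 0\<^sub>m n 1" for h k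
  proof (induction k rule: less_induct)
    case (less k)
    show ?case
    proof (cases "k < m")
      case False
      define l where "l = k - m"
      have k: "k = l + m" using False by (simp add: l_def)
      have "C ** hmat_pow t A l ** hmat_comb N c (hmat_pow t A) m ** h = 0\<^sub>m n 1"
      proof (rule mult_hmat_comb_eq_0)
        fix i assume "i < m"
        then have "C ** hmat_pow t A (l + i) ** h = 0\<^sub>m n 1" by (intro less) (simp add: k)
        then show "C ** hmat_pow t A l ** hmat_pow t A i ** h = 0\<^sub>m n 1"
          using A C h by (simp add: hmat_pow_add hmat_assoc)
      qed (use A C h in auto)
      then show ?thesis
        using A C h unfolding m[symmetric] k by (simp add: hmat_pow_add hmat_assoc)
    qed (rule z)
  qed
  then show ?thesis by blast
qed

text \<open>
  The adjoint of multiplication with \<open>q\<close> from the left for the positive definite inner product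
  \<open>Re (a (cnj c)) + \<bar>t\<bar> Re (b (cnj d))\<close> of \<open>a + b j\<^sub>t\<close> and \<open>c + d j\<^sub>t\<close>. It is \<open>\<circledast>\<close> for \<open>t < 0\<close>; for \<open>t > 0\<close>
  the form \<open>q\<^sup>\<circledast> q\<close> is indefinite, and Gram matrices have to be formed with this involution instead.
\<close>

definition hq_star :: "hq \<Rightarrow> hq" where
  "hq_star q = (cnj (fst q), of_real (sgn t) * snd q)"

definition hmat_star :: "hq mat \<Rightarrow> hq mat" where
  "hmat_star M = map_mat hq_star (transpose_mat M)"

definition sq_norm :: "hq mat \<Rightarrow> real" where
  "sq_norm f = Re (fst ((hmat_star f ** f) $$ (0, 0)))"

lemma sgn_square: "sgn t * sgn t = 1"
  using t_nonzero by (auto simp: sgn_if)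

lemma hq_star_mult: "hq_star (p \<diamondop> q) = hq_star q \<diamondop> hq_star p"
proof -
  have "complex_of_real (sgn t) * (complex_of_real (sgn t) * z) = z" for z
    by (simp add: t_nonzero sgn_square mult.assoc[symmetric] flip: of_real_mult)
  then show ?thesis
    by (simp add: hq_star_def hq_mult_def algebra_simps)
qed

lemma hq_star_add: "hq_star (p + q) = hq_star p + hq_star q"
  by (simp add: hq_star_def algebra_simps)

lemma hq_star_sum: "hq_star (\<Sum>i\<in>S. f i) = (\<Sum>i\<in>S. hq_star (f i))"
  by (rule additive.sum) (simp add: additive_def hq_star_add)

lemma Re_hq_star_mult_self:
  "Re (fst (hq_star q \<diamondop> q)) = (cmod (fst q))\<^sup>2 + \<bar>t\<bar> * (cmod (snd q))\<^sup>2"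
proof -
  have "Re (fst (hq_star q \<diamondop> q)) = (cmod (fst q))\<^sup>2 + t * sgn t * (cmod (snd q))\<^sup>2"
    unfolding cmod_power2 by (simp add: hq_star_def hq_mult_def power2_eq_square algebra_simps)
  then show ?thesis by (simp add: abs_sgn[symmetric])
qed

lemma dim_hmat_star [simp]: "dim_row (hmat_star M) = dim_col M" "dim_col (hmat_star M) = dim_row M"
  by (simp_all add: hmat_star_def)

lemma hmat_star_carrier [simp]: "M \<in> carrier_mat a b \<Longrightarrow> hmat_star M \<in> carrier_mat b a"
  by (auto intro: carrier_matI)

lemma hmat_star_mult: "dim_col A = dim_row B \<Longrightarrow> hmat_star (A ** B) = hmat_star B ** hmat_star A"
  by (rule eq_matI) (auto simp: hmat_star_def hq_star_mult hq_star_sum)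

lemma sq_norm_eq:
  "f \<in> carrier_mat N 1 \<Longrightarrow>
    sq_norm f = (\<Sum>i<N. (cmod (fst (f $$ (i, 0))))\<^sup>2 + \<bar>t\<bar> * (cmod (snd (f $$ (i, 0))))\<^sup>2)"
  by (auto simp: sq_norm_def hmat_star_def fst_sum Re_hq_star_mult_self)

lemma sq_norm_nonneg: "f \<in> carrier_mat N 1 \<Longrightarrow> 0 \<le> sq_norm f"
  by (simp add: sq_norm_eq sum_nonneg)

lemma sq_norm_eq_0D:
  assumes f: "f \<in> carrier_mat N 1" and z: "sq_norm f = 0"
  shows "f = 0\<^sub>m N 1"
proof (rule eq_matI)
  fix i j assume ij: "i < dim_row (0\<^sub>m N 1)" "j < dim_col (0\<^sub>m N 1)"
  have "(cmod (fst (f $$ (i, 0))))\<^sup>2 + \<bar>t\<bar> * (cmod (snd (f $$ (i, 0))))\<^sup>2 = 0"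
    using z ij unfolding sq_norm_eq[OF f] by (subst (asm) sum_nonneg_eq_0_iff) auto
  then have "fst (f $$ (i, 0)) = 0" "snd (f $$ (i, 0)) = 0"
    using t_nonzero by (auto simp: add_nonneg_eq_0_iff)
  then show "f $$ (i, j) = 0\<^sub>m N 1 $$ (i, j)" using ij by (simp add: prod_eq_iff)
qed (use f in auto)

text \<open>
  In the notation of the positive involution \<open>M \<mapsto> M\<^sup>*\<close>, the matrices are
  \<open>G = \<Sum>k<m. (C A\<^sup>k)\<^sup>* C A\<^sup>k\<close> and \<open>S = \<Sum>k<m. (C A\<^sup>k)\<^sup>* C' A'\<^sup>k\<close>, built up one summand at a time.
\<close>

lemma observability_gram:
  assumes A: "A \<in> carrier_mat N N" and C: "C \<in> carrier_mat n N"
    and A': "A' \<in> carrier_mat N' N'" and C': "C' \<in> carrier_mat n N'"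
  shows "\<exists>G \<in> carrier_mat N N. \<exists>S \<in> carrier_mat N N'.
    (\<forall>h \<in> carrier_mat N 1. Re (fst ((hmat_star h ** (G ** h)) $$ (0, 0))) =
        (\<Sum>k<m. sq_norm (C ** hmat_pow t A k ** h))) \<and>
    (\<forall>p. \<forall>X \<in> carrier_mat N p. \<forall>X' \<in> carrier_mat N' p.
        (\<forall>k. C ** hmat_pow t A k ** X = C' ** hmat_pow t A' k ** X') \<longrightarrow> G ** X = S ** X')"
proof (induction m)
  case 0
  show ?case
    by (rule bexI[of _ "0\<^sub>m N N"], rule bexI[of _ "0\<^sub>m N N'"]) auto
next
  case (Suc m)
  then obtain G S where G: "G \<in> carrier_mat N N" and S: "S \<in> carrier_mat N N'"
    and form: "\<And>h. h \<in> carrier_mat N 1 \<Longrightarrow> Re (fst ((hmat_star h ** (G ** h)) $$ (0, 0))) =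
        (\<Sum>k<m. sq_norm (C ** hmat_pow t A k ** h))"
    and lift: "\<And>p X X'. X \<in> carrier_mat N p \<Longrightarrow> X' \<in> carrier_mat N' p \<Longrightarrow>
        (\<And>k. C ** hmat_pow t A k ** X = C' ** hmat_pow t A' k ** X') \<Longrightarrow> G ** X = S ** X'"
    by blast
  define F F' where "F = C ** hmat_pow t A m" and "F' = C' ** hmat_pow t A' m"
  have F: "F \<in> carrier_mat n N" "F' \<in> carrier_mat n N'" using A C A' C' by (auto simp: F_def F'_def)
  show ?case
  proof (rule bexI[of _ "G + hmat_star F ** F"], rule bexI[of _ "S + hmat_star F ** F'"], intro conjI ballI allI impI)
    fix h :: "hq mat" assume h: "h \<in> carrier_mat N 1"
    have "hmat_star h ** ((G + hmat_star F ** F) ** h) = hmat_star h ** (G ** h) + hmat_star (F ** h) ** (F ** h)"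
      using F G h by (simp add: hmat_add_left hmat_add_right hmat_assoc hmat_star_mult)
    then show "Re (fst ((hmat_star h ** ((G + hmat_star F ** F) ** h)) $$ (0, 0))) =
        (\<Sum>k<Suc m. sq_norm (C ** hmat_pow t A k ** h))"
      using form[OF h] h F by (simp add: sq_norm_def F_def[symmetric] del: index_hmat(1))
  next
    fix p and X X' :: "hq mat" assume X: "X \<in> carrier_mat N p" "X' \<in> carrier_mat N' p"
      and eq: "\<forall>k. C ** hmat_pow t A k ** X = C' ** hmat_pow t A' k ** X'"
    have "F ** X = F' ** X'" using eq by (simp add: F_def F'_def)
    moreover have "G ** X = S ** X'" using lift[OF X] eq by blast
    ultimately show "(G + hmat_star F ** F) ** X = (S + hmat_star F ** F') ** X'"
      using F G S X by (simp add: hmat_add_left hmat_assoc)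
  qed (use F G S in auto)
qed

definition markov_observable :: "nat \<Rightarrow> nat \<Rightarrow> hq mat \<Rightarrow> hq mat \<Rightarrow> bool" where
  "markov_observable n N C A \<longleftrightarrow>
    (\<forall>h \<in> carrier_mat N 1. (\<forall>k. C ** hmat_pow t A k ** h = 0\<^sub>m n 1) \<longrightarrow> h = 0\<^sub>m N 1)"

text \<open>
  An observable state is reconstructed from its outputs \<open>C A\<^sup>k X\<close> by a left inverse of the
  observability matrix, obtained from the Gram matrix. Applied to the outputs of a second system
  it becomes a single matrix \<open>S\<close> that transports every state \<open>X'\<close> with the same outputs.
\<close>

lemma observability_lift:
  assumes A: "A \<in> carrier_mat N N" and C: "C \<in> carrier_mat n N"
    and A': "A' \<in> carrier_mat N' N'" and C': "C' \<in> carrier_mat n N'"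
    and obs: "markov_observable n N C A"
  obtains S where "S \<in> carrier_mat N N'"
    "\<And>p X X'. X \<in> carrier_mat N p \<Longrightarrow> X' \<in> carrier_mat N' p \<Longrightarrow>
        (\<And>k. C ** hmat_pow t A k ** X = C' ** hmat_pow t A' k ** X') \<Longrightarrow> X = S ** X'"
proof -
  obtain m where m: "\<forall>h \<in> carrier_mat N 1. (\<forall>k<m. C ** hmat_pow t A k ** h = 0\<^sub>m n 1) \<longrightarrow>
      (\<forall>k. C ** hmat_pow t A k ** h = 0\<^sub>m n 1)"
    using finitely_many_markov[OF A C] ..
  obtain G S where G: "G \<in> carrier_mat N N" and S: "S \<in> carrier_mat N N'"
    and form: "\<And>h. h \<in> carrier_mat N 1 \<Longrightarrow> Re (fst ((hmat_star h ** (G ** h)) $$ (0, 0))) =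
        (\<Sum>k<m. sq_norm (C ** hmat_pow t A k ** h))"
    and lift: "\<And>p X X'. X \<in> carrier_mat N p \<Longrightarrow> X' \<in> carrier_mat N' p \<Longrightarrow>
        (\<And>k. C ** hmat_pow t A k ** X = C' ** hmat_pow t A' k ** X') \<Longrightarrow> G ** X = S ** X'"
    using observability_gram[OF A C A' C', of m] by blast
  have "hmat_injective G"
    unfolding hmat_injective_def
  proof (intro ballI impI)
    fix h :: "hq mat" assume "h \<in> carrier_mat (dim_col G) 1" "G ** h = 0\<^sub>m (dim_row G) 1"
    then have h: "h \<in> carrier_mat N 1" "G ** h = 0\<^sub>m N 1" using G by auto
    have carr: "C ** hmat_pow t A k ** h \<in> carrier_mat n 1" for k using A C h by auto
    have "(\<Sum>k<m. sq_norm (C ** hmat_pow t A k ** h)) = 0"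
      using form[OF h(1)] h by (simp add: hmat_zero_right del: index_hmat(1))
    then have "sq_norm (C ** hmat_pow t A k ** h) = 0" if "k < m" for k
      using that by (subst (asm) sum_nonneg_eq_0_iff) (auto intro: sq_norm_nonneg[OF carr])
    then have "C ** hmat_pow t A k ** h = 0\<^sub>m n 1" if "k < m" for k
      using that sq_norm_eq_0D[OF carr] by blast
    then have "\<forall>k. C ** hmat_pow t A k ** h = 0\<^sub>m n 1" using m h(1) by blast
    then show "h = 0\<^sub>m (dim_col G) 1" using obs h(1) G by (auto simp: markov_observable_def)
  qed
  then have "hmat_invertible t G" by (rule hmat_injective_imp_invertible[OF G])
  note Gi = hmat_invD[OF this G]
  show thesis
  proof
    show "hmat_inv t G ** S \<in> carrier_mat N N'" using Gi S by auto
    fix p and X X' :: "hq mat" assume X: "X \<in> carrier_mat N p" "X' \<in> carrier_mat N' p"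
      and eq: "\<And>k. C ** hmat_pow t A k ** X = C' ** hmat_pow t A' k ** X'"
    have "X = (hmat_inv t G ** G) ** X" using Gi X by simp
    also have "\<dots> = hmat_inv t G ** (G ** X)" using Gi X G by (intro hmat_assoc) auto
    also have "G ** X = S ** X'" by (rule lift[OF X eq])
    finally show "X = (hmat_inv t G ** S) ** X'" using Gi S X by (simp add: hmat_assoc)
  qed
qed

definition markov_controllable :: "nat \<Rightarrow> nat \<Rightarrow> hq mat \<Rightarrow> hq mat \<Rightarrow> bool" where
  "markov_controllable n N A B \<longleftrightarrow>
    (\<forall>h \<in> carrier_mat 1 N. (\<forall>k. h ** hmat_pow t A k ** B = 0\<^sub>m 1 n) \<longrightarrow> h = 0\<^sub>m 1 N)"

lemma markov_adj:
  assumes "A \<in> carrier_mat N N" "B \<in> carrier_mat N n" "Z \<in> carrier_mat p N"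
  shows "(Z ** hmat_pow t A k ** B)\<^sup>\<circledast> = B\<^sup>\<circledast> ** hmat_pow t (A\<^sup>\<circledast>) k ** Z\<^sup>\<circledast>"
  using assms by (simp add: hmat_adj_mult hmat_pow_adj hmat_assoc)

lemma markov_controllable_adj:
  assumes A: "A \<in> carrier_mat N N" and B: "B \<in> carrier_mat N n"
    and ctr: "markov_controllable n N A B"
  shows "markov_observable n N (B\<^sup>\<circledast>) (A\<^sup>\<circledast>)"
  unfolding markov_observable_def
proof (intro ballI impI)
  fix h :: "hq mat" assume h: "h \<in> carrier_mat N 1" and z: "\<forall>k. B\<^sup>\<circledast> ** hmat_pow t (A\<^sup>\<circledast>) k ** h = 0\<^sub>m n 1"
  have "h\<^sup>\<circledast> ** hmat_pow t A k ** B = 0\<^sub>m 1 n" for k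
  proof -
    have "(h\<^sup>\<circledast> ** hmat_pow t A k ** B)\<^sup>\<circledast> = (0\<^sub>m 1 n)\<^sup>\<circledast>"
      using markov_adj[OF A B, of "h\<^sup>\<circledast>" 1 k] h z by simp
    then show ?thesis by (simp only: hmat_adj_inject)
  qed
  then have "h\<^sup>\<circledast> = 0\<^sub>m 1 N" using ctr h unfolding markov_controllable_def by blast
  then have "h\<^sup>\<circledast> = (0\<^sub>m N 1)\<^sup>\<circledast>" by simp
  then show "h = 0\<^sub>m N 1" by (simp only: hmat_adj_inject)
qed

text \<open>
  Taking \<open>\<circledast>\<close> of all matrices reduces this to the lifting property of observable systems.
\<close>

lemma controllability_lift:
  assumes A: "A \<in> carrier_mat N N" and B: "B \<in> carrier_mat N n"
    and A': "A' \<in> carrier_mat N' N'" and B': "B' \<in> carrier_mat N' n"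
    and ctr: "markov_controllable n N A B"
  obtains T where "T \<in> carrier_mat N' N"
    "\<And>p Z Z'. Z \<in> carrier_mat p N \<Longrightarrow> Z' \<in> carrier_mat p N' \<Longrightarrow>
        (\<And>k. Z ** hmat_pow t A k ** B = Z' ** hmat_pow t A' k ** B') \<Longrightarrow> Z = Z' ** T"
proof -
  obtain S where S: "S \<in> carrier_mat N N'"
    "\<And>p X X'. X \<in> carrier_mat N p \<Longrightarrow> X' \<in> carrier_mat N' p \<Longrightarrow>
        (\<And>k. B\<^sup>\<circledast> ** hmat_pow t (A\<^sup>\<circledast>) k ** X = B'\<^sup>\<circledast> ** hmat_pow t (A'\<^sup>\<circledast>) k ** X') \<Longrightarrow> X = S ** X'"
    using observability_lift[of "A\<^sup>\<circledast>" N "B\<^sup>\<circledast>" n "A'\<^sup>\<circledast>" N' "B'\<^sup>\<circledast>"]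
      markov_controllable_adj[OF A B ctr] A B A' B' by (metis carrier_hmat(4))
  show thesis
  proof
    show "S\<^sup>\<circledast> \<in> carrier_mat N' N" using S by auto
    fix p and Z Z' :: "hq mat" assume Z: "Z \<in> carrier_mat p N" "Z' \<in> carrier_mat p N'"
      and eq: "\<And>k. Z ** hmat_pow t A k ** B = Z' ** hmat_pow t A' k ** B'"
    have "Z\<^sup>\<circledast> = S ** Z'\<^sup>\<circledast>"
      using Z eq markov_adj[OF A B Z(1)] markov_adj[OF A' B' Z(2)] by (intro S(2)[of _ p]) auto
    then have "Z\<^sup>\<circledast> = (Z' ** S\<^sup>\<circledast>)\<^sup>\<circledast>" using S Z by (simp add: hmat_adj_mult)
    then show "Z = Z' ** S\<^sup>\<circledast>" by (simp only: hmat_adj_inject)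
  qed
qed

text \<open>
  The states \<open>A\<^sup>k B\<close> and \<open>A'\<^sup>k B'\<close> have equal outputs, so \<open>S\<close> maps the latter to the former. Each of
  the identities for \<open>T\<close> is then an instance of the dual lifting property: for \<open>S T = I\<close> the rows
  \<open>I\<close> and \<open>S\<close> are compared, for the second \<open>A\<close> and \<open>S A'\<close>, for the last \<open>C\<close> and \<open>C'\<close>.
\<close>

lemma state_space_embedding:
  assumes A: "A \<in> carrier_mat N N" and B: "B \<in> carrier_mat N n" and C: "C \<in> carrier_mat n N"
    and A': "A' \<in> carrier_mat N' N'" and B': "B' \<in> carrier_mat N' n" and C': "C' \<in> carrier_mat n N'"
    and obs: "markov_observable n N C A" and ctr: "markov_controllable n N A B"
    and markov: "\<And>k. C ** hmat_pow t A k ** B = C' ** hmat_pow t A' k ** B'"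
  obtains S T where "S \<in> carrier_mat N N'" "T \<in> carrier_mat N' N" "S ** T = hmat_one N"
    "A = S ** A' ** T" "B = S ** B'" "C = C' ** T"
proof -
  obtain S where S: "S \<in> carrier_mat N N'" and
    lift: "\<And>p X X'. X \<in> carrier_mat N p \<Longrightarrow> X' \<in> carrier_mat N' p \<Longrightarrow>
        (\<And>k. C ** hmat_pow t A k ** X = C' ** hmat_pow t A' k ** X') \<Longrightarrow> X = S ** X'"
    using observability_lift[OF A C A' C' obs] by blast
  obtain T where T: "T \<in> carrier_mat N' N" and
    colift: "\<And>p Z Z'. Z \<in> carrier_mat p N \<Longrightarrow> Z' \<in> carrier_mat p N' \<Longrightarrow>
        (\<And>k. Z ** hmat_pow t A k ** B = Z' ** hmat_pow t A' k ** B') \<Longrightarrow> Z = Z' ** T"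
    using controllability_lift[OF A B A' B' ctr] by blast
  have state: "hmat_pow t A k ** B = S ** (hmat_pow t A' k ** B')" for k
  proof (rule lift[of _ n])
    fix l
    show "C ** hmat_pow t A l ** (hmat_pow t A k ** B) = C' ** hmat_pow t A' l ** (hmat_pow t A' k ** B')"
      using markov[of "l + k"] A B C A' B' C' by (simp add: hmat_pow_add hmat_assoc)
  qed (use A B A' B' in auto)
  have "hmat_one N = S ** T"
    by (rule colift[of _ N]) (use S A B A' B' state in \<open>auto simp: hmat_assoc\<close>)
  moreover have "A = (S ** A') ** T"
  proof (rule colift[of _ N])
    fix k
    have "A ** hmat_pow t A k ** B = hmat_pow t A (Suc k) ** B"
      using A by (subst hmat_pow_Suc_left[of _ N]) auto
    also have "\<dots> = S ** (hmat_pow t A' (Suc k) ** B')" by (rule state)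
    also have "\<dots> = S ** A' ** hmat_pow t A' k ** B'"
      using S A' B' by (subst hmat_pow_Suc_left[of _ N']) (auto simp: hmat_assoc)
    finally show "A ** hmat_pow t A k ** B = S ** A' ** hmat_pow t A' k ** B'" .
  qed (use A S A' in auto)
  moreover have "B = S ** B'" using state[of 0] A B A' B' by simp
  moreover have "C = C' ** T" by (rule colift[OF C C' markov])
  ultimately show thesis using that S T by metis
qed

text \<open>
  Comparing the system with itself forces both transport matrices to be the identity, so equal
  outputs mean equal states, and dually.
\<close>

lemma sandwich_unique:
  assumes A: "A \<in> carrier_mat N N" and B: "B \<in> carrier_mat N n" and C: "C \<in> carrier_mat n N"
    and obs: "markov_observable n N C A" and ctr: "markov_controllable n N A B"
    and Z: "Z \<in> carrier_mat N N" "Z' \<in> carrier_mat N N"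
    and eq: "\<And>k l. C ** hmat_pow t A k ** Z ** hmat_pow t A l ** B = C ** hmat_pow t A k ** Z' ** hmat_pow t A l ** B"
  shows "Z = Z'"
proof -
  obtain S where S: "S \<in> carrier_mat N N" and
    lift: "\<And>p X X'. X \<in> carrier_mat N p \<Longrightarrow> X' \<in> carrier_mat N p \<Longrightarrow>
        (\<And>k. C ** hmat_pow t A k ** X = C ** hmat_pow t A k ** X') \<Longrightarrow> X = S ** X'"
    using observability_lift[OF A C A C obs] by blast
  obtain T where T: "T \<in> carrier_mat N N" and
    colift: "\<And>p Z Z'. Z \<in> carrier_mat p N \<Longrightarrow> Z' \<in> carrier_mat p N \<Longrightarrow>
        (\<And>k. Z ** hmat_pow t A k ** B = Z' ** hmat_pow t A k ** B) \<Longrightarrow> Z = Z' ** T"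
    using controllability_lift[OF A B A B ctr] by blast
  have S1: "S = hmat_one N" using lift[of "hmat_one N" N "hmat_one N"] S by simp
  have T1: "T = hmat_one N" using colift[of "hmat_one N" N "hmat_one N"] T by simp
  have "Z ** hmat_pow t A l ** B = Z' ** hmat_pow t A l ** B" for l
  proof -
    have "Z ** hmat_pow t A l ** B = S ** (Z' ** hmat_pow t A l ** B)"
      by (rule lift[of _ n]) (use A B C Z eq in \<open>auto simp: hmat_assoc\<close>)
    then show ?thesis using S1 Z by simp
  qed
  from colift[OF Z this] show ?thesis using T1 Z by simp
qed

section \<open>Transfer functions\<close>

lemma mult_cancel_left:
  "V ** U = hmat_one k \<Longrightarrow> dim_col V = dim_row U \<Longrightarrow> dim_row X = k \<Longrightarrow> V ** (U ** X) = X"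
  by (metis hmat_assoc hmat_one_left)

lemma transfer_fun_at_0:
  assumes A: "A \<in> carrier_mat N N" and C: "C \<in> carrier_mat n N" and B: "B \<in> carrier_mat N n"
    and D: "D \<in> carrier_mat n n"
  shows "transfer_fun t D C A B 0 = Some D"
proof -
  have "pencil A 0 = hmat_one N" by (rule eq_matI) (use A in \<open>auto simp: pencil_def\<close>)
  then have inv: "pencil_invertible A 0"
    by (auto simp: hmat_invertible_def hmat_is_inverse_def intro!: exI[of _ "hmat_one N"] exI[of _ N])
  then show ?thesis using B C D by (simp add: transfer_fun_def)
qed

lemma add_scaleR_cancel:
  assumes "D + x *\<^sub>H E = D + x *\<^sub>H F" "x \<noteq> 0"
    and "D \<in> carrier_mat n p" "E \<in> carrier_mat n p" "F \<in> carrier_mat n p"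
  shows "E = F"
proof (rule eq_matI)
  fix i j assume ij: "i < dim_row F" "j < dim_col F"
  then have "(D + x *\<^sub>H E) $$ (i, j) = (D + x *\<^sub>H F) $$ (i, j)" using assms(1) by simp
  then show "E $$ (i, j) = F $$ (i, j)" using ij assms(2-) by (simp del: index_hmat(1))
qed (use assms in auto)

text \<open>
  If \<open>X\<close> intertwines \<open>A\<close> and \<open>A'\<close>, it intertwines \<open>I - x A\<close> and \<open>I - x A'\<close> and therefore their
  inverses.
\<close>

lemma resolvent_intertwine:
  assumes A: "A \<in> carrier_mat N N" and A': "A' \<in> carrier_mat M M" and X: "X \<in> carrier_mat M N"
    and XA: "X ** A = A' ** X"
    and inv: "pencil_invertible A x" "pencil_invertible A' x"
  shows "X ** resolvent A x = resolvent A' x ** X"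
proof -
  note R = hmat_invD[OF inv(1) pencil_carrier[OF A]]
  note R' = hmat_invD[OF inv(2) pencil_carrier[OF A']]
  have p: "pencil A' x ** X = X ** pencil A x"
    using A A' X XA by (simp add: pencil_mult mult_pencil)
  have "X ** resolvent A x = resolvent A' x ** (pencil A' x ** (X ** resolvent A x))"
    by (rule mult_cancel_left[symmetric]) (use R R' X A' in auto)
  also have "pencil A' x ** (X ** resolvent A x) = (pencil A' x ** X) ** resolvent A x"
    using A' X by (intro hmat_assoc[symmetric]) simp
  also have "\<dots> = X ** (pencil A x ** resolvent A x)"
    unfolding p using A X by (intro hmat_assoc) simp
  also have "\<dots> = X" using R X by simp
  finally show ?thesis .
qed

text \<open>
  This and the next lemma relate \<open>I - x A\<close> to \<open>I - x u A v\<close>, which is its direct sum with an identity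
  along the splitting by the projection \<open>u v\<close>.
\<close>

lemma compress_resolvent:
  assumes u: "u \<in> carrier_mat N k" and v: "v \<in> carrier_mat k N" and vu: "v ** u = hmat_one k"
    and A: "A \<in> carrier_mat k k" and inv: "pencil_invertible (u ** A ** v) x"
  shows "hmat_is_inverse t (pencil A x) (v ** resolvent (u ** A ** v) x ** u)"
proof (rule right_inverse_imp_inverse)
  have M: "u ** A ** v \<in> carrier_mat N N" using u v A by auto
  note R = hmat_invD[OF inv pencil_carrier[OF M]]
  show "v ** resolvent (u ** A ** v) x ** u \<in> carrier_mat k k" using u v R by auto
  have "pencil A x ** v = v ** pencil (u ** A ** v) x"
    using pencil_mult[OF A v, of x] mult_pencil[OF M v, of x] u v A
    by (simp add: hmat_assoc mult_cancel_left[OF vu])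
  note p = this
  have "pencil A x ** (v ** resolvent (u ** A ** v) x) = (pencil A x ** v) ** resolvent (u ** A ** v) x"
    using A v by (intro hmat_assoc[symmetric]) simp
  also have "\<dots> = v ** (pencil (u ** A ** v) x ** resolvent (u ** A ** v) x)"
    unfolding p using u v A by (intro hmat_assoc) simp
  also have "\<dots> = v" unfolding R(2) using v by simp
  finally have eq: "pencil A x ** (v ** resolvent (u ** A ** v) x) = v" .
  have "pencil A x ** (v ** resolvent (u ** A ** v) x ** u)
      = (pencil A x ** (v ** resolvent (u ** A ** v) x)) ** u"
    using A v by (intro hmat_assoc[symmetric]) simp
  also have "\<dots> = hmat_one k" unfolding eq by (rule vu)
  finally show "pencil A x ** (v ** resolvent (u ** A ** v) x ** u) = hmat_one k" .
qed (use A in simp)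

text \<open>
  With the resolvent \<open>R\<close> of \<open>A\<close>, the inverse is \<open>(I - u v) + u R v\<close>.
\<close>

lemma expand_pencil_invertible:
  assumes u: "u \<in> carrier_mat N k" and v: "v \<in> carrier_mat k N" and vu: "v ** u = hmat_one k"
    and A: "A \<in> carrier_mat k k" and inv: "pencil_invertible A x"
  shows "pencil_invertible (u ** A ** v) x"
proof -
  have M: "u ** A ** v \<in> carrier_mat N N" using u v A by auto
  note R = resolvent_carrier[OF A inv]
  define X where "X = (hmat_one N - u ** v) + u ** resolvent A x ** v"
  have X: "X \<in> carrier_mat N N" unfolding X_def using u v R by (auto intro: add_carrier_mat)
  have MX: "(u ** A ** v) ** X = u ** (A ** resolvent A x) ** v"
  proof -
    have "(u ** A ** v) ** X = (u ** A ** v - u ** A ** v) + u ** (A ** resolvent A x) ** v"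
      unfolding X_def using u v A R
      by (simp add: hmat_add_right hmat_diff_right hmat_assoc mult_cancel_left[OF vu])
    also have "\<dots> = u ** (A ** resolvent A x) ** v"
      using u v A R by (intro eq_matI) (auto simp del: index_hmat(1))
    finally show ?thesis .
  qed
  have "u ** resolvent A x ** v = u ** (hmat_one k + x *\<^sub>H (A ** resolvent A x)) ** v"
    using resolvent_eq(1)[OF A inv] by simp
  also have "\<dots> = u ** v + x *\<^sub>H (u ** (A ** resolvent A x) ** v)"
    using u v A R by (simp add: hmat_add_left hmat_add_right)
  finally have Q: "u ** resolvent A x ** v = u ** v + x *\<^sub>H (u ** (A ** resolvent A x) ** v)" .
  have "pencil (u ** A ** v) x ** X = X - x *\<^sub>H (u ** (A ** resolvent A x) ** v)"
    unfolding MX[symmetric] by (rule pencil_mult[OF M X])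
  also have "\<dots> = hmat_one N"
    unfolding X_def Q using u v A R by (intro eq_matI) (auto simp del: index_hmat(1))
  finally have "hmat_is_inverse t (pencil (u ** A ** v) x) X"
    by (intro right_inverse_imp_inverse[of _ N]) (use M X in auto)
  then show ?thesis by (auto simp: hmat_invertible_def)
qed

text \<open>
  Padding a system by a zero block changes neither the transfer function nor its domain.
\<close>

lemma transfer_fun_compress:
  assumes u: "u \<in> carrier_mat N k" and v: "v \<in> carrier_mat k N" and vu: "v ** u = hmat_one k"
    and A: "A \<in> carrier_mat k k" and B: "B \<in> carrier_mat k n" and C: "C \<in> carrier_mat n k"
  shows "transfer_fun t D (C ** v) (u ** A ** v) (u ** B) = transfer_fun t D C A B"
proof
  fix x
  show "transfer_fun t D (C ** v) (u ** A ** v) (u ** B) x = transfer_fun t D C A B x"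
  proof (cases "pencil_invertible A x")
    case True
    have inv: "pencil_invertible (u ** A ** v) x" by (rule expand_pencil_invertible[OF u v vu A True])
    have M: "u ** A ** v \<in> carrier_mat N N" using u v A by auto
    have "resolvent A x = v ** resolvent (u ** A ** v) x ** u"
      by (rule hmat_inv_eqI[OF compress_resolvent[OF u v vu A inv]])
    moreover have "(C ** v) ** resolvent (u ** A ** v) x ** (u ** B) = C ** (v ** resolvent (u ** A ** v) x ** u) ** B"
      using u v B C resolvent_carrier[OF M inv] by (simp add: hmat_assoc)
    ultimately show ?thesis using True inv by (simp add: transfer_fun_def)
  next
    case False
    then have "\<not> pencil_invertible (u ** A ** v) x"
      using compress_resolvent[OF u v vu A] by (auto simp: hmat_invertible_def)
    then show ?thesis using False by (simp add: transfer_fun_def)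
  qed
qed

section \<open>Direct sums\<close>

text \<open>
  The inclusions and coordinate projections of a direct sum. Their relations replace computations with
  block matrices.
\<close>

lemma block_embeddings:
  obtains e1 e2 p1 p2 :: "hq mat" where
    "e1 \<in> carrier_mat (a + b) a" "e2 \<in> carrier_mat (a + b) b"
    "p1 \<in> carrier_mat a (a + b)" "p2 \<in> carrier_mat b (a + b)"
    "p1 ** e1 = hmat_one a" "p2 ** e2 = hmat_one b" "p1 ** e2 = 0\<^sub>m a b" "p2 ** e1 = 0\<^sub>m b a"
    "e1 ** p1 + e2 ** p2 = hmat_one (a + b)"
proof -
  define \<delta> :: "nat \<Rightarrow> nat \<Rightarrow> hq" where "\<delta> i j = (if i = j then hq_one else 0)" for i j
  have d: "\<delta> i j \<diamondop> q = (if i = j then q else 0)" for i j q by (simp add: \<delta>_def qmult.zero_left)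
  define e1 e2 p1 p2 where "e1 = mat (a + b) a (\<lambda>(i, j). \<delta> i j)" and "e2 = mat (a + b) b (\<lambda>(i, j). \<delta> i (j + a))"
    and "p1 = mat a (a + b) (\<lambda>(i, j). \<delta> i j)" and "p2 = mat b (a + b) (\<lambda>(i, j). \<delta> (i + a) j)"
  note defs = e1_def e2_def p1_def p2_def
  show thesis
  proof
    show "p1 ** e1 = hmat_one a" "p2 ** e2 = hmat_one b" "p1 ** e2 = 0\<^sub>m a b" "p2 ** e1 = 0\<^sub>m b a"
      by (rule eq_matI; auto simp: defs d; auto simp: \<delta>_def)+
    show "e1 ** p1 + e2 ** p2 = hmat_one (a + b)"
    proof (rule eq_matI)
      fix i j assume "i < dim_row (hmat_one (a + b))" "j < dim_col (hmat_one (a + b))"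
      then have ij: "i < a + b" "j < a + b" by auto
      have "(e1 ** p1) $$ (i, j) = (if i < a then \<delta> i j else 0)"
        using ij by (simp add: defs d)
      moreover have "(e2 ** p2) $$ (i, j) = (if i < a then 0 else \<delta> i j)"
      proof -
        have "(e2 ** p2) $$ (i, j) = (\<Sum>k<b. if i = k + a then \<delta> (k + a) j else 0)"
          using ij by (simp add: defs d)
        also have "\<dots> = (\<Sum>k<b. if k = i - a \<and> \<not> i < a then \<delta> i j else 0)"
          by (intro sum.cong) auto
        also have "\<dots> = (if i < a then 0 else \<delta> i j)"
          using ij by (cases "i < a") auto
        finally show ?thesis .
      qed
      ultimately show "(e1 ** p1 + e2 ** p2) $$ (i, j) = hmat_one (a + b) $$ (i, j)"
        using ij by (simp add: \<delta>_def defs del: index_hmat(1))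
    qed (auto simp: defs)
  qed (auto simp: defs)
qed

text \<open>
  The matrices are the row of blocks \<open>U, U'\<close> and the column of blocks \<open>V, V'\<close>. They serve to
  enlarge a frame by one column and to compare the ranks of complementary frames.
\<close>

lemma combine_frames:
  assumes U: "U \<in> carrier_mat N k" and V: "V \<in> carrier_mat k N" and VU: "V ** U = hmat_one k"
    and U': "U' \<in> carrier_mat N k'" and V': "V' \<in> carrier_mat k' N" and VU': "V' ** U' = hmat_one k'"
    and mixed: "V ** U' = 0\<^sub>m k k'" "V' ** U = 0\<^sub>m k' k"
  obtains X Y where "X \<in> carrier_mat N (k + k')" "Y \<in> carrier_mat (k + k') N"
    "Y ** X = hmat_one (k + k')" "X ** Y = U ** V + U' ** V'"
    "\<forall>h \<in> carrier_mat (k + k') 1.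
      \<exists>a \<in> carrier_mat k 1. \<exists>b \<in> carrier_mat k' 1. X ** h = U ** a + U' ** b"
proof -
  obtain e1 e2 p1 p2 where car: "e1 \<in> carrier_mat (k + k') k" "e2 \<in> carrier_mat (k + k') k'"
    "p1 \<in> carrier_mat k (k + k')" "p2 \<in> carrier_mat k' (k + k')"
    and pe: "p1 ** e1 = hmat_one k" "p2 ** e2 = hmat_one k'" "p1 ** e2 = 0\<^sub>m k k'" "p2 ** e1 = 0\<^sub>m k' k"
    and ep: "e1 ** p1 + e2 ** p2 = hmat_one (k + k')"
    using block_embeddings[of k k'] by metis
  have z: "V ** (U' ** Z) = 0\<^sub>m k (dim_col Z)" "p1 ** (e2 ** Z) = 0\<^sub>m k (dim_col Z)" if "dim_row Z = k'" for Z
    using mixed pe U V U' V' car that by (simp_all flip: hmat_assoc)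
  have z': "V' ** (U ** Z) = 0\<^sub>m k' (dim_col Z)" "p2 ** (e1 ** Z) = 0\<^sub>m k' (dim_col Z)" if "dim_row Z = k" for Z
    using mixed pe U V U' V' car that by (simp_all flip: hmat_assoc)
  note cancel = mult_cancel_left[OF VU] mult_cancel_left[OF VU'] mult_cancel_left[OF pe(1)] mult_cancel_left[OF pe(2)] z z'
  define X Y where "X = U ** p1 + U' ** p2" and "Y = e1 ** V + e2 ** V'"
  show thesis
  proof
    show "X \<in> carrier_mat N (k + k')" "Y \<in> carrier_mat (k + k') N"
      unfolding X_def Y_def using U V U' V' car by (auto intro!: add_carrier_mat)
    show "X ** Y = U ** V + U' ** V'" unfolding X_def Y_def using U V U' V' car
      by (simp add: hmat_add_left hmat_add_right hmat_assoc cancel hmat_add_zero)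
    have "Y ** X = e1 ** p1 + e2 ** p2" unfolding X_def Y_def using U V U' V' car
      by (simp add: hmat_add_left hmat_add_right hmat_assoc cancel hmat_add_zero)
    then show "Y ** X = hmat_one (k + k')" using ep by simp
    show "\<forall>h \<in> carrier_mat (k + k') 1.
      \<exists>a \<in> carrier_mat k 1. \<exists>b \<in> carrier_mat k' 1. X ** h = U ** a + U' ** b"
    proof
      fix h :: "hq mat" assume h: "h \<in> carrier_mat (k + k') 1"
      have "X ** h = U ** (p1 ** h) + U' ** (p2 ** h)"
        unfolding X_def using U U' car h by (simp add: hmat_add_left hmat_assoc)
      moreover have "p1 ** h \<in> carrier_mat k 1" "p2 ** h \<in> carrier_mat k' 1" using car h by auto
      ultimately show "\<exists>a \<in> carrier_mat k 1. \<exists>b \<in> carrier_mat k' 1. X ** h = U ** a + U' ** b" by blast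
    qed
  qed
qed

text \<open>
  The combined block matrices are inverse to each other, and each of the two products gives one of
  the inequalities between \<open>N\<close> and \<open>k + k'\<close>.
\<close>

lemma complementary_dims:
  assumes U: "U \<in> carrier_mat N k" and V: "V \<in> carrier_mat k N" and VU: "V ** U = hmat_one k"
    and U': "U' \<in> carrier_mat N k'" and V': "V' \<in> carrier_mat k' N" and VU': "V' ** U' = hmat_one k'"
    and mixed: "V ** U' = 0\<^sub>m k k'" "V' ** U = 0\<^sub>m k' k"
    and sum: "U ** V + U' ** V' = hmat_one N"
  shows "N = k + k'"
proof -
  obtain X Y where "X \<in> carrier_mat N (k + k')" "Y \<in> carrier_mat (k + k') N"
    "Y ** X = hmat_one (k + k')" "X ** Y = U ** V + U' ** V'"
    by (rule combine_frames[OF U V VU U' V' VU' mixed])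
  then show ?thesis
    using left_inverse_imp_le[of X N "k + k'" Y] left_inverse_imp_le[of Y "k + k'" N X] sum by simp
qed

text \<open>
  The direct sum of the two systems has dimension \<open>N\<close> and the Markov parameters of the given system.
  The embedding of state spaces is then between spaces of equal dimension, hence a similarity; it
  turns inclusions and coordinate projections into \<open>u1, u2\<close> and \<open>v1, v2\<close>.
\<close>

lemma additive_state_space:
  assumes A: "A \<in> carrier_mat N N" and B: "B \<in> carrier_mat N n" and C: "C \<in> carrier_mat n N"
    and A1: "A1 \<in> carrier_mat N1 N1" and B1: "B1 \<in> carrier_mat N1 n" and C1: "C1 \<in> carrier_mat n N1"
    and A2: "A2 \<in> carrier_mat N2 N2" and B2: "B2 \<in> carrier_mat N2 n" and C2: "C2 \<in> carrier_mat n N2"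
    and obs: "markov_observable n N C A" and ctr: "markov_controllable n N A B"
    and N: "N = N1 + N2"
    and eq: "\<forall>\<^sub>F x in at 0. C ** resolvent A x ** B = C1 ** resolvent A1 x ** B1 + C2 ** resolvent A2 x ** B2"
  obtains u1 v1 u2 v2 where
    "u1 \<in> carrier_mat N N1" "v1 \<in> carrier_mat N1 N" "u2 \<in> carrier_mat N N2" "v2 \<in> carrier_mat N2 N"
    "v1 ** u1 = hmat_one N1" "v2 ** u2 = hmat_one N2" "u1 ** v1 + u2 ** v2 = hmat_one N"
    "A ** u1 = u1 ** A1" "v1 ** A = A1 ** v1" "C ** u1 = C1" "v1 ** B = B1"
    "A ** u2 = u2 ** A2" "v2 ** A = A2 ** v2" "C ** u2 = C2" "v2 ** B = B2"
proof -
  obtain e1 e2 p1 p2 where car: "e1 \<in> carrier_mat N N1" "e2 \<in> carrier_mat N N2"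
    "p1 \<in> carrier_mat N1 N" "p2 \<in> carrier_mat N2 N"
    and pe: "p1 ** e1 = hmat_one N1" "p2 ** e2 = hmat_one N2" "p1 ** e2 = 0\<^sub>m N1 N2" "p2 ** e1 = 0\<^sub>m N2 N1"
    and ep: "e1 ** p1 + e2 ** p2 = hmat_one N"
    using block_embeddings[of N1 N2] unfolding N by metis
  have z12: "p1 ** (e2 ** X) = 0\<^sub>m N1 (dim_col X)" if "dim_row X = N2" for X
    using pe(3) car that by (simp flip: hmat_assoc)
  have z21: "p2 ** (e1 ** X) = 0\<^sub>m N2 (dim_col X)" if "dim_row X = N1" for X
    using pe(4) car that by (simp flip: hmat_assoc)
  note cancel = mult_cancel_left[OF pe(1)] mult_cancel_left[OF pe(2)] z12 z21
  define A' B' C' where "A' = e1 ** (A1 ** p1) + e2 ** (A2 ** p2)"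
    and "B' = e1 ** B1 + e2 ** B2" and "C' = C1 ** p1 + C2 ** p2"
  note defs = A'_def B'_def C'_def
  have car': "A' \<in> carrier_mat N N" "B' \<in> carrier_mat N n" "C' \<in> carrier_mat n N"
    unfolding defs using car A1 B1 C1 A2 B2 C2 by (auto intro!: add_carrier_mat)
  note dims = car car' A B C A1 B1 C1 A2 B2 C2
  have p1A: "p1 ** A' = A1 ** p1" and p2A: "p2 ** A' = A2 ** p2"
    and Ae1: "A' ** e1 = e1 ** A1" and Ae2: "A' ** e2 = e2 ** A2"
    and p1B: "p1 ** B' = B1" and p2B: "p2 ** B' = B2" and Ce1: "C' ** e1 = C1" and Ce2: "C' ** e2 = C2"
    unfolding defs using dims
    by (auto simp: hmat_add_left hmat_add_right hmat_assoc cancel pe hmat_add_zero)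
  have "\<forall>\<^sub>F x in at 0. C ** resolvent A x ** B = C' ** resolvent A' x ** B'"
    using eq eventually_at_0I[OF eventually_pencil_invertible[OF A1]]
      eventually_at_0I[OF eventually_pencil_invertible[OF A2]]
      eventually_at_0I[OF eventually_pencil_invertible[OF car'(1)]]
  proof eventually_elim
    case (elim x)
    have r1: "p1 ** resolvent A' x = resolvent A1 x ** p1"
      by (rule resolvent_intertwine[OF car'(1) A1 _ p1A]) (use car elim in auto)
    have r2: "p2 ** resolvent A' x = resolvent A2 x ** p2"
      by (rule resolvent_intertwine[OF car'(1) A2 _ p2A]) (use car elim in auto)
    have "C' ** resolvent A' x ** B' = C1 ** ((p1 ** resolvent A' x) ** B') + C2 ** ((p2 ** resolvent A' x) ** B')"
      unfolding C'_def using dims elim by (simp add: hmat_add_left hmat_assoc)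
    also have "\<dots> = C1 ** resolvent A1 x ** B1 + C2 ** resolvent A2 x ** B2"
      unfolding r1 r2 using dims elim by (simp add: hmat_assoc p1B p2B)
    finally show ?case using elim(1) by simp
  qed
  then have markov: "C ** hmat_pow t A k ** B = C' ** hmat_pow t A' k ** B'" for k
    by (rule markov_eqI[OF A C car'(1) car'(3) B car'(2)])
  obtain S T where S: "S \<in> carrier_mat N N" and T: "T \<in> carrier_mat N N" and ST: "S ** T = hmat_one N"
    and sim: "A = S ** A' ** T" "B = S ** B'" "C = C' ** T"
    using state_space_embedding[OF A B C car' obs ctr markov] by blast
  have TS: "T ** S = hmat_one N"
    using right_inverse_imp_inverse[OF S T ST] S by (auto simp: hmat_is_inverse_def)
  note cancel' = mult_cancel_left[OF ST] mult_cancel_left[OF TS]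
  show thesis
  proof
    show "S ** e1 \<in> carrier_mat N N1" "p1 ** T \<in> carrier_mat N1 N"
      "S ** e2 \<in> carrier_mat N N2" "p2 ** T \<in> carrier_mat N2 N" using S T car by auto
    show "(p1 ** T) ** (S ** e1) = hmat_one N1" "(p2 ** T) ** (S ** e2) = hmat_one N2"
      using S T car pe by (auto simp: hmat_assoc cancel')
    have "(S ** e1) ** (p1 ** T) + (S ** e2) ** (p2 ** T) = S ** ((e1 ** p1 + e2 ** p2) ** T)"
      using S T car by (simp add: hmat_add_left hmat_add_right hmat_assoc)
    then show "(S ** e1) ** (p1 ** T) + (S ** e2) ** (p2 ** T) = hmat_one N"
      unfolding ep using S T ST by simp
    show "A ** (S ** e1) = S ** e1 ** A1" "A ** (S ** e2) = S ** e2 ** A2"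
      unfolding sim(1) using S T dims by (auto simp: hmat_assoc cancel' Ae1 Ae2)
    show "C ** (S ** e1) = C1" "C ** (S ** e2) = C2"
      unfolding sim(3) using S T dims by (auto simp: hmat_assoc cancel' Ce1 Ce2)
    show "p1 ** T ** B = B1" "p2 ** T ** B = B2"
      unfolding sim(2) using S T dims by (auto simp: hmat_assoc cancel' p1B p2B)
    have "p1 ** T ** A = (p1 ** A') ** T" "p2 ** T ** A = (p2 ** A') ** T"
      unfolding sim(1) using S T dims by (auto simp: hmat_assoc cancel')
    then show "p1 ** T ** A = A1 ** (p1 ** T)" "p2 ** T ** A = A2 ** (p2 ** T)"
      unfolding p1A p2A using S T dims by (auto simp: hmat_assoc)
  qed
qed

lemma minimal_dim_unique:
  assumes A: "A \<in> carrier_mat N N" and B: "B \<in> carrier_mat N n" and C: "C \<in> carrier_mat n N"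
    and A': "A' \<in> carrier_mat M M" and B': "B' \<in> carrier_mat M n" and C': "C' \<in> carrier_mat n M"
    and obs: "markov_observable n N C A" "markov_observable n M C' A'"
    and ctr: "markov_controllable n N A B" "markov_controllable n M A' B'"
    and markov: "\<And>k. C ** hmat_pow t A k ** B = C' ** hmat_pow t A' k ** B'"
  shows "N = M"
proof (rule antisym)
  show "N \<le> M"
    using state_space_embedding[OF A B C A' B' C' obs(1) ctr(1) markov] left_inverse_imp_le by metis
  show "M \<le> N"
    using state_space_embedding[OF A' B' C' A B C obs(2) ctr(2) markov[symmetric]] left_inverse_imp_le by metis
qed

section \<open>Odd transfer functions\<close>

text \<open>
  The relation for \<open>A\<close> says \<open>(I + x A)\<^sup>\<circledast> H = H (I - x A)\<close>. For the resolvent \<open>R\<close> this becomes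
  \<open>R(-x)\<^sup>\<circledast> H = H R(x)\<close>, and \<open>C\<^sup>\<circledast> = H B\<close> turns it into a symmetry of \<open>C R B\<close>.
\<close>

lemma odd_antisymmetric_transfer_fun:
  assumes A: "A \<in> carrier_mat N N" and B: "B \<in> carrier_mat N n" and C: "C \<in> carrier_mat n N"
    and D: "D \<in> carrier_mat n n" "D = - (D\<^sup>\<circledast>)"
    and H: "H \<in> carrier_mat N N" "H\<^sup>\<circledast> = H" and AH: "A\<^sup>\<circledast> ** H = - (H ** A)" and CB: "C\<^sup>\<circledast> = H ** B"
  shows "odd_antisymmetric (transfer_fun t D C A B)"
  unfolding odd_antisymmetric_def
proof (intro allI impI)
  fix x Y Z assume Y: "transfer_fun t D C A B x = Some Y" and Z: "transfer_fun t D C A B (- x) = Some Z"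
  then have inv: "pencil_invertible A x" "pencil_invertible A (- x)"
    by (auto simp: transfer_fun_def split: if_splits)
  define R R' where "R = resolvent A x" and "R' = resolvent A (- x)"
  have R: "R \<in> carrier_mat N N" "pencil A x ** R = hmat_one N"
    using hmat_invD[OF inv(1) pencil_carrier[OF A]] by (auto simp: R_def)
  have R': "R' \<in> carrier_mat N N" "pencil A (- x) ** R' = hmat_one N"
    using hmat_invD[OF inv(2) pencil_carrier[OF A]] by (auto simp: R'_def)
  have "R'\<^sup>\<circledast> ** (pencil A (- x))\<^sup>\<circledast> = (pencil A (- x) ** R')\<^sup>\<circledast>"
    using R' A by (intro hmat_adj_mult[symmetric]) simp
  then have R'_adj: "R'\<^sup>\<circledast> ** (pencil A (- x))\<^sup>\<circledast> = hmat_one N" by (simp add: R')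
  have "(pencil A (- x))\<^sup>\<circledast> ** H = H ** pencil A x"
  proof -
    have "(pencil A (- x))\<^sup>\<circledast> ** H = H - (- x) *\<^sub>H (A\<^sup>\<circledast> ** H)"
      using A H by (simp add: pencil_def hmat_adj_diff hmat_diff_left)
    also have "\<dots> = H - x *\<^sub>H (H ** A)"
      unfolding AH using A H by (intro eq_matI) (auto simp del: index_hmat(1))
    finally show ?thesis using A H by (simp add: mult_pencil)
  qed
  then have "R'\<^sup>\<circledast> ** (H ** pencil A x) = (R'\<^sup>\<circledast> ** (pencil A (- x))\<^sup>\<circledast>) ** H"
    using R' A H by (simp add: hmat_assoc)
  then have "R'\<^sup>\<circledast> ** (H ** pencil A x) = H" using R'_adj H by simp
  then have "H ** R = R'\<^sup>\<circledast> ** (H ** pencil A x) ** R" by simp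
  also have "\<dots> = R'\<^sup>\<circledast> ** (H ** (pencil A x ** R))"
    using R(1) R'(1) A H by (simp add: hmat_assoc)
  finally have HR: "R'\<^sup>\<circledast> ** H = H ** R" using R H R' by simp
  have "C = (C\<^sup>\<circledast>)\<^sup>\<circledast>" by simp
  then have C_eq: "C = B\<^sup>\<circledast> ** H" unfolding CB using H B by (simp add: hmat_adj_mult)
  have K: "(C ** R' ** B)\<^sup>\<circledast> = C ** R ** B"
  proof -
    have "(C ** R' ** B)\<^sup>\<circledast> = B\<^sup>\<circledast> ** (R'\<^sup>\<circledast> ** C\<^sup>\<circledast>)"
      using A B C R' by (simp add: hmat_adj_mult)
    also have "\<dots> = B\<^sup>\<circledast> ** ((R'\<^sup>\<circledast> ** H) ** B)"
      unfolding CB using B H R' by (simp add: hmat_assoc)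
    also have "\<dots> = (B\<^sup>\<circledast> ** H) ** R ** B"
      unfolding HR using B H R by (simp add: hmat_assoc)
    finally show ?thesis by (simp flip: C_eq)
  qed
  have "- Z\<^sup>\<circledast> = - (D\<^sup>\<circledast>) + x *\<^sub>H (C ** R' ** B)\<^sup>\<circledast>"
    using Z inv D(1) C B R'(1) by (auto simp: transfer_fun_def R'_def[symmetric] intro!: eq_matI simp del: index_hmat(1))
  also have "\<dots> = D + x *\<^sub>H (C ** R ** B)" unfolding K by (simp flip: D(2))
  also have "\<dots> = Y" using Y inv by (simp add: transfer_fun_def R_def)
  finally show "Y = - Z\<^sup>\<circledast>" by simp
qed

lemma resolvent_adj:
  assumes A: "A \<in> carrier_mat N N" and inv: "pencil_invertible A (- x)"
  shows "(resolvent A (- x))\<^sup>\<circledast> = resolvent (- (A\<^sup>\<circledast>)) x"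
proof (rule hmat_inv_eqI[symmetric], rule right_inverse_imp_inverse)
  note R = hmat_invD[OF inv pencil_carrier[OF A]]
  have p: "pencil (- (A\<^sup>\<circledast>)) x = (pencil A (- x))\<^sup>\<circledast>"
    using A by (intro eq_matI) (auto simp: pencil_def)
  show "pencil (- (A\<^sup>\<circledast>)) x \<in> carrier_mat N N" "(resolvent A (- x))\<^sup>\<circledast> \<in> carrier_mat N N"
    unfolding p using R A by auto
  have "pencil (- (A\<^sup>\<circledast>)) x ** (resolvent A (- x))\<^sup>\<circledast> = (resolvent A (- x) ** pencil A (- x))\<^sup>\<circledast>"
    unfolding p using R A by (intro hmat_adj_mult[symmetric]) simp
  then show "pencil (- (A\<^sup>\<circledast>)) x ** (resolvent A (- x))\<^sup>\<circledast> = hmat_one N" using R by simp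
qed

lemma odd_antisymmetric_value_at_0:
  assumes "A \<in> carrier_mat N N" "B \<in> carrier_mat N n" "C \<in> carrier_mat n N" "D \<in> carrier_mat n n"
    and "odd_antisymmetric (transfer_fun t D C A B)"
  shows "D = - (D\<^sup>\<circledast>)"
  using assms(5) transfer_fun_at_0[OF assms(1,3,2,4)] unfolding odd_antisymmetric_def
  by (metis minus_zero)

lemma eventually_reflect: "\<forall>\<^sub>F x in nhds 0. P x \<Longrightarrow> \<forall>\<^sub>F x in nhds 0. P (- x)" for P :: "real \<Rightarrow> bool"
  by (auto simp: eventually_nhds_metric dist_real_def)

text \<open>
  The converse on the level of Markov parameters: near \<open>0\<close> an odd function is also
  realized by the adjoint system \<open>(B\<^sup>\<circledast>, - A\<^sup>\<circledast>, C\<^sup>\<circledast>)\<close> with the same \<open>D\<close>.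
\<close>

lemma odd_antisymmetric_markov:
  assumes A: "A \<in> carrier_mat N N" and B: "B \<in> carrier_mat N n" and C: "C \<in> carrier_mat n N"
    and D: "D \<in> carrier_mat n n" and odd: "odd_antisymmetric (transfer_fun t D C A B)"
  shows "C ** hmat_pow t A k ** B = B\<^sup>\<circledast> ** hmat_pow t (- (A\<^sup>\<circledast>)) k ** C\<^sup>\<circledast>"
proof (rule markov_eqI[OF A C])
  show "\<forall>\<^sub>F x in at 0. C ** resolvent A x ** B = B\<^sup>\<circledast> ** resolvent (- (A\<^sup>\<circledast>)) x ** C\<^sup>\<circledast>"
    using eventually_at_0I[OF eventually_pencil_invertible[OF A]] eventually_neq_at_within[of 0 0]
      eventually_at_0I[OF eventually_reflect[OF eventually_pencil_invertible[OF A]]]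
  proof eventually_elim
    case (elim x)
    define E F where "E = C ** resolvent A x ** B" and "F = C ** resolvent A (- x) ** B"
    have EF: "E \<in> carrier_mat n n" "F \<in> carrier_mat n n" unfolding E_def F_def using A B C elim by auto
    have "D + x *\<^sub>H E = - (D + (- x) *\<^sub>H F)\<^sup>\<circledast>"
    proof -
      have "transfer_fun t D C A B x = Some (D + x *\<^sub>H E)"
        "transfer_fun t D C A B (- x) = Some (D + (- x) *\<^sub>H F)"
        using elim by (simp_all add: transfer_fun_def E_def F_def)
      then show ?thesis using odd unfolding odd_antisymmetric_def by blast
    qed
    also have "\<dots> = - (D\<^sup>\<circledast>) + x *\<^sub>H (F\<^sup>\<circledast>)"
      using D EF by (intro eq_matI) auto
    also have "- (D\<^sup>\<circledast>) = D" using odd_antisymmetric_value_at_0[OF A B C D odd] by simp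
    finally have "E = F\<^sup>\<circledast>" using add_scaleR_cancel D EF elim by blast
    also have "F\<^sup>\<circledast> = B\<^sup>\<circledast> ** (resolvent A (- x))\<^sup>\<circledast> ** C\<^sup>\<circledast>"
      unfolding F_def using A B C elim by (simp add: hmat_adj_mult hmat_assoc)
    also have "\<dots> = B\<^sup>\<circledast> ** resolvent (- (A\<^sup>\<circledast>)) x ** C\<^sup>\<circledast>" using resolvent_adj[OF A] elim by simp
    finally show ?case unfolding E_def .
  qed
qed (use A B C in auto)

section \<open>Orthogonal projections\<close>

lemma lessThan_one_nat [simp]: "{..<1::nat} = {0}"
  by auto

definition re_form :: "hq mat \<Rightarrow> hq mat \<Rightarrow> real" where
  "re_form f g = Re (fst ((f\<^sup>\<circledast> ** g) $$ (0, 0)))"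

text \<open>
  The trace of the matrix \<open>I(q)\<close> is twice the real part of the complex component of \<open>q\<close>.
\<close>

lemma hform_eq:
  assumes f: "f \<in> carrier_mat N 1" and g: "g \<in> carrier_mat N 1"
  shows "hform t N f g = of_real (2 * re_form f g)"
proof -
  have "(\<Sum>i<2. (hq_I t p * hq_I t q) $$ (i, i)) = of_real (2 * Re (fst (p \<diamondop> q)))" for p q
    by (simp add: hq_I_def hq_mult_def mat_of_rows_list_def scalar_prod_def numeral_2_eq_2 One_nat_def
        complex_eq_iff)
  then have "hform t N f g = (\<Sum>k<N. of_real (2 * Re (fst (hq_conj (f $$ (k, 0)) \<diamondop> g $$ (k, 0)))))"
    by (simp add: hform_def)
  also have "\<dots> = of_real (2 * re_form f g)"
    using f g by (auto simp: re_form_def fst_sum sum_distrib_left)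
  finally show ?thesis .
qed

lemma re_form_add_right:
  "f \<in> carrier_mat N 1 \<Longrightarrow> g \<in> carrier_mat N 1 \<Longrightarrow> h \<in> carrier_mat N 1 \<Longrightarrow> re_form f (g + h) = re_form f g + re_form f h"
  by (simp add: re_form_def hmat_add_right del: index_hmat(1))

lemma re_form_add_left:
  "f \<in> carrier_mat N 1 \<Longrightarrow> g \<in> carrier_mat N 1 \<Longrightarrow> h \<in> carrier_mat N 1 \<Longrightarrow> re_form (f + g) h = re_form f h + re_form g h"
  by (simp add: re_form_def hmat_adj_add hmat_add_left del: index_hmat(1))

lemma re_form_adjoint:
  "f \<in> carrier_mat N 1 \<Longrightarrow> g \<in> carrier_mat N 1 \<Longrightarrow> A \<in> carrier_mat N N \<Longrightarrow> re_form f (A ** g) = re_form (A\<^sup>\<circledast> ** f) g"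
  by (simp add: re_form_def hmat_adj_mult hmat_assoc)

lemma re_form_commute:
  assumes "f \<in> carrier_mat N 1" "g \<in> carrier_mat N 1"
  shows "re_form f g = re_form g f"
proof -
  have "g\<^sup>\<circledast> ** f = (f\<^sup>\<circledast> ** g)\<^sup>\<circledast>" using assms by (simp add: hmat_adj_mult)
  then have "(g\<^sup>\<circledast> ** f) $$ (0, 0) = hq_conj ((f\<^sup>\<circledast> ** g) $$ (0, 0))"
    using assms by (simp del: index_hmat(1))
  then show ?thesis by (simp add: re_form_def hq_conj_def)
qed

lemma re_form_zero_left [simp]: "g \<in> carrier_mat N 1 \<Longrightarrow> re_form (0\<^sub>m N 1) g = 0"
  by (simp add: re_form_def)

text \<open>
  The form is tested against the column obtained from \<open>f\<close> by changing the second component by the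
  factor \<open>- sgn t\<close>; this gives the sum of squares for the positive involution.
\<close>

lemma re_form_nondegenerate:
  assumes f: "f \<in> carrier_mat N 1" and z: "\<And>g. g \<in> carrier_mat N 1 \<Longrightarrow> re_form f g = 0"
  shows "f = 0\<^sub>m N 1"
proof -
  define g where "g = map_mat (\<lambda>q. (fst q, - of_real (sgn t) * snd q)) f"
  have g: "g \<in> carrier_mat N 1" using f by (simp add: g_def)
  have re: "Re (fst (hq_conj q \<diamondop> (fst q, - of_real (sgn t) * snd q))) = (cmod (fst q))\<^sup>2 + \<bar>t\<bar> * (cmod (snd q))\<^sup>2" for q
  proof -
    have "Re (fst (hq_conj q \<diamondop> (fst q, - of_real (sgn t) * snd q))) = (cmod (fst q))\<^sup>2 + t * sgn t * (cmod (snd q))\<^sup>2"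
      unfolding cmod_power2 by (simp add: hq_conj_def hq_mult_def power2_eq_square algebra_simps)
    then show ?thesis by (simp add: abs_sgn[symmetric])
  qed
  have "re_form f g = (\<Sum>k<N. Re (fst (hq_conj (f $$ (k, 0)) \<diamondop> (fst (f $$ (k, 0)), - of_real (sgn t) * snd (f $$ (k, 0))))))"
    using f by (simp add: re_form_def g_def fst_sum)
  also have "\<dots> = sq_norm f" unfolding re sq_norm_eq[OF f] ..
  finally show ?thesis using z[OF g] sq_norm_eq_0D[OF f] by simp
qed

definition fixed_space :: "nat \<Rightarrow> hq mat \<Rightarrow> hq mat set" where
  "fixed_space N P = {f \<in> carrier_mat N 1. P ** f = f}"

text \<open>
  \<open>P\<close> is the orthogonal projection onto its range iff it is idempotent and self-adjoint for \<open>[f, g]\<^sub>H\<close>.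
\<close>

definition H_orthogonal_projection :: "nat \<Rightarrow> hq mat \<Rightarrow> hq mat \<Rightarrow> bool" where
  "H_orthogonal_projection N H P \<longleftrightarrow> P \<in> carrier_mat N N \<and> P ** P = P \<and> P\<^sup>\<circledast> ** H = H ** P"

text \<open>
  By self-adjointness \<open>[f, P g]\<^sub>H\<close> is the pairing of \<open>H P f\<close> with \<open>g\<close>. It vanishes for all \<open>g\<close> iff
  \<open>H P f = 0\<close>, and \<open>H\<close> is invertible.
\<close>

lemma perp_fixed_space:
  assumes H: "H \<in> carrier_mat N N" "H\<^sup>\<circledast> = H" "hmat_invertible t H" and P: "H_orthogonal_projection N H P"
  shows "perp_H t N H (fixed_space N P) = {f \<in> carrier_mat N 1. P ** f = 0\<^sub>m N 1}"
proof (rule subset_antisym; rule subsetI)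
  have P': "P \<in> carrier_mat N N" "P ** P = P" "P\<^sup>\<circledast> ** H = H ** P"
    using P by (auto simp: H_orthogonal_projection_def)
  have form: "re_form f (H ** (P ** g)) = re_form (H ** (P ** f)) g"
    if "f \<in> carrier_mat N 1" "g \<in> carrier_mat N 1" for f g
  proof -
    have "re_form f (H ** (P ** g)) = re_form f ((H ** P) ** g)" using that H P' by (simp add: hmat_assoc)
    also have "\<dots> = re_form ((H ** P)\<^sup>\<circledast> ** f) g" by (rule re_form_adjoint) (use that H P' in auto)
    also have "(H ** P)\<^sup>\<circledast> = H ** P" using H P' by (simp add: hmat_adj_mult)
    finally show ?thesis using that H P' by (simp add: hmat_assoc)
  qed
  {
    fix f assume "f \<in> perp_H t N H (fixed_space N P)"
    then have f: "f \<in> carrier_mat N 1" and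
      perp: "\<And>m. m \<in> fixed_space N P \<Longrightarrow> hform t N f (H ** m) = 0"
      by (auto simp: perp_H_def hform_H_def)
    have "re_form (H ** (P ** f)) g = 0" if g: "g \<in> carrier_mat N 1" for g
    proof -
      have "P ** (P ** g) = P ** g" using P' by (simp flip: hmat_assoc)
      then have "hform t N f (H ** (P ** g)) = 0"
        by (intro perp) (use P' g in \<open>auto simp: fixed_space_def\<close>)
      then have "re_form f (H ** (P ** g)) = 0"
        using hform_eq[OF f, of "H ** (P ** g)"] H P' g by auto
      then show ?thesis using form[OF f g] by simp
    qed
    then have "H ** (P ** f) = 0\<^sub>m N 1" by (intro re_form_nondegenerate) (use H P' f in auto)
    then have "hmat_inv t H ** (H ** (P ** f)) = 0\<^sub>m N 1" using hmat_invD[OF H(3,1)] by simp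
    moreover have "hmat_inv t H ** (H ** (P ** f)) = P ** f"
      by (rule mult_cancel_left) (use hmat_invD[OF H(3,1)] H P' in auto)
    ultimately show "f \<in> {f \<in> carrier_mat N 1. P ** f = 0\<^sub>m N 1}" using f by simp
  next
    fix f assume "f \<in> {f \<in> carrier_mat N 1. P ** f = 0\<^sub>m N 1}"
    then have f: "f \<in> carrier_mat N 1" "P ** f = 0\<^sub>m N 1" by auto
    have "hform t N f (H ** m) = 0" if "m \<in> fixed_space N P" for m
    proof -
      have m: "m \<in> carrier_mat N 1" "P ** m = m" using that by (auto simp: fixed_space_def)
      have "re_form f (H ** m) = 0" using form[OF f(1) m(1)] f m H by simp
      then show ?thesis using hform_eq[OF f(1), of "H ** m"] H m by auto
    qed
    then show "f \<in> perp_H t N H (fixed_space N P)" using f by (auto simp: perp_H_def hform_H_def)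
  }
qed

lemma mult_residual:
  assumes "P \<in> carrier_mat N N" "f \<in> carrier_mat N 1"
  shows "P ** (f - P ** f) = P ** f - P ** P ** f"
  using assms by (simp add: hmat_diff_right hmat_assoc)

lemma H_projection_fixed_space:
  assumes H: "H \<in> carrier_mat N N" "H\<^sup>\<circledast> = H" "hmat_invertible t H" and P: "H_orthogonal_projection N H P"
  shows "H_projection t N H (fixed_space N P) = P"
  unfolding H_projection_def perp_fixed_space[OF assms]
proof (rule the_equality)
  have P': "P \<in> carrier_mat N N" "P ** P = P"
    using P by (auto simp: H_orthogonal_projection_def)
  show "P \<in> carrier_mat N N \<and> (\<forall>f\<in>fixed_space N P. P ** f = f) \<and>
      (\<forall>f\<in>{f \<in> carrier_mat N 1. P ** f = 0\<^sub>m N 1}. P ** f = 0\<^sub>m N 1)"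
    using P' by (auto simp: fixed_space_def)
  fix Q assume Q: "Q \<in> carrier_mat N N \<and> (\<forall>f\<in>fixed_space N P. Q ** f = f) \<and>
      (\<forall>f\<in>{f \<in> carrier_mat N 1. P ** f = 0\<^sub>m N 1}. Q ** f = 0\<^sub>m N 1)"
  show "Q = P"
  proof (rule hmat_eqI_columns[of _ N N])
    fix h :: "hq mat" assume h: "h \<in> carrier_mat N 1"
    have "P ** (P ** h) = P ** h" using P' by (simp flip: hmat_assoc)
    then have 1: "Q ** (P ** h) = P ** h" using Q P' h by (auto simp: fixed_space_def)
    have c: "h - P ** h \<in> carrier_mat N 1" using P' h by (intro minus_carrier_mat) auto
    have "P ** (h - P ** h) = P ** h - P ** h" using mult_residual[OF P'(1) h] P' by simp
    also have "\<dots> = 0\<^sub>m N 1" using P' h by (intro diff_self_hmat) auto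
    finally have "Q ** (h - P ** h) = 0\<^sub>m N 1" using Q c by blast
    moreover have Qc: "Q \<in> carrier_mat N N" using Q by blast
    ultimately have "Q ** h - Q ** (P ** h) = 0\<^sub>m N 1" using P'(1) h by (simp add: hmat_diff_right)
    then have "Q ** h = Q ** (P ** h)" by (rule hmat_diff_eq_0) (use Q P' h in auto)
    then show "Q ** h = P ** h" using 1 by simp
  qed (use Q P' in auto)
qed

lemma H_orthogonal_projection_eqI:
  assumes "H \<in> carrier_mat N N" "H\<^sup>\<circledast> = H" "hmat_invertible t H"
    and "H_orthogonal_projection N H P" "H_orthogonal_projection N H Q" "fixed_space N P = fixed_space N Q"
  shows "P = Q"
  using H_projection_fixed_space assms by metis

lemma H_orthogonal_projection_complement:
  assumes H: "H \<in> carrier_mat N N" and P: "H_orthogonal_projection N H P"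
  shows "H_orthogonal_projection N H (hmat_one N - P)"
    and "fixed_space N (hmat_one N - P) = {f \<in> carrier_mat N 1. P ** f = 0\<^sub>m N 1}"
    and "{f \<in> carrier_mat N 1. (hmat_one N - P) ** f = 0\<^sub>m N 1} = fixed_space N P"
proof -
  have P': "P \<in> carrier_mat N N" "P ** P = P" "P\<^sup>\<circledast> ** H = H ** P"
    using P by (auto simp: H_orthogonal_projection_def)
  have c: "hmat_one N - P \<in> carrier_mat N N" using P' by (intro minus_carrier_mat)
  have "(hmat_one N - P) ** (hmat_one N - P) = hmat_one N - P - (P - P)"
    using P' c by (simp add: hmat_diff_left hmat_diff_right)
  also have "\<dots> = hmat_one N - P" using P' by (intro eq_matI) auto
  finally show "H_orthogonal_projection N H (hmat_one N - P)"
    using P' H c by (simp add: H_orthogonal_projection_def hmat_adj_diff hmat_diff_left hmat_diff_right)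
  have app: "(hmat_one N - P) ** f = f - P ** f" if "f \<in> carrier_mat N 1" for f
    using that P' by (simp add: hmat_diff_left)
  show "fixed_space N (hmat_one N - P) = {f \<in> carrier_mat N 1. P ** f = 0\<^sub>m N 1}"
    unfolding fixed_space_def
  proof (intro Collect_cong conj_cong refl)
    fix f :: "hq mat" assume f: "f \<in> carrier_mat N 1"
    have "f - P ** f = f \<longleftrightarrow> f = f + P ** f"
      by (rule hmat_diff_eq_iff[of _ N 1]) (use f P' in auto)
    also have "\<dots> \<longleftrightarrow> P ** f = 0\<^sub>m N 1"
    proof
      assume eq: "f = f + P ** f"
      show "P ** f = 0\<^sub>m N 1"
      proof (rule eq_matI)
        fix i j assume ij: "i < dim_row (0\<^sub>m N 1)" "j < dim_col (0\<^sub>m N 1)"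
        have "f $$ (i, j) = (f + P ** f) $$ (i, j)" using eq by simp
        then show "(P ** f) $$ (i, j) = 0\<^sub>m N 1 $$ (i, j)" using ij f P' by (simp del: index_hmat(1))
      qed (use f P' in auto)
    qed (use f in simp)
    finally show "(hmat_one N - P) ** f = f \<longleftrightarrow> P ** f = 0\<^sub>m N 1" using app[OF f] by simp
  qed
  show "{f \<in> carrier_mat N 1. (hmat_one N - P) ** f = 0\<^sub>m N 1} = fixed_space N P"
    unfolding fixed_space_def
  proof (intro Collect_cong conj_cong refl)
    fix f :: "hq mat" assume f: "f \<in> carrier_mat N 1"
    have "f - P ** f = 0\<^sub>m N 1 \<longleftrightarrow> P ** f = f"
      using hmat_diff_eq_0[of f "P ** f" N 1] f P' by (auto simp del: index_hmat(1))
    then show "(hmat_one N - P) ** f = 0\<^sub>m N 1 \<longleftrightarrow> P ** f = f" using app[OF f] by simp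
  qed
qed

lemma fixed_space_subspace:
  assumes P: "P \<in> carrier_mat N N"
  shows "right_subspace t N (fixed_space N P)"
proof -
  have "map_mat (\<lambda>p. p \<diamondop> q) f \<in> fixed_space N P" if f: "f \<in> fixed_space N P" for f q
  proof -
    define Q where "Q = mat 1 1 (\<lambda>_. q)"
    have fc: "f \<in> carrier_mat N 1" "P ** f = f" using f by (auto simp: fixed_space_def)
    have "map_mat (\<lambda>p. p \<diamondop> q) f = f ** Q"
      using fc by (intro eq_matI) (auto simp: Q_def)
    moreover have "P ** (f ** Q) = f ** Q" using fc P by (simp flip: hmat_assoc)
    moreover have "f ** Q \<in> carrier_mat N 1" using fc by (auto simp: Q_def)
    ultimately show ?thesis by (simp add: fixed_space_def)
  qed
  then show ?thesis
    using P by (auto simp: right_subspace_def fixed_space_def hmat_add_right intro: add_carrier_mat)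
qed

lemma fixed_space_nondegenerate:
  assumes "H \<in> carrier_mat N N" "H\<^sup>\<circledast> = H" "hmat_invertible t H" "H_orthogonal_projection N H P"
  shows "nondegenerate_H t N H (fixed_space N P)"
  using assms(4) unfolding nondegenerate_H_def perp_fixed_space[OF assms]
  by (auto simp: fixed_space_def H_orthogonal_projection_def)

text \<open>
  Gram-Schmidt orthogonalization. A family of columns of \<open>W\<close> is recorded as a matrix \<open>U\<close> with a left
  inverse \<open>V\<close> for which \<open>U V\<close> is self-adjoint; a maximal family spans \<open>W\<close>. Since \<open>f\<^sup>\<circledast> H f\<close> is real, it is invertible as
  soon as it is not zero, even when the algebra has zero divisors. A column of \<open>W\<close> orthogonal to a
  maximal family is therefore isotropic, polarization makes all such columns mutually orthogonal, and
  non-degeneracy leaves only \<open>0\<close>.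
\<close>

lemma nondegenerate_frame:
  assumes H: "H \<in> carrier_mat N N" "H\<^sup>\<circledast> = H"
    and W: "right_subspace t N W" and nd: "nondegenerate_H t N H W"
  obtains k U V where "U \<in> carrier_mat N k" "V \<in> carrier_mat k N" "V ** U = hmat_one k"
    "H_orthogonal_projection N H (U ** V)" "W = fixed_space N (U ** V)"
proof -
  have W0: "W \<subseteq> carrier_mat N 1" "0\<^sub>m N 1 \<in> W"
    and Wadd: "\<And>f g. f \<in> W \<Longrightarrow> g \<in> W \<Longrightarrow> f + g \<in> W"
    and Wmult: "\<And>f q. f \<in> W \<Longrightarrow> map_mat (\<lambda>p. p \<diamondop> q) f \<in> W"
    using W by (auto simp: right_subspace_def)
  have Wdiff: "f - g \<in> W" if "f \<in> W" "g \<in> W" for f g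
  proof -
    have "f \<in> carrier_mat N 1" "g \<in> carrier_mat N 1" using that W0(1) by blast+
    then have "f - g = f + map_mat (\<lambda>p. p \<diamondop> (- hq_one)) g"
      by (intro eq_matI) (auto simp: qmult.minus_right)
    then show ?thesis using Wadd[OF that(1) Wmult[OF that(2)]] by simp
  qed
  \<comment> \<open>\<open>frame k U V\<close>: the \<open>k\<close> columns of \<open>U\<close> lie in \<open>W\<close>, and \<open>U V\<close> is the orthogonal projection onto
    their span. The length \<open>k\<close> is bounded by \<open>N\<close>, so there is a longest frame.\<close>
  define frame where "frame k U V \<longleftrightarrow> U \<in> carrier_mat N k \<and> V \<in> carrier_mat k N \<and> V ** U = hmat_one k \<and>
      (U ** V)\<^sup>\<circledast> ** H = H ** (U ** V) \<and> (\<forall>h \<in> carrier_mat k 1. U ** h \<in> W)" for k U V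
  have "frame 0 (0\<^sub>m N 0) (0\<^sub>m 0 N)"
  proof -
    have "0\<^sub>m 0 N ** 0\<^sub>m N 0 = hmat_one 0" by (rule eq_matI) auto
    then show ?thesis using W0 H by (auto simp: frame_def)
  qed
  then have ex: "\<exists>U V. frame 0 U V" by blast
  have "k \<le> N" if "\<exists>U V. frame k U V" for k
    using that left_inverse_imp_le by (auto simp: frame_def)
  then obtain k where "\<exists>U V. frame k U V" and max: "\<And>j. \<exists>U V. frame j U V \<Longrightarrow> j \<le> k"
    using Nat.ex_has_greatest_nat[of "\<lambda>k. \<exists>U V. frame k U V" 0 N] ex by blast
  then obtain U V where UV: "frame k U V" by blast
  then have U: "U \<in> carrier_mat N k" and V: "V \<in> carrier_mat k N" and VU: "V ** U = hmat_one k"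
    and UVH: "(U ** V)\<^sup>\<circledast> ** H = H ** (U ** V)" and UW: "\<And>h. h \<in> carrier_mat k 1 \<Longrightarrow> U ** h \<in> W"
    by (auto simp: frame_def)
  define P where "P = U ** V"
  have P: "P \<in> carrier_mat N N" using U V by (auto simp: P_def)
  have PP: "P ** P = P" using U V by (simp add: P_def hmat_assoc mult_cancel_left[OF VU])
  have PH: "P\<^sup>\<circledast> ** H = H ** P" using UVH by (simp add: P_def)
  have PW: "P ** f \<in> W" if "f \<in> W" for f
    using UW[of "V ** f"] that W0 U V by (auto simp: P_def hmat_assoc)
  \<comment> \<open>A non-isotropic column orthogonal to the frame could be added to it.\<close>
  have isotropic: "re_form w (H ** w) = 0" if w: "w \<in> W" "P ** w = 0\<^sub>m N 1" for w
  proof (rule ccontr)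
    assume ne: "re_form w (H ** w) \<noteq> 0"
    have wc: "w \<in> carrier_mat N 1" using w W0 by auto
    define r where "r = re_form w (H ** w)"
    define s where "s = w\<^sup>\<circledast> ** (H ** w)"
    have s: "s \<in> carrier_mat 1 1" using wc H by (auto simp: s_def)
    have "s\<^sup>\<circledast> = s" unfolding s_def using wc H by (simp add: hmat_adj_mult hmat_assoc)
    moreover have "s\<^sup>\<circledast> $$ (0, 0) = hq_conj (s $$ (0, 0))" using s by simp
    ultimately have "s $$ (0, 0) = hq_conj (s $$ (0, 0))" by simp
    then have "s $$ (0, 0) = r *\<^sub>R hq_one"
      by (auto simp: r_def re_form_def s_def[symmetric] hq_conj_def hq_one_def complex_eq_iff prod_eq_iff
          simp del: index_hmat(1))
    then have s_eq: "s = r *\<^sub>H hmat_one 1" using s by (intro eq_matI) auto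
    \<comment> \<open>The new row of the left inverse; \<open>r\<close> can be divided by because it is real.\<close>
    define v where "v = (1 / r) *\<^sub>H (w\<^sup>\<circledast> ** H)"
    have v: "v \<in> carrier_mat 1 N" using wc H by (auto simp: v_def)
    have vw: "v ** w = hmat_one 1"
      using wc H ne s_eq unfolding v_def s_def r_def by (simp add: hmat_assoc)
    have "V ** (P ** w) = V ** w" using U V by (simp add: P_def hmat_assoc mult_cancel_left[OF VU])
    then have Vw: "V ** w = 0\<^sub>m k 1" using w V by simp
    have "U\<^sup>\<circledast> ** (H ** w) = (P ** U)\<^sup>\<circledast> ** (H ** w)"
      using U V by (simp add: P_def hmat_assoc VU)
    also have "\<dots> = U\<^sup>\<circledast> ** ((P\<^sup>\<circledast> ** H) ** w)" using U P H by (simp add: hmat_adj_mult hmat_assoc)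
    also have "\<dots> = 0\<^sub>m k 1" unfolding PH using U H P w by (simp add: hmat_assoc)
    finally have "(w\<^sup>\<circledast> ** (H ** U))\<^sup>\<circledast> = (0\<^sub>m 1 k)\<^sup>\<circledast>"
      using U H wc by (simp add: hmat_adj_mult hmat_assoc)
    then have "w\<^sup>\<circledast> ** (H ** U) = 0\<^sub>m 1 k" by (simp only: hmat_adj_inject)
    then have vU: "v ** U = 0\<^sub>m 1 k"
      unfolding v_def using U H wc by (simp add: hmat_assoc) (rule eq_matI; simp)
    obtain U' V' where U': "U' \<in> carrier_mat N (k + 1)" and V': "V' \<in> carrier_mat (k + 1) N"
      and V'U': "V' ** U' = hmat_one (k + 1)" and U'V': "U' ** V' = P + w ** v"
      and split: "\<forall>h \<in> carrier_mat (k + 1) 1.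
        \<exists>a \<in> carrier_mat k 1. \<exists>b \<in> carrier_mat 1 1. U' ** h = U ** a + w ** b"
      unfolding P_def by (rule combine_frames[OF U V VU wc v vw Vw vU])
    have "(w ** v)\<^sup>\<circledast> ** H = H ** (w ** v)"
      unfolding v_def using wc H by (simp add: hmat_adj_mult hmat_assoc)
    then have "(U' ** V')\<^sup>\<circledast> ** H = H ** (U' ** V')"
      unfolding U'V' using P wc v H PH by (simp add: hmat_adj_add hmat_add_left hmat_add_right)
    moreover have "U' ** h \<in> W" if h: "h \<in> carrier_mat (k + 1) 1" for h
    proof -
      obtain a b where a: "a \<in> carrier_mat k 1" and b: "b \<in> carrier_mat 1 1" and ab: "U' ** h = U ** a + w ** b"
        using split h by blast
      have "w ** b = map_mat (\<lambda>p. p \<diamondop> b $$ (0, 0)) w" using wc b by (intro eq_matI) auto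
      then have "w ** b \<in> W" using Wmult[OF w(1)] by simp
      then show ?thesis unfolding ab by (rule Wadd[OF UW[OF a]])
    qed
    ultimately have "frame (k + 1) U' V'" using U' V' V'U' unfolding frame_def by blast
    then show False using max[of "k + 1"] by auto
  qed
  have residual: "m - P ** m \<in> W" "P ** (m - P ** m) = 0\<^sub>m N 1" if "m \<in> W" for m
  proof -
    have m: "m \<in> carrier_mat N 1" using that W0 by auto
    show "m - P ** m \<in> W" using that Wdiff PW by blast
    have "P ** (m - P ** m) = P ** m - P ** m" using mult_residual[OF P m] PP by simp
    also have "\<dots> = 0\<^sub>m N 1" using P m by (intro diff_self_hmat) auto
    finally show "P ** (m - P ** m) = 0\<^sub>m N 1" .
  qed
  \<comment> \<open>Polarization: the form vanishes on \<open>w\<close>, \<open>w'\<close> and \<open>w + w'\<close>.\<close>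
  have isotropic2: "re_form w (H ** w') = 0"
    if w: "w \<in> W" "P ** w = 0\<^sub>m N 1" and w': "w' \<in> W" "P ** w' = 0\<^sub>m N 1" for w w'
  proof -
    have c: "w \<in> carrier_mat N 1" "w' \<in> carrier_mat N 1" "H ** w \<in> carrier_mat N 1" "H ** w' \<in> carrier_mat N 1"
      using w w' W0 H by auto
    have "w + w' \<in> W" "P ** (w + w') = 0\<^sub>m N 1"
      using w w' c P Wadd by (auto simp: hmat_add_right)
    then have "0 = re_form (w + w') (H ** (w + w'))" using isotropic by simp
    also have "\<dots> = re_form (w + w') (H ** w + H ** w')" using c H by (simp add: hmat_add_right)
    also have "\<dots> = re_form (w + w') (H ** w) + re_form (w + w') (H ** w')"
      using c by (intro re_form_add_right) (auto intro: add_carrier_mat)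
    also have "\<dots> = (re_form w (H ** w) + re_form w' (H ** w)) + (re_form w (H ** w') + re_form w' (H ** w'))"
      by (simp only: re_form_add_left[OF c(1,2,3)] re_form_add_left[OF c(1,2,4)])
    also have "re_form w' (H ** w) = re_form (H ** w') w" using re_form_adjoint[OF c(2,1) H(1)] H by simp
    also have "\<dots> = re_form w (H ** w')" using c by (intro re_form_commute) auto
    finally show ?thesis using isotropic w w' by simp
  qed
  have "W = fixed_space N P"
  proof
    show "W \<subseteq> fixed_space N P"
    proof
      fix m assume m: "m \<in> W"
      then have mc: "m \<in> carrier_mat N 1" using W0 by auto
      define w where "w = m - P ** m"
      have w: "w \<in> W" "P ** w = 0\<^sub>m N 1" using residual[OF m] by (auto simp: w_def)
      then have wc: "w \<in> carrier_mat N 1" using W0 by auto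
      have "hform t N w (H ** m') = 0" if m': "m' \<in> W" for m'
      proof -
        have mc': "m' \<in> carrier_mat N 1" using m' W0 by auto
        define w' where "w' = m' - P ** m'"
        have w': "w' \<in> W" "P ** w' = 0\<^sub>m N 1" using residual[OF m'] by (auto simp: w'_def)
        then have wc': "w' \<in> carrier_mat N 1" using W0 by auto
        have "m' = P ** m' + w'" unfolding w'_def
          using P mc' by (intro eq_matI) (auto simp del: index_hmat(1))
        then have "H ** m' = H ** (P ** m' + w')" by simp
        also have "\<dots> = H ** (P ** m') + H ** w'" using H P mc' wc' by (intro hmat_add_right) auto
        finally have "H ** m' = H ** (P ** m') + H ** w'" .
        then have "re_form w (H ** m') = re_form w (H ** (P ** m')) + re_form w (H ** w')"
          using re_form_add_right[OF wc, of "H ** (P ** m')" "H ** w'"] H P mc' wc' by auto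
        also have "re_form w (H ** w') = 0" by (rule isotropic2[OF w w'])
        also have "H ** (P ** m') = P\<^sup>\<circledast> ** (H ** m')"
        proof -
          have "H ** (P ** m') = (P\<^sup>\<circledast> ** H) ** m'" unfolding PH using H P by (simp add: hmat_assoc)
          then show ?thesis using H P by (simp add: hmat_assoc)
        qed
        also have "re_form w (P\<^sup>\<circledast> ** (H ** m')) = re_form (P ** w) (H ** m')"
          using re_form_adjoint[OF wc, of "H ** m'" "P\<^sup>\<circledast>"] H P mc' by auto
        also have "\<dots> = 0" unfolding w(2) using re_form_zero_left[of "H ** m'" N] H mc' by auto
        finally show ?thesis using hform_eq[OF wc, of "H ** m'"] H mc' by auto
      qed
      then have "w \<in> W \<inter> perp_H t N H W" using w wc by (auto simp: perp_H_def hform_H_def)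
      then have "m - P ** m = 0\<^sub>m N 1" using nd by (auto simp: nondegenerate_H_def w_def)
      then have "m = P ** m" by (rule hmat_diff_eq_0) (use mc P in auto)
      then show "m \<in> fixed_space N P" using mc by (auto simp: fixed_space_def)
    qed
    show "fixed_space N P \<subseteq> W"
    proof
      fix f assume "f \<in> fixed_space N P"
      then have f: "f \<in> carrier_mat N 1" "P ** f = f" by (auto simp: fixed_space_def)
      have "U ** (V ** f) \<in> W" by (rule UW) (use V f in auto)
      then show "f \<in> W" using f U V by (simp add: P_def hmat_assoc)
    qed
  qed
  then show thesis
    using that[OF U V VU] P PP PH by (auto simp: H_orthogonal_projection_def P_def)
qed

end

section \<open>Decompositions of an odd minimal system\<close>

text \<open>
  A minimal realization of an odd function with its associated matrix. The conditions on \<open>H\<close> are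
  solved for \<open>A\<^sup>\<circledast> H\<close> and \<open>C\<^sup>\<circledast>\<close>, since computations move \<open>\<circledast>\<close> past \<open>H\<close> from left to right.
\<close>

locale odd_minimal_system = generalized_quaternions t for t :: real +
  fixes n N :: nat and D C A B H :: "hq mat"
  assumes D: "D \<in> carrier_mat n n" and C: "C \<in> carrier_mat n N"
    and A: "A \<in> carrier_mat N N" and B: "B \<in> carrier_mat N n"
    and obs: "markov_observable n N C A" and ctr: "markov_controllable n N A B"
    and H: "H \<in> carrier_mat N N" "H\<^sup>\<circledast> = H" "hmat_invertible t H"
    and AH: "A\<^sup>\<circledast> ** H = - (H ** A)" and CB: "C\<^sup>\<circledast> = H ** B"
    and D_odd: "D = - (D\<^sup>\<circledast>)"
begin

text \<open>
  Invariance of \<open>W\<close> is \<open>P A P = A P\<close>. Applying \<open>\<circledast>\<close> and moving \<open>H\<close> through with \<open>A\<^sup>\<circledast> H = - H A\<close> and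
  \<open>P\<^sup>\<circledast> H = H P\<close> gives \<open>P A P = P A\<close>.
\<close>

lemma invariant_imp_commute:
  assumes P: "H_orthogonal_projection N H P" and inv: "invariant_under t A (fixed_space N P)"
  shows "A ** P = P ** A"
proof -
  have P': "P \<in> carrier_mat N N" "P ** P = P" "P\<^sup>\<circledast> ** H = H ** P"
    using P by (auto simp: H_orthogonal_projection_def)
  have PAP: "P ** (A ** P) = A ** P"
  proof (rule hmat_eqI_columns[of _ N N])
    fix h :: "hq mat" assume h: "h \<in> carrier_mat N 1"
    have "P ** (P ** h) = P ** h" using P' by (simp flip: hmat_assoc)
    then have "P ** h \<in> fixed_space N P" using P' h by (auto simp: fixed_space_def)
    then have "A ** (P ** h) \<in> fixed_space N P" using inv by (auto simp: invariant_under_def)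
    then show "P ** (A ** P) ** h = A ** P ** h"
      using P' A by (simp add: fixed_space_def hmat_assoc)
  qed (use A P' in auto)
  have "(P ** (A ** P))\<^sup>\<circledast> = P\<^sup>\<circledast> ** (A\<^sup>\<circledast> ** P\<^sup>\<circledast>)"
    using A P'(1) by (simp add: hmat_adj_mult hmat_assoc)
  then have "P\<^sup>\<circledast> ** (A\<^sup>\<circledast> ** P\<^sup>\<circledast>) ** H = (A ** P)\<^sup>\<circledast> ** H" unfolding PAP by simp
  then have "P\<^sup>\<circledast> ** (A\<^sup>\<circledast> ** (P\<^sup>\<circledast> ** H)) = P\<^sup>\<circledast> ** (A\<^sup>\<circledast> ** H)"
    using A P'(1) H by (simp add: hmat_adj_mult hmat_assoc)
  moreover have "P\<^sup>\<circledast> ** (A\<^sup>\<circledast> ** (P\<^sup>\<circledast> ** H)) = - (P\<^sup>\<circledast> ** H ** (A ** P))"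
  proof -
    have "A\<^sup>\<circledast> ** (P\<^sup>\<circledast> ** H) = (A\<^sup>\<circledast> ** H) ** P" unfolding P'(3) using A H by (simp add: hmat_assoc)
    then show ?thesis unfolding AH using A H P'(1) by (simp add: hmat_assoc)
  qed
  moreover have "P\<^sup>\<circledast> ** (A\<^sup>\<circledast> ** H) = - (P\<^sup>\<circledast> ** H ** A)"
    unfolding AH using A H P'(1) by (simp add: hmat_assoc)
  ultimately have "- (H ** P ** (A ** P)) = - (H ** P ** A)" unfolding P'(3) by simp
  then have "- (- (H ** P ** (A ** P))) = - (- (H ** P ** A))" by (rule arg_cong)
  then have "H ** P ** (A ** P) = H ** P ** A" by simp
  then have "H ** (P ** (A ** P)) = H ** (P ** A)" using A H P'(1) by (simp add: hmat_assoc)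
  then have "hmat_inv t H ** (H ** (P ** (A ** P))) = hmat_inv t H ** (H ** (P ** A))" by simp
  moreover have "hmat_inv t H ** (H ** X) = X" if "dim_row X = N" for X
    by (rule mult_cancel_left) (use hmat_invD[OF H(3,1)] H that in auto)
  ultimately show ?thesis using P'(1) A PAP by simp
qed

lemma complement_commute:
  assumes "P \<in> carrier_mat N N" "A ** P = P ** A"
  shows "A ** (hmat_one N - P) = (hmat_one N - P) ** A"
  using A assms by (simp add: hmat_diff_left hmat_diff_right)

lemma compressed_markov:
  assumes P: "P \<in> carrier_mat N N" "P ** P = P" and AP: "A ** P = P ** A"
  shows "(C ** P) ** hmat_pow t (P ** A ** P) k ** (P ** B) = C ** hmat_pow t A k ** (P ** B)"
proof -
  have "A ** P = P ** (P ** A ** P)"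
  proof -
    have "P ** (P ** A ** P) = (P ** P) ** (A ** P)" using P(1) A by (simp add: hmat_assoc)
    also have "\<dots> = (P ** P) ** A" unfolding P(2) AP using P A by (simp flip: hmat_assoc)
    also have "\<dots> = A ** P" unfolding P(2) AP ..
    finally show ?thesis ..
  qed
  then have "hmat_pow t A k ** P = P ** hmat_pow t (P ** A ** P) k"
    by (intro hmat_pow_intertwine[of _ N _ N]) (use A P(1) in auto)
  then have "(C ** P) ** hmat_pow t (P ** A ** P) k ** (P ** B) = C ** (hmat_pow t A k ** P) ** (P ** B)"
    using A P(1) C by (simp add: hmat_assoc)
  also have "\<dots> = C ** hmat_pow t A k ** ((P ** P) ** B)" using A P(1) C by (simp add: hmat_assoc)
  finally show ?thesis unfolding P(2) .
qed

text \<open>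
  The compression satisfies the same relations as the system, with the same \<open>H\<close>.
\<close>

lemma compressed_odd:
  assumes P: "H_orthogonal_projection N H P" and E: "E \<in> carrier_mat n n" "E = - (E\<^sup>\<circledast>)"
  shows "odd_antisymmetric (compressed_fun t P E C A B)"
  unfolding compressed_fun_def
proof (rule odd_antisymmetric_transfer_fun[OF _ _ _ E H(1,2)])
  have P': "P \<in> carrier_mat N N" "P ** P = P" "P\<^sup>\<circledast> ** H = H ** P"
    using P by (auto simp: H_orthogonal_projection_def)
  show "P ** A ** P \<in> carrier_mat N N" "P ** B \<in> carrier_mat N n" "C ** P \<in> carrier_mat n N"
    using P'(1) A B C by auto
  have "(P ** A ** P)\<^sup>\<circledast> ** H = P\<^sup>\<circledast> ** (A\<^sup>\<circledast> ** (P\<^sup>\<circledast> ** H))"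
    using P'(1) A H by (simp add: hmat_adj_mult hmat_assoc)
  also have "\<dots> = P\<^sup>\<circledast> ** ((A\<^sup>\<circledast> ** H) ** P)" unfolding P'(3) using A H by (simp add: hmat_assoc)
  also have "\<dots> = - ((P\<^sup>\<circledast> ** H) ** (A ** P))" unfolding AH using P'(1) A H by (simp add: hmat_assoc)
  also have "\<dots> = - (H ** (P ** A ** P))" unfolding P'(3) using P'(1) A H by (simp add: hmat_assoc)
  finally show "(P ** A ** P)\<^sup>\<circledast> ** H = - (H ** (P ** A ** P))" .
  have "(C ** P)\<^sup>\<circledast> = (P\<^sup>\<circledast> ** H) ** B" using P'(1) C H B by (simp add: hmat_adj_mult CB hmat_assoc)
  then show "(C ** P)\<^sup>\<circledast> = H ** (P ** B)" unfolding P'(3) using P'(1) H by (simp add: hmat_assoc)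
qed

text \<open>
  In the coordinates given by \<open>U\<close> and \<open>V\<close>, the compression has state space of dimension \<open>k\<close>. Since \<open>U V\<close>
  commutes with \<open>A\<close>, its outputs are those of the states \<open>U h\<close>, and dually for the rows \<open>h V\<close>.
\<close>

lemma compressed_minimal:
  assumes U: "U \<in> carrier_mat N k" and V: "V \<in> carrier_mat k N" and VU: "V ** U = hmat_one k"
    and AP: "A ** (U ** V) = U ** V ** A" and E: "E \<in> carrier_mat n n"
  shows "minimal_realization t n k (compressed_fun t (U ** V) E C A B) E (C ** U) (V ** A ** U) (V ** B)"
proof -
  have car: "C ** U \<in> carrier_mat n k" "V ** A ** U \<in> carrier_mat k k" "V ** B \<in> carrier_mat k n"
    using U V A B C by auto
  have "compressed_fun t (U ** V) E C A B
      = transfer_fun t E (C ** U ** V) (U ** (V ** A ** U) ** V) (U ** (V ** B))"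
    unfolding compressed_fun_def using U V A B C by (simp add: hmat_assoc)
  also have "\<dots> = transfer_fun t E (C ** U) (V ** A ** U) (V ** B)"
    by (rule transfer_fun_compress[OF U V VU car(2,3,1)])
  finally have "realization t n k (compressed_fun t (U ** V) E C A B) E (C ** U) (V ** A ** U) (V ** B)"
    using E car by (simp add: realization_def)
  moreover have "observable t n k (C ** U) (V ** A ** U)"
    unfolding observable_iff_markov[OF car(2,1)]
  proof (intro ballI impI)
    fix h assume h: "h \<in> carrier_mat k 1" and z: "\<forall>l. C ** U ** hmat_pow t (V ** A ** U) l ** h = 0\<^sub>m n 1"
    have "U ** (V ** A ** U) = (U ** V ** A) ** U" using U V A by (simp add: hmat_assoc)
    also have "\<dots> = A ** U" unfolding AP[symmetric] using U V A by (simp add: hmat_assoc VU)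
    finally have "hmat_pow t A l ** U = U ** hmat_pow t (V ** A ** U) l" for l
      by (intro hmat_pow_intertwine[OF A car(2) U]) simp
    note pow = this
    have "C ** hmat_pow t A l ** (U ** h) = C ** U ** hmat_pow t (V ** A ** U) l ** h" for l
    proof -
      have "C ** hmat_pow t A l ** (U ** h) = C ** (hmat_pow t A l ** U) ** h"
        using A C U by (simp add: hmat_assoc)
      also have "\<dots> = C ** U ** hmat_pow t (V ** A ** U) l ** h"
        unfolding pow using car(2) C U by (simp add: hmat_assoc)
      finally show ?thesis .
    qed
    then have "\<forall>l. C ** hmat_pow t A l ** (U ** h) = 0\<^sub>m n 1" using z by simp
    moreover have "U ** h \<in> carrier_mat N 1" using U h by auto
    ultimately have "U ** h = 0\<^sub>m N 1" using obs unfolding markov_observable_def by blast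
    then have "V ** (U ** h) = 0\<^sub>m k 1" using V by simp
    then show "h = 0\<^sub>m k 1" using mult_cancel_left[OF VU] U V h by simp
  qed
  moreover have "controllable t n k (V ** A ** U) (V ** B)"
    unfolding controllable_iff[OF car(2,3)]
  proof (intro ballI impI)
    fix h assume h: "h \<in> carrier_mat 1 k" and z: "\<forall>l. h ** hmat_pow t (V ** A ** U) l ** (V ** B) = 0\<^sub>m 1 n"
    have "(V ** A ** U) ** V = V ** (A ** (U ** V))" using U V A by (simp add: hmat_assoc)
    also have "\<dots> = V ** A" unfolding AP using U V A by (simp add: hmat_assoc mult_cancel_left[OF VU])
    finally have "hmat_pow t (V ** A ** U) l ** V = V ** hmat_pow t A l" for l
      by (intro hmat_pow_intertwine[OF car(2) A V])
    note pow = this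
    have "h ** V ** hmat_pow t A l ** B = h ** hmat_pow t (V ** A ** U) l ** (V ** B)" for l
    proof -
      have "h ** V ** hmat_pow t A l ** B = h ** (V ** hmat_pow t A l) ** B"
        using A V h by (simp add: hmat_assoc)
      also have "\<dots> = h ** hmat_pow t (V ** A ** U) l ** (V ** B)"
        unfolding pow[symmetric] using U V A h by (simp add: hmat_assoc)
      finally show ?thesis .
    qed
    then have "\<forall>l. h ** V ** hmat_pow t A l ** B = 0\<^sub>m 1 n" using z by simp
    moreover have "h ** V \<in> carrier_mat 1 N" using V h by auto
    ultimately have "h ** V = 0\<^sub>m 1 N" using ctr unfolding markov_controllable_def by blast
    then have "(h ** V) ** U = 0\<^sub>m 1 k" using U by simp
    then show "h = 0\<^sub>m 1 k" using U V h VU by (simp add: hmat_assoc)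
  qed
  ultimately show ?thesis by (simp add: minimal_realization_def)
qed

lemma minimal_realization_self: "minimal_realization t n N (transfer_fun t D C A B) D C A B"
  using obs ctr D C A B
  by (simp add: minimal_realization_def realization_def observable_iff_markov controllable_iff
      markov_observable_def markov_controllable_def)

lemma compressed_sum:
  assumes P: "P \<in> carrier_mat N N" and AP: "A ** P = P ** A" and PP: "P ** P = P"
    and E: "E1 \<in> carrier_mat n n" "E2 \<in> carrier_mat n n" "D = E1 + E2"
    and Y: "transfer_fun t D C A B x = Some Y"
      "compressed_fun t P E1 C A B x = Some Y1" "compressed_fun t (hmat_one N - P) E2 C A B x = Some Y2"
  shows "Y = Y1 + Y2"
proof -
  define Q where "Q = hmat_one N - P"
  have Q: "Q \<in> carrier_mat N N" unfolding Q_def using P by (intro minus_carrier_mat)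
  have AQ: "A ** Q = Q ** A" unfolding Q_def by (rule complement_commute[OF P AP])
  have QQ: "Q ** Q = Q"
  proof -
    have "Q ** Q = hmat_one N - P - (P - P)"
      using P Q PP unfolding Q_def by (simp add: hmat_diff_left hmat_diff_right)
    also have "\<dots> = Q" unfolding Q_def using P by (intro eq_matI) auto
    finally show ?thesis .
  qed
  have part: "C ** P' ** resolvent (P' ** A ** P') x ** (P' ** B) = C ** resolvent A x ** (P' ** B)"
    if P': "P' \<in> carrier_mat N N" "A ** P' = P' ** A" "P' ** P' = P'"
      and inv: "pencil_invertible (P' ** A ** P') x" "pencil_invertible A x" for P'
  proof -
    have M: "P' ** A ** P' \<in> carrier_mat N N" using P' A by auto
    have "P' ** (P' ** A ** P') = (P' ** P') ** (A ** P')" using P'(1) A by (simp add: hmat_assoc)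
    also have "\<dots> = (P' ** P') ** A" unfolding P'(2,3) using P' A by (simp flip: hmat_assoc)
    also have "\<dots> = A ** P'" using P' by simp
    finally have "P' ** resolvent (P' ** A ** P') x = resolvent A x ** P'"
      by (intro resolvent_intertwine[OF M A P'(1) _ inv])
    then have "C ** P' ** resolvent (P' ** A ** P') x ** (P' ** B) = C ** (resolvent A x ** P') ** (P' ** B)"
      using C P'(1) A inv by (simp add: hmat_assoc)
    also have "\<dots> = C ** resolvent A x ** ((P' ** P') ** B)"
      using C P'(1) A inv by (simp add: hmat_assoc)
    finally show ?thesis unfolding P'(3) .
  qed
  have inv: "pencil_invertible A x" "pencil_invertible (P ** A ** P) x" "pencil_invertible (Q ** A ** Q) x"
    using Y by (auto simp: transfer_fun_def compressed_fun_def Q_def split: if_splits)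
  define R where "R = resolvent A x"
  have R: "R \<in> carrier_mat N N" using A inv by (simp add: R_def)
  have Y1: "Y1 = E1 + x *\<^sub>H (C ** R ** (P ** B))"
    using Y(2) inv part[OF P AP PP inv(2,1)] by (simp add: transfer_fun_def compressed_fun_def R_def)
  have Y2: "Y2 = E2 + x *\<^sub>H (C ** R ** (Q ** B))"
    using Y(3) inv part[OF Q AQ QQ inv(3,1)] by (simp add: transfer_fun_def compressed_fun_def R_def Q_def)
  have "P + Q = hmat_one N" unfolding Q_def using P by (intro eq_matI) auto
  then have "C ** R ** B = C ** R ** ((P + Q) ** B)" using B by simp
  also have "\<dots> = C ** R ** (P ** B) + C ** R ** (Q ** B)"
    using P Q B C R by (simp add: hmat_add_left hmat_add_right)
  finally have "C ** R ** B = C ** R ** (P ** B) + C ** R ** (Q ** B)" .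
  moreover have "Y = D + x *\<^sub>H (C ** R ** B)" using Y(1) inv by (simp add: transfer_fun_def R_def)
  ultimately show ?thesis unfolding Y1 Y2 E(3)
    using E P Q B C R by (intro eq_matI) (auto simp del: index_hmat(1) simp: algebra_simps)
qed

text \<open>
  Both compressions have the Markov parameters \<open>C A\<^sup>k P B\<close>, and \<open>P\<close> commutes with \<open>A\<close>, so the products
  \<open>C A\<^sup>k P A\<^sup>l B\<close> are known.
\<close>

lemma compressed_fun_inject:
  assumes P: "P \<in> carrier_mat N N" "P ** P = P" "A ** P = P ** A"
    and P': "P' \<in> carrier_mat N N" "P' ** P' = P'" "A ** P' = P' ** A"
    and E: "E \<in> carrier_mat n n" "E' \<in> carrier_mat n n"
    and eq: "compressed_fun t P E C A B = compressed_fun t P' E' C A B"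
  shows "E = E'" and "P = P'"
proof -
  have M: "P ** A ** P \<in> carrier_mat N N" "C ** P \<in> carrier_mat n N" "P ** B \<in> carrier_mat N n"
    and M': "P' ** A ** P' \<in> carrier_mat N N" "C ** P' \<in> carrier_mat n N" "P' ** B \<in> carrier_mat N n"
    using P P' A B C by auto
  have "Some E = Some E'"
    using transfer_fun_at_0[OF M E(1)] transfer_fun_at_0[OF M' E(2)] eq by (simp add: compressed_fun_def)
  then show EE: "E = E'" by simp
  have "\<forall>\<^sub>F x in at 0. (C ** P) ** resolvent (P ** A ** P) x ** (P ** B) = (C ** P') ** resolvent (P' ** A ** P') x ** (P' ** B)"
    using eventually_at_0I[OF eventually_pencil_invertible[OF M(1)]]
      eventually_at_0I[OF eventually_pencil_invertible[OF M'(1)]] eventually_neq_at_within[of 0 0]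
  proof eventually_elim
    case (elim x)
    have "compressed_fun t P E C A B x = compressed_fun t P' E' C A B x" using eq by simp
    then have "E + x *\<^sub>H ((C ** P) ** resolvent (P ** A ** P) x ** (P ** B))
        = E + x *\<^sub>H ((C ** P') ** resolvent (P' ** A ** P') x ** (P' ** B))"
      using elim EE by (simp add: compressed_fun_def transfer_fun_def)
    then show ?case
      by (rule add_scaleR_cancel[OF _ elim(3) E(1)])
        (intro carrier_hmat(1)[OF carrier_hmat(1)[OF M(2)] M(3)] resolvent_carrier[OF M(1)] elim
          carrier_hmat(1)[OF carrier_hmat(1)[OF M'(2)] M'(3)] resolvent_carrier[OF M'(1)])+
  qed
  then have "(C ** P) ** hmat_pow t (P ** A ** P) k ** (P ** B) = (C ** P') ** hmat_pow t (P' ** A ** P') k ** (P' ** B)" for k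
    by (rule markov_eqI[OF M(1,2) M'(1,2) M(3) M'(3)])
  then have markov: "C ** hmat_pow t A k ** (P ** B) = C ** hmat_pow t A k ** (P' ** B)" for k
    by (simp only: compressed_markov[OF P] compressed_markov[OF P'])
  show "P = P'"
  proof (rule sandwich_unique[OF A B C obs ctr P(1) P'(1)])
    fix k l
    have split: "C ** hmat_pow t A k ** X ** hmat_pow t A l ** B = C ** hmat_pow t A (k + l) ** (X ** B)"
      if X: "X \<in> carrier_mat N N" "A ** X = X ** A" for X
    proof -
      have "hmat_pow t A l ** X = X ** hmat_pow t A l" by (rule hmat_pow_intertwine[OF A A X])
      then have "C ** hmat_pow t A k ** X ** hmat_pow t A l ** B = C ** hmat_pow t A k ** (hmat_pow t A l ** X) ** B"
        using A B C X(1) by (simp add: hmat_assoc)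
      then show ?thesis using A B C X(1) by (simp add: hmat_assoc hmat_pow_add[OF A])
    qed
    show "C ** hmat_pow t A k ** P ** hmat_pow t A l ** B = C ** hmat_pow t A k ** P' ** hmat_pow t A l ** B"
      unfolding split[OF P(1,3)] split[OF P'(1,3)] by (rule markov)
  qed
qed

definition admissible_constants :: "(hq mat \<times> hq mat) set" where
  "admissible_constants = {(M1, M2). M1 \<in> carrier_mat n n \<and> M2 \<in> carrier_mat n n \<and>
      D - D\<^sup>\<circledast> = M1 + M2 \<and> M1 + M1\<^sup>\<circledast> = 0\<^sub>m n n \<and> M2 + M2\<^sup>\<circledast> = 0\<^sub>m n n}"

definition admissible_subspaces :: "hq mat set set" where
  "admissible_subspaces =
     {W. right_subspace t N W \<and> invariant_under t A W \<and> nondegenerate_H t N H W}"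

definition odd_decompositions :: "(hfun \<times> hfun) set" where
  "odd_decompositions = {(\<phi>1, \<phi>2). minimal_decomposition t n (transfer_fun t D C A B) \<phi>1 \<phi>2 \<and>
      odd_antisymmetric \<phi>1 \<and> odd_antisymmetric \<phi>2}"

lemma half_antisymmetric:
  assumes "M \<in> carrier_mat n n" "M + M\<^sup>\<circledast> = 0\<^sub>m n n"
  shows "(1/2) *\<^sub>H M = - (((1/2) *\<^sub>H M)\<^sup>\<circledast>)"
proof (rule eq_matI)
  fix i j assume ij: "i < dim_row (- (((1/2) *\<^sub>H M)\<^sup>\<circledast>))" "j < dim_col (- (((1/2) *\<^sub>H M)\<^sup>\<circledast>))"
  have "(M + M\<^sup>\<circledast>) $$ (i, j) = 0" using ij assms by simp
  then have "M $$ (i, j) = - hq_conj (M $$ (j, i))" using ij assms(1) by (simp add: eq_neg_iff_add_eq_0)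
  then show "((1/2) *\<^sub>H M) $$ (i, j) = (- (((1/2) *\<^sub>H M)\<^sup>\<circledast>)) $$ (i, j)" using ij assms(1) by simp
qed (use assms in auto)

lemma D_eq_halves:
  assumes "M1 \<in> carrier_mat n n" "M2 \<in> carrier_mat n n" "D - D\<^sup>\<circledast> = M1 + M2"
  shows "D = (1/2) *\<^sub>H M1 + (1/2) *\<^sub>H M2"
proof (rule eq_matI)
  fix i j assume ij: "i < dim_row ((1/2) *\<^sub>H M1 + (1/2) *\<^sub>H M2)" "j < dim_col ((1/2) *\<^sub>H M1 + (1/2) *\<^sub>H M2)"
  then have ij': "i < n" "j < n" using assms by auto
  have "D $$ (i, j) = (- (D\<^sup>\<circledast>)) $$ (i, j)" using D_odd by simp
  then have e: "hq_conj (D $$ (j, i)) = - D $$ (i, j)" using ij' D by simp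
  have "(M1 + M2) $$ (i, j) = D $$ (i, j) - hq_conj (D $$ (j, i))"
    unfolding assms(3)[symmetric] using ij' D by simp
  also have "\<dots> = 2 *\<^sub>R D $$ (i, j)" unfolding e by (simp add: scaleR_2)
  finally have "(1/2) *\<^sub>R (M1 + M2) $$ (i, j) = D $$ (i, j)" by simp
  then show "D $$ (i, j) = ((1/2) *\<^sub>H M1 + (1/2) *\<^sub>H M2) $$ (i, j)"
    using ij' assms(1,2) by (simp add: scaleR_add_right)
qed (use assms(1,2) D in auto)

text \<open>
  Both \<open>W\<close> and its orthogonal complement are non-degenerate and hence free; the two frames
  factor \<open>P\<close> and \<open>I - P\<close> and exhibit the degrees \<open>k\<close> and \<open>k'\<close>.
\<close>

lemma subspace_projection:
  assumes W: "W \<in> admissible_subspaces"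
  obtains k U V k' U' V' where
    "U \<in> carrier_mat N k" "V \<in> carrier_mat k N" "V ** U = hmat_one k"
    "U' \<in> carrier_mat N k'" "V' \<in> carrier_mat k' N" "V' ** U' = hmat_one k'"
    "hmat_one N - U ** V = U' ** V'" "N = k + k'" "H_orthogonal_projection N H (U ** V)"
    "W = fixed_space N (U ** V)" "A ** (U ** V) = U ** V ** A" "H_projection t N H W = U ** V"
proof -
  have W': "right_subspace t N W" "invariant_under t A W" "nondegenerate_H t N H W"
    using W by (auto simp: admissible_subspaces_def)
  obtain k U V where U: "U \<in> carrier_mat N k" and V: "V \<in> carrier_mat k N" and VU: "V ** U = hmat_one k"
    and P: "H_orthogonal_projection N H (U ** V)" and WP: "W = fixed_space N (U ** V)"
    using nondegenerate_frame[OF H(1,2) W'(1,3)] by metis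
  define Q where "Q = hmat_one N - U ** V"
  have Q: "H_orthogonal_projection N H Q"
    unfolding Q_def by (rule H_orthogonal_projection_complement(1)[OF H(1) P])
  then have Qc: "Q \<in> carrier_mat N N" by (simp add: H_orthogonal_projection_def)
  obtain k' U' V' where U': "U' \<in> carrier_mat N k'" and V': "V' \<in> carrier_mat k' N" and VU': "V' ** U' = hmat_one k'"
    and P': "H_orthogonal_projection N H (U' ** V')" and QP: "fixed_space N Q = fixed_space N (U' ** V')"
    using nondegenerate_frame[OF H(1,2) fixed_space_subspace[OF Qc] fixed_space_nondegenerate[OF H Q]] by metis
  have QUV: "Q = U' ** V'" by (rule H_orthogonal_projection_eqI[OF H Q P' QP])
  have sum: "U ** V + U' ** V' = hmat_one N"
    unfolding QUV[symmetric] Q_def using U V by (intro eq_matI) auto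
  have "V ** (hmat_one N - U ** V) = V - V"
    using U V by (simp add: hmat_diff_right mult_cancel_left[OF VU])
  also have "\<dots> = 0\<^sub>m k N" using V by simp
  finally have VQ: "V ** (U' ** V') = 0\<^sub>m k N" unfolding QUV[symmetric] Q_def .
  have "V ** U' = (V ** (U' ** V')) ** U'" using V U' V' by (simp add: hmat_assoc VU')
  also have "\<dots> = 0\<^sub>m k k'" unfolding VQ using U' by simp
  finally have VU1: "V ** U' = 0\<^sub>m k k'" .
  have "(hmat_one N - U ** V) ** U = U - U"
    using U V by (simp add: hmat_diff_left hmat_assoc VU)
  also have "\<dots> = 0\<^sub>m N k" using U by simp
  finally have QU: "(U' ** V') ** U = 0\<^sub>m N k" unfolding QUV[symmetric] Q_def .
  have "V' ** U = V' ** ((U' ** V') ** U)" using U U' V' by (simp add: hmat_assoc mult_cancel_left[OF VU'])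
  also have "\<dots> = 0\<^sub>m k' k" unfolding QU using V' by simp
  finally have VU2: "V' ** U = 0\<^sub>m k' k" .
  have "N = k + k'" by (rule complementary_dims[OF U V VU U' V' VU' VU1 VU2 sum])
  moreover have "A ** (U ** V) = U ** V ** A"
    using invariant_imp_commute[OF P] W'(2) WP by simp
  moreover have "H_projection t N H W = U ** V" unfolding WP by (rule H_projection_fixed_space[OF H P])
  ultimately show thesis using that[OF U V VU U' V' VU' QUV[unfolded Q_def] _ P WP] by blast
qed

lemma H_projection_admissible:
  assumes "W \<in> admissible_subspaces"
  shows "H_orthogonal_projection N H (H_projection t N H W)"
    and "W = fixed_space N (H_projection t N H W)"
    and "A ** H_projection t N H W = H_projection t N H W ** A"
  by (rule subspace_projection[OF assms], simp only:)+

lemma subspace_decomposition_mem: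
  assumes M: "(M1, M2) \<in> admissible_constants" and W: "W \<in> admissible_subspaces"
  shows "subspace_decomposition t N C A B H M1 M2 W \<in> odd_decompositions"
proof -
  have M': "M1 \<in> carrier_mat n n" "M2 \<in> carrier_mat n n" "D - D\<^sup>\<circledast> = M1 + M2"
    "M1 + M1\<^sup>\<circledast> = 0\<^sub>m n n" "M2 + M2\<^sup>\<circledast> = 0\<^sub>m n n"
    using M by (auto simp: admissible_constants_def)
  obtain k U V k' U' V' where UV: "U \<in> carrier_mat N k" "V \<in> carrier_mat k N" "V ** U = hmat_one k"
    and UV': "U' \<in> carrier_mat N k'" "V' \<in> carrier_mat k' N" "V' ** U' = hmat_one k'"
    and Q: "hmat_one N - U ** V = U' ** V'" and N: "N = k + k'" and P: "H_orthogonal_projection N H (U ** V)"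
    and "W = fixed_space N (U ** V)"
    and AP: "A ** (U ** V) = U ** V ** A" and HP: "H_projection t N H W = U ** V"
    by (rule subspace_projection[OF W])
  have P': "U ** V \<in> carrier_mat N N" "(U ** V) ** (U ** V) = U ** V"
    using P by (auto simp: H_orthogonal_projection_def)
  define E1 E2 where "E1 = (1/2) *\<^sub>H M1" and "E2 = (1/2) *\<^sub>H M2"
  have E: "E1 \<in> carrier_mat n n" "E2 \<in> carrier_mat n n" using M' by (auto simp: E1_def E2_def)
  have DE: "D = E1 + E2" unfolding E1_def E2_def by (rule D_eq_halves[OF M'(1-3)])
  define \<phi>1 \<phi>2 where "\<phi>1 = compressed_fun t (U ** V) E1 C A B" and "\<phi>2 = compressed_fun t (U' ** V') E2 C A B"
  have dec: "subspace_decomposition t N C A B H M1 M2 W = (\<phi>1, \<phi>2)"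
    by (simp add: subspace_decomposition_def HP Q \<phi>1_def \<phi>2_def E1_def E2_def)
  have AQ: "A ** (U' ** V') = U' ** V' ** A"
    unfolding Q[symmetric] by (rule complement_commute[OF P'(1) AP])
  have min1: "minimal_realization t n k \<phi>1 E1 (C ** U) (V ** A ** U) (V ** B)"
    unfolding \<phi>1_def by (rule compressed_minimal[OF UV AP E(1)])
  have min2: "minimal_realization t n k' \<phi>2 E2 (C ** U') (V' ** A ** U') (V' ** B)"
    unfolding \<phi>2_def by (rule compressed_minimal[OF UV' AQ E(2)])
  have "Y = Y1 + Y2" if "transfer_fun t D C A B x = Some Y" "\<phi>1 x = Some Y1" "\<phi>2 x = Some Y2" for x Y Y1 Y2
    using compressed_sum[OF P'(1) AP P'(2) E DE] that unfolding \<phi>1_def \<phi>2_def Q by blast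
  moreover have "rational_hfun t n \<phi>1" "rational_hfun t n \<phi>2"
    using min1 min2 unfolding rational_hfun_def minimal_realization_def by blast+
  moreover have "has_degree t n \<phi>1 k" "has_degree t n \<phi>2 k'" "has_degree t n (transfer_fun t D C A B) (k + k')"
    using min1 min2 minimal_realization_self unfolding has_degree_def N by blast+
  ultimately have "minimal_decomposition t n (transfer_fun t D C A B) \<phi>1 \<phi>2"
    unfolding minimal_decomposition_def additive_decomposition_def by blast
  moreover have "odd_antisymmetric \<phi>1"
    unfolding \<phi>1_def E1_def by (rule compressed_odd[OF P _ half_antisymmetric[OF M'(1,4)]]) (use M' in auto)
  moreover have "H_orthogonal_projection N H (U' ** V')"
    unfolding Q[symmetric] by (rule H_orthogonal_projection_complement(1)[OF H(1) P])
  then have "odd_antisymmetric \<phi>2"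
    unfolding \<phi>2_def E2_def by (rule compressed_odd[OF _ _ half_antisymmetric[OF M'(2,5)]]) (use M' in auto)
  ultimately show ?thesis unfolding dec odd_decompositions_def by simp
qed

lemma subspace_decomposition_inject:
  assumes M: "(M1, M2) \<in> admissible_constants" "(M1', M2') \<in> admissible_constants"
    and W: "W \<in> admissible_subspaces" "W' \<in> admissible_subspaces"
    and eq: "subspace_decomposition t N C A B H M1 M2 W = subspace_decomposition t N C A B H M1' M2' W'"
  shows "M1 = M1'" "M2 = M2'" "W = W'"
proof -
  have car: "M1 \<in> carrier_mat n n" "M2 \<in> carrier_mat n n" "M1' \<in> carrier_mat n n" "M2' \<in> carrier_mat n n"
    using M by (auto simp: admissible_constants_def)
  define P P' where "P = H_projection t N H W" and "P' = H_projection t N H W'"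
  note P = H_projection_admissible[OF W(1), folded P_def] and P' = H_projection_admissible[OF W(2), folded P'_def]
  have c: "P \<in> carrier_mat N N" "P ** P = P" "P' \<in> carrier_mat N N" "P' ** P' = P'"
    using P(1) P'(1) by (auto simp: H_orthogonal_projection_def)
  have eq1: "compressed_fun t P ((1/2) *\<^sub>H M1) C A B = compressed_fun t P' ((1/2) *\<^sub>H M1') C A B"
    and eq2: "compressed_fun t (hmat_one N - P) ((1/2) *\<^sub>H M2) C A B
      = compressed_fun t (hmat_one N - P') ((1/2) *\<^sub>H M2') C A B"
    using eq by (simp_all add: subspace_decomposition_def Let_def P_def P'_def)
  note inj = compressed_fun_inject[OF c(1,2) P(3) c(3,4) P'(3) carrier_hmat(3)[OF car(1)] carrier_hmat(3)[OF car(3)] eq1]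
  show "M1 = M1'" using inj(1) by simp
  show "W = W'" using inj(2) P(2) P'(2) by simp
  define Q where "Q = hmat_one N - P"
  have Q: "Q \<in> carrier_mat N N" "Q ** Q = Q"
    using H_orthogonal_projection_complement(1)[OF H(1) P(1)] by (auto simp: Q_def H_orthogonal_projection_def)
  have AQ: "A ** Q = Q ** A" unfolding Q_def by (rule complement_commute[OF c(1) P(3)])
  have "compressed_fun t Q ((1/2) *\<^sub>H M2) C A B = compressed_fun t Q ((1/2) *\<^sub>H M2') C A B"
    using eq2 inj(2) by (simp add: Q_def)
  from compressed_fun_inject(1)[OF Q AQ Q AQ carrier_hmat(3)[OF car(2)] carrier_hmat(3)[OF car(4)] this]
  show "M2 = M2'" by simp
qed

text \<open>
  The products for the \<open>H\<close>-adjoint \<open>H\<^sup>-\<^sup>1 (u v)\<^sup>\<circledast> H\<close> are computed by moving \<open>H\<close> outwards, which turns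
  powers of \<open>A\<close> into powers of \<open>- A\<^sup>\<circledast>\<close>. What results are the Markov parameters of the
  adjoint of the summand, and these agree with its own since it is odd.
\<close>

lemma odd_summand_projection:
  assumes A1: "A1 \<in> carrier_mat N1 N1" and B1: "B1 \<in> carrier_mat N1 n" and C1: "C1 \<in> carrier_mat n N1"
    and D1: "D1 \<in> carrier_mat n n" and odd: "odd_antisymmetric (transfer_fun t D1 C1 A1 B1)"
    and u: "u \<in> carrier_mat N N1" and v: "v \<in> carrier_mat N1 N" and vu: "v ** u = hmat_one N1"
    and Au: "A ** u = u ** A1" and vA: "v ** A = A1 ** v" and Cu: "C ** u = C1" and vB: "v ** B = B1"
  shows "H_orthogonal_projection N H (u ** v)"
proof -
  define Hi where "Hi = hmat_inv t H"
  have Hi: "Hi \<in> carrier_mat N N" "H ** Hi = hmat_one N" "Hi ** H = hmat_one N"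
    unfolding Hi_def by (rule hmat_invD[OF H(3,1)])+
  define A' A1' where "A' = - (A\<^sup>\<circledast>)" and "A1' = - (A1\<^sup>\<circledast>)"
  have A': "A' \<in> carrier_mat N N" and A1': "A1' \<in> carrier_mat N1 N1" using A A1 by (auto simp: A'_def A1'_def)
  have "A' ** H = H ** A" unfolding A'_def using AH by simp
  then have HA: "hmat_pow t A' k ** H = H ** hmat_pow t A k" for k
    by (rule hmat_pow_intertwine[OF A' A H(1)])
  have "(v ** A)\<^sup>\<circledast> = (A1 ** v)\<^sup>\<circledast>" unfolding vA ..
  then have "A' ** v\<^sup>\<circledast> = v\<^sup>\<circledast> ** A1'" unfolding A'_def A1'_def using v A A1 by (simp add: hmat_adj_mult)
  then have A'v: "hmat_pow t A' k ** v\<^sup>\<circledast> = v\<^sup>\<circledast> ** hmat_pow t A1' k" for k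
    by (rule hmat_pow_intertwine[OF A' A1' carrier_hmat(4)[OF v]])
  have "(A ** u)\<^sup>\<circledast> = (u ** A1)\<^sup>\<circledast>" unfolding Au ..
  then have "A1' ** u\<^sup>\<circledast> = u\<^sup>\<circledast> ** A'" unfolding A'_def A1'_def using u A A1 by (simp add: hmat_adj_mult)
  then have A1'u: "hmat_pow t A1' k ** u\<^sup>\<circledast> = u\<^sup>\<circledast> ** hmat_pow t A' k" for k
    by (rule hmat_pow_intertwine[OF A1' A' carrier_hmat(4)[OF u]])
  have Aku: "hmat_pow t A k ** u = u ** hmat_pow t A1 k" for k
    by (rule hmat_pow_intertwine[OF A A1 u Au])
  have vAk: "hmat_pow t A1 k ** v = v ** hmat_pow t A k" for k
    by (rule hmat_pow_intertwine[OF A1 A v vA[symmetric]])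
  have "C = (C\<^sup>\<circledast>)\<^sup>\<circledast>" by simp
  then have C_eq: "C = B\<^sup>\<circledast> ** H" unfolding CB using H B by (simp add: hmat_adj_mult)
  have P: "u ** v \<in> carrier_mat N N" using u v by auto
  have Pa: "Hi ** ((u ** v)\<^sup>\<circledast> ** H) \<in> carrier_mat N N" using P Hi H by auto
  have "u ** v = Hi ** ((u ** v)\<^sup>\<circledast> ** H)"
  proof (rule sandwich_unique[OF A B C obs ctr P Pa])
    fix k l
    have "C ** hmat_pow t A k ** (u ** v) ** hmat_pow t A l ** B = C ** (hmat_pow t A k ** u) ** ((v ** hmat_pow t A l) ** B)"
      using A B C u v by (simp add: hmat_assoc)
    also have "\<dots> = (C ** u) ** (hmat_pow t A1 k ** hmat_pow t A1 l) ** (v ** B)"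
      unfolding Aku vAk[symmetric] using A1 B C u v by (simp add: hmat_assoc)
    finally have lhs: "C ** hmat_pow t A k ** (u ** v) ** hmat_pow t A l ** B = C1 ** hmat_pow t A1 (k + l) ** B1"
      unfolding Cu vB hmat_pow_add[OF A1] .
    have "C ** hmat_pow t A k ** (Hi ** ((u ** v)\<^sup>\<circledast> ** H)) ** hmat_pow t A l ** B
        = B\<^sup>\<circledast> ** (H ** hmat_pow t A k) ** Hi ** (u ** v)\<^sup>\<circledast> ** (H ** hmat_pow t A l) ** B"
      unfolding C_eq using A B H(1) Hi(1) u v by (simp add: hmat_assoc)
    also have "\<dots> = B\<^sup>\<circledast> ** hmat_pow t A' k ** (H ** Hi) ** (u ** v)\<^sup>\<circledast> ** hmat_pow t A' l ** (H ** B)"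
      unfolding HA[symmetric] using A' B H(1) Hi(1) u v by (simp add: hmat_assoc)
    also have "\<dots> = B\<^sup>\<circledast> ** (hmat_pow t A' k ** v\<^sup>\<circledast>) ** (u\<^sup>\<circledast> ** hmat_pow t A' l) ** C\<^sup>\<circledast>"
      unfolding Hi CB using A' B H(1) u v by (simp add: hmat_assoc hmat_adj_mult)
    also have "\<dots> = (v ** B)\<^sup>\<circledast> ** (hmat_pow t A1' k ** hmat_pow t A1' l) ** (C ** u)\<^sup>\<circledast>"
      unfolding A'v A1'u[symmetric] using A1' B C u v by (simp add: hmat_assoc hmat_adj_mult)
    also have "\<dots> = B1\<^sup>\<circledast> ** hmat_pow t A1' (k + l) ** C1\<^sup>\<circledast>"
      unfolding Cu vB hmat_pow_add[OF A1'] ..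
    also have "\<dots> = C1 ** hmat_pow t A1 (k + l) ** B1"
      unfolding A1'_def by (rule odd_antisymmetric_markov[OF A1 B1 C1 D1 odd, symmetric])
    finally show "C ** hmat_pow t A k ** (u ** v) ** hmat_pow t A l ** B
        = C ** hmat_pow t A k ** (Hi ** ((u ** v)\<^sup>\<circledast> ** H)) ** hmat_pow t A l ** B"
      using lhs by simp
  qed
  then have "H ** (u ** v) = H ** (Hi ** ((u ** v)\<^sup>\<circledast> ** H))" by (rule arg_cong)
  also have "\<dots> = (u ** v)\<^sup>\<circledast> ** H"
    by (rule mult_cancel_left[OF Hi(2)]) (use H Hi P in auto)
  finally have "(u ** v)\<^sup>\<circledast> ** H = H ** (u ** v)" by simp
  moreover have "(u ** v) ** (u ** v) = u ** v"
    using u v by (simp add: hmat_assoc mult_cancel_left[OF vu])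
  ultimately show ?thesis using P by (simp add: H_orthogonal_projection_def)
qed

lemma compressed_fun_of_summand:
  assumes u: "u \<in> carrier_mat N k" and v: "v \<in> carrier_mat k N" and vu: "v ** u = hmat_one k"
    and A': "A' \<in> carrier_mat k k" and B': "B' \<in> carrier_mat k n" and C': "C' \<in> carrier_mat n k"
    and vA: "v ** A = A' ** v" and Cu: "C ** u = C'" and vB: "v ** B = B'"
  shows "compressed_fun t (u ** v) E C A B = transfer_fun t E C' A' B'"
proof -
  have "(u ** v) ** A ** (u ** v) = u ** ((v ** A) ** u) ** v" using u v A by (simp add: hmat_assoc)
  also have "(v ** A) ** u = A'" unfolding vA using u v vu A' by (simp add: hmat_assoc)
  finally have "(u ** v) ** A ** (u ** v) = u ** A' ** v" .
  moreover have "C ** (u ** v) = C' ** v" unfolding Cu[symmetric] using u v C by (simp add: hmat_assoc)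
  moreover have "(u ** v) ** B = u ** B'" unfolding vB[symmetric] using u v B by (simp add: hmat_assoc)
  ultimately show ?thesis
    unfolding compressed_fun_def using transfer_fun_compress[OF u v vu A' B' C'] by simp
qed

lemma antisymmetric_double:
  assumes E: "E \<in> carrier_mat n n" "E = - (E\<^sup>\<circledast>)"
  shows "2 *\<^sub>H E + (2 *\<^sub>H E)\<^sup>\<circledast> = 0\<^sub>m n n" "E - E\<^sup>\<circledast> = 2 *\<^sub>H E"
proof -
  have e: "hq_conj (E $$ (j, i)) = - E $$ (i, j)" if "i < n" "j < n" for i j
  proof -
    have "E $$ (i, j) = (- (E\<^sup>\<circledast>)) $$ (i, j)" using E(2) by simp
    then show ?thesis using that E(1) by simp
  qed
  show "2 *\<^sub>H E + (2 *\<^sub>H E)\<^sup>\<circledast> = 0\<^sub>m n n" "E - E\<^sup>\<circledast> = 2 *\<^sub>H E"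
    using E(1) by (auto intro!: eq_matI simp: e scaleR_2)
qed

text \<open>
  The constant terms of the summands are \<open>D1\<close> and \<open>D2\<close>, which are anti-symmetric by oddness; this forces
  \<open>M1 = 2 D1\<close> and \<open>M2 = 2 D2\<close>.
\<close>

lemma odd_decomposition_arises:
  assumes "(\<phi>1, \<phi>2) \<in> odd_decompositions"
  obtains M1 M2 W where "(M1, M2) \<in> admissible_constants" "W \<in> admissible_subspaces"
    "subspace_decomposition t N C A B H M1 M2 W = (\<phi>1, \<phi>2)"
proof -
  have odd: "odd_antisymmetric \<phi>1" "odd_antisymmetric \<phi>2"
    and add: "\<And>x Y Y1 Y2. transfer_fun t D C A B x = Some Y \<Longrightarrow> \<phi>1 x = Some Y1 \<Longrightarrow> \<phi>2 x = Some Y2 \<Longrightarrow> Y = Y1 + Y2"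
    and deg: "\<exists>N1 N2. has_degree t n \<phi>1 N1 \<and> has_degree t n \<phi>2 N2 \<and> has_degree t n (transfer_fun t D C A B) (N1 + N2)"
    using assms unfolding odd_decompositions_def minimal_decomposition_def additive_decomposition_def by auto
  obtain N1 N2 where deg: "has_degree t n \<phi>1 N1" "has_degree t n \<phi>2 N2" "has_degree t n (transfer_fun t D C A B) (N1 + N2)"
    using deg by blast
  obtain D1 C1 A1 B1 where m1: "minimal_realization t n N1 \<phi>1 D1 C1 A1 B1" using deg(1) by (auto simp: has_degree_def)
  obtain D2 C2 A2 B2 where m2: "minimal_realization t n N2 \<phi>2 D2 C2 A2 B2" using deg(2) by (auto simp: has_degree_def)
  obtain D0 C0 A0 B0 where m0: "minimal_realization t n (N1 + N2) (transfer_fun t D C A B) D0 C0 A0 B0"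
    using deg(3) by (auto simp: has_degree_def)
  have c1: "D1 \<in> carrier_mat n n" "C1 \<in> carrier_mat n N1" "A1 \<in> carrier_mat N1 N1" "B1 \<in> carrier_mat N1 n"
    and \<phi>1: "\<phi>1 = transfer_fun t D1 C1 A1 B1"
    using m1 by (auto simp: minimal_realization_def realization_def)
  have c2: "D2 \<in> carrier_mat n n" "C2 \<in> carrier_mat n N2" "A2 \<in> carrier_mat N2 N2" "B2 \<in> carrier_mat N2 n"
    and \<phi>2: "\<phi>2 = transfer_fun t D2 C2 A2 B2"
    using m2 by (auto simp: minimal_realization_def realization_def)
  have c0: "D0 \<in> carrier_mat n n" "C0 \<in> carrier_mat n (N1 + N2)" "A0 \<in> carrier_mat (N1 + N2) (N1 + N2)" "B0 \<in> carrier_mat (N1 + N2) n"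
    and \<phi>0: "transfer_fun t D C A B = transfer_fun t D0 C0 A0 B0"
    and obs0: "markov_observable n (N1 + N2) C0 A0" and ctr0: "markov_controllable n (N1 + N2) A0 B0"
    using m0 by (auto simp: minimal_realization_def realization_def observable_iff_markov controllable_iff
        markov_observable_def markov_controllable_def)
  have "Some D = Some D0"
    using transfer_fun_at_0[OF A C B D] transfer_fun_at_0[OF c0(3,2,4,1)] \<phi>0 by simp
  then have D0: "D0 = D" by simp
  have "\<forall>\<^sub>F x in at 0. C ** resolvent A x ** B = C0 ** resolvent A0 x ** B0"
    using eventually_at_0I[OF eventually_pencil_invertible[OF A]]
      eventually_at_0I[OF eventually_pencil_invertible[OF c0(3)]] eventually_neq_at_within[of 0 0]
  proof eventually_elim
    case (elim x)
    have "D + x *\<^sub>H (C ** resolvent A x ** B) = D + x *\<^sub>H (C0 ** resolvent A0 x ** B0)"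
      using fun_cong[OF \<phi>0, of x] elim D0 by (simp add: transfer_fun_def)
    then show ?case by (rule add_scaleR_cancel[OF _ elim(3) D]) (use A B C c0 elim in auto)
  qed
  then have "C ** hmat_pow t A k ** B = C0 ** hmat_pow t A0 k ** B0" for k
    by (rule markov_eqI[OF A C c0(3,2) B c0(4)])
  \<comment> \<open>The degree of the function, attained by another minimal realization, is \<open>N\<close>.\<close>
  then have N: "N = N1 + N2"
    by (rule minimal_dim_unique[OF A B C c0(3,4,2) obs obs0 ctr ctr0])
  have D12: "D = D1 + D2"
    using add[of 0 D D1 D2] transfer_fun_at_0[OF A C B D] transfer_fun_at_0[OF c1(3,2,4,1)]
      transfer_fun_at_0[OF c2(3,2,4,1)] by (simp add: \<phi>1 \<phi>2)
  have "\<forall>\<^sub>F x in at 0. C ** resolvent A x ** B = C1 ** resolvent A1 x ** B1 + C2 ** resolvent A2 x ** B2"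
    using eventually_at_0I[OF eventually_pencil_invertible[OF A]]
      eventually_at_0I[OF eventually_pencil_invertible[OF c1(3)]]
      eventually_at_0I[OF eventually_pencil_invertible[OF c2(3)]] eventually_neq_at_within[of 0 0]
  proof eventually_elim
    case (elim x)
    define K K1 K2 where "K = C ** resolvent A x ** B" and "K1 = C1 ** resolvent A1 x ** B1"
      and "K2 = C2 ** resolvent A2 x ** B2"
    have c: "K \<in> carrier_mat n n" "K1 \<in> carrier_mat n n" "K2 \<in> carrier_mat n n"
      unfolding K_def K1_def K2_def
      by (rule carrier_hmat(1)[OF carrier_hmat(1)[OF C resolvent_carrier[OF A elim(1)]] B]
          carrier_hmat(1)[OF carrier_hmat(1)[OF c1(2) resolvent_carrier[OF c1(3) elim(2)]] c1(4)]
          carrier_hmat(1)[OF carrier_hmat(1)[OF c2(2) resolvent_carrier[OF c2(3) elim(3)]] c2(4)])+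
    have "D + x *\<^sub>H K = (D1 + x *\<^sub>H K1) + (D2 + x *\<^sub>H K2)"
      by (rule add[of x]) (use elim(1-3) in \<open>simp_all only: \<phi>1 \<phi>2 transfer_fun_def K_def K1_def K2_def if_True\<close>)
    also have "\<dots> = D + x *\<^sub>H (K1 + K2)"
      unfolding D12 using c c1(1) c2(1)
      by (intro eq_matI) (auto simp: scaleR_add_right add.assoc add.left_commute simp del: index_hmat(1))
    finally have "K = K1 + K2"
      by (rule add_scaleR_cancel[OF _ elim(4) D c(1) add_carrier_mat[OF c(3)]])
    then show ?case unfolding K_def K1_def K2_def .
  qed
  note summands = this
  obtain u1 v1 u2 v2 where
    u1: "u1 \<in> carrier_mat N N1" and v1: "v1 \<in> carrier_mat N1 N" and u2: "u2 \<in> carrier_mat N N2" and v2: "v2 \<in> carrier_mat N2 N"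
    and vu: "v1 ** u1 = hmat_one N1" "v2 ** u2 = hmat_one N2" and sum: "u1 ** v1 + u2 ** v2 = hmat_one N"
    and 1: "A ** u1 = u1 ** A1" "v1 ** A = A1 ** v1" "C ** u1 = C1" "v1 ** B = B1"
    and 2: "A ** u2 = u2 ** A2" "v2 ** A = A2 ** v2" "C ** u2 = C2" "v2 ** B = B2"
    by (rule additive_state_space[OF A B C c1(3,4,2) c2(3,4,2) obs ctr N summands])
  define P W where "P = u1 ** v1" and "W = fixed_space N P"
  have P: "H_orthogonal_projection N H P"
    unfolding P_def by (rule odd_summand_projection[OF c1(3,4,2,1) odd(1)[unfolded \<phi>1] u1 v1 vu(1) 1])
  have Pc: "P \<in> carrier_mat N N" using u1 v1 by (auto simp: P_def)
  have "A ** P = (A ** u1) ** v1" unfolding P_def using A u1 by (simp add: hmat_assoc)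
  also have "\<dots> = u1 ** (v1 ** A)" unfolding 1(1,2) using u1 c1 by (simp add: hmat_assoc)
  also have "\<dots> = P ** A" unfolding P_def using u1 v1 by (simp add: hmat_assoc)
  finally have AP: "A ** P = P ** A" .
  have "A ** f \<in> W" if "f \<in> W" for f
  proof -
    have f: "f \<in> carrier_mat N 1" "P ** f = f" using that by (auto simp: W_def fixed_space_def)
    have "P ** (A ** f) = (P ** A) ** f" using Pc A by (simp add: hmat_assoc)
    also have "\<dots> = A ** (P ** f)" unfolding AP[symmetric] using Pc A by (simp add: hmat_assoc)
    finally show ?thesis using f A by (auto simp: W_def fixed_space_def)
  qed
  then have W: "W \<in> admissible_subspaces"
    using fixed_space_subspace[OF Pc] fixed_space_nondegenerate[OF H P]
    by (auto simp: admissible_subspaces_def invariant_under_def W_def)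
  have HP: "H_projection t N H W = P" unfolding W_def by (rule H_projection_fixed_space[OF H P])
  have Q: "hmat_one N - P = u2 ** v2"
    unfolding sum[symmetric] P_def using u1 v1 u2 v2 by (intro eq_matI) (auto simp del: index_hmat(1))
  define M1 M2 where "M1 = 2 *\<^sub>H D1" and "M2 = 2 *\<^sub>H D2"
  have Dodd: "D1 = - (D1\<^sup>\<circledast>)" "D2 = - (D2\<^sup>\<circledast>)"
    using odd_antisymmetric_value_at_0[OF c1(3,4,2,1) odd(1)[unfolded \<phi>1]]
      odd_antisymmetric_value_at_0[OF c2(3,4,2,1) odd(2)[unfolded \<phi>2]] .
  have "D - D\<^sup>\<circledast> = 2 *\<^sub>H D" by (rule antisymmetric_double(2)[OF D D_odd])
  also have "\<dots> = M1 + M2"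
    unfolding M1_def M2_def D12 using c1(1) c2(1) by (intro eq_matI) (auto simp: scaleR_add_right)
  finally have "D - D\<^sup>\<circledast> = M1 + M2" .
  then have "(M1, M2) \<in> admissible_constants"
    using c1 c2 antisymmetric_double(1)[OF c1(1) Dodd(1)] antisymmetric_double(1)[OF c2(1) Dodd(2)]
    by (simp add: admissible_constants_def M1_def M2_def)
  moreover note W
  moreover have "subspace_decomposition t N C A B H M1 M2 W = (\<phi>1, \<phi>2)"
    unfolding subspace_decomposition_def HP Let_def Q
    unfolding P_def \<phi>1 \<phi>2 using compressed_fun_of_summand[OF u1 v1 vu(1) c1(3,4,2) 1(2-4)]
      compressed_fun_of_summand[OF u2 v2 vu(2) c2(3,4,2) 2(2-4)]
    by (simp add: M1_def M2_def)
  ultimately show thesis by (rule that)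
qed

lemma subspace_decomposition_bij:
  "bij_betw (\<lambda>((M1, M2), W). subspace_decomposition t N C A B H M1 M2 W)
     (admissible_constants \<times> admissible_subspaces) odd_decompositions"
  unfolding bij_betw_def
proof
  show "inj_on (\<lambda>((M1, M2), W). subspace_decomposition t N C A B H M1 M2 W)
      (admissible_constants \<times> admissible_subspaces)"
  proof (rule inj_onI)
    fix p q assume p: "p \<in> admissible_constants \<times> admissible_subspaces"
      and q: "q \<in> admissible_constants \<times> admissible_subspaces"
      and eq: "(\<lambda>((M1, M2), W). subspace_decomposition t N C A B H M1 M2 W) p =
        (\<lambda>((M1, M2), W). subspace_decomposition t N C A B H M1 M2 W) q"
    obtain M1 M2 W where p': "p = ((M1, M2), W)" by (metis prod.collapse)
    obtain M1' M2' W' where q': "q = ((M1', M2'), W')" by (metis prod.collapse)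
    have mem: "(M1, M2) \<in> admissible_constants" "(M1', M2') \<in> admissible_constants"
      "W \<in> admissible_subspaces" "W' \<in> admissible_subspaces"
      using p q unfolding p' q' by (simp_all only: mem_Times_iff fst_conv snd_conv)
    have "subspace_decomposition t N C A B H M1 M2 W = subspace_decomposition t N C A B H M1' M2' W'"
      using eq unfolding p' q' by (simp only: prod.case)
    from subspace_decomposition_inject[OF mem this] show "p = q" unfolding p' q' by simp
  qed
  show "(\<lambda>((M1, M2), W). subspace_decomposition t N C A B H M1 M2 W) `
      (admissible_constants \<times> admissible_subspaces) = odd_decompositions"
  proof
    show "(\<lambda>((M1, M2), W). subspace_decomposition t N C A B H M1 M2 W) `
        (admissible_constants \<times> admissible_subspaces) \<subseteq> odd_decompositions"
      using subspace_decomposition_mem by auto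
    show "odd_decompositions \<subseteq> (\<lambda>((M1, M2), W). subspace_decomposition t N C A B H M1 M2 W) `
        (admissible_constants \<times> admissible_subspaces)"
    proof
      fix p assume p: "p \<in> odd_decompositions"
      obtain \<phi>1 \<phi>2 where p12: "p = (\<phi>1, \<phi>2)" by (cases p)
      obtain M1 M2 W where *: "(M1, M2) \<in> admissible_constants" "W \<in> admissible_subspaces"
        "subspace_decomposition t N C A B H M1 M2 W = (\<phi>1, \<phi>2)"
        using odd_decomposition_arises p unfolding p12 by metis
      then show "p \<in> (\<lambda>((M1, M2), W). subspace_decomposition t N C A B H M1 M2 W) `
          (admissible_constants \<times> admissible_subspaces)"
        unfolding p12 by (intro image_eqI[of _ _ "((M1, M2), W)"]) auto
    qed
  qed
qed

end

theorem theorem6p2: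
  fixes t :: real and n N :: nat and \<phi> :: hfun and D C A B H :: "hq mat"
  assumes "t \<noteq> 0"
    and "rational_hfun t n \<phi>"
    and "odd_antisymmetric \<phi>"
    and "minimal_realization t n N \<phi> D C A B"
    and "associated_matrix t N C A B H"
  shows "bij_betw (\<lambda>((M1, M2), W). subspace_decomposition t N C A B H M1 M2 W)
     ({(M1, M2). M1 \<in> carrier_mat n n \<and> M2 \<in> carrier_mat n n \<and>
                 D - hmat_adj D = M1 + M2 \<and>
                 M1 + hmat_adj M1 = 0\<^sub>m n n \<and> M2 + hmat_adj M2 = 0\<^sub>m n n}
      \<times> {W. right_subspace t N W \<and> invariant_under t A W \<and> nondegenerate_H t N H W})
     {(\<phi>1, \<phi>2). minimal_decomposition t n \<phi> \<phi>1 \<phi>2 \<and>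
                odd_antisymmetric \<phi>1 \<and> odd_antisymmetric \<phi>2}"
proof -
  interpret generalized_quaternions t by standard (rule assms(1))
  have car: "D \<in> carrier_mat n n" "C \<in> carrier_mat n N" "A \<in> carrier_mat N N" "B \<in> carrier_mat N n"
    and \<phi>: "\<phi> = transfer_fun t D C A B"
    and obs: "markov_observable n N C A" and ctr: "markov_controllable n N A B"
    using assms(4) by (auto simp: minimal_realization_def realization_def observable_iff_markov controllable_iff
        markov_observable_def markov_controllable_def)
  have H: "H \<in> carrier_mat N N" "hmat_adj H = H" "hmat_invertible t H"
    and AH: "hmat_adj A ** H + H ** A = 0\<^sub>m N N" and B: "B = hmat_inv t H ** hmat_adj C"
    using assms(5) by (auto simp: associated_matrix_def hmat_symmetric_def)
  have AH': "hmat_adj A ** H = - (H ** A)"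
  proof (rule eq_matI)
    fix i j assume ij: "i < dim_row (- (H ** A))" "j < dim_col (- (H ** A))"
    have "(hmat_adj A ** H + H ** A) $$ (i, j) = 0" unfolding AH using ij H car by simp
    then show "(hmat_adj A ** H) $$ (i, j) = (- (H ** A)) $$ (i, j)"
      using ij H car by (simp add: eq_neg_iff_add_eq_0 del: index_hmat(1))
  qed (use H car in auto)
  have "H ** (hmat_inv t H ** hmat_adj C) = hmat_adj C"
    by (rule mult_cancel_left) (use hmat_invD[OF H(3,1)] H car in auto)
  then have CB: "hmat_adj C = H ** B" using B by simp
  have D: "D = - (hmat_adj D)"
    by (rule odd_antisymmetric_value_at_0[OF car(3,4,2,1) assms(3)[unfolded \<phi>]])
  interpret odd_minimal_system t n N D C A B H
    by unfold_locales (fact car obs ctr H AH' CB D)+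
  show ?thesis
    using subspace_decomposition_bij
    unfolding admissible_constants_def admissible_subspaces_def odd_decompositions_def \<phi> .
qed

end
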